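(* For any $\delta\in(0,1/2)$, any single-pass streaming algorithm with $o(n^{\delta}/\log n)$ space cannot distinguish the following two families of $n$-vertex multi-graphs (edge multiplicity $O(1)$) with constant probability better than $\frac12$: Case 1: a single expander on $n$ vertices with $m=10\,n\log n$ edges; Case 2: a collection of $t:=n^{1/2-\delta}$ vertex-disjoint expanders $G_i$, each on $n_i:=n/t=n^{1/2+\delta}$ vertices and with $m_i:=10\,n\log n/t$ edges. Here an expander means a multi-graph with edge expansion $\Omega(\log n)$.
   Context: The edge expansion of a (multi-)graph $G=(V,E)$ is $\Phi_G=\min_{S\subseteq V,\,0<|S|\le |V|/2}\frac{|\delta(S,V\setminus S)|}{|S|}$, where $\delta(S,V\setminus S)$ is the multiset of edges with exactly one endpoint in $S$. Streaming model: edges arrive one at a time in an arbitrary order, a single-pass algorithm reads them once, and its space is the maximum memory used. *)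

theory Defs
  imports "HOL-Probability.Probability" "HOL-Library.Multiset" "HOL-Library.Landau_Symbols"
begin

type_synonym edge = "nat \<times> nat"

definition cut_size :: "edge multiset \<Rightarrow> nat set \<Rightarrow> nat" where
  "cut_size E S = size (filter_mset (\<lambda>(u,v). (u \<in> S) \<noteq> (v \<in> S)) E)"

definition edge_expansion :: "nat set \<Rightarrow> edge multiset \<Rightarrow> real" where
  "edge_expansion V E =
     Min {real (cut_size E S) / real (card S) | S. S \<subseteq> V \<and> 0 < card S \<and> 2 * card S \<le> card V}"

text \<open>E is a loopless multigraph on vertex set V (an edge {u,v} is stored as (u,v) or (v,u)).\<close>
definition multigraph_on :: "nat set \<Rightarrow> edge multiset \<Rightarrow> bool" where
  "multigraph_on V E \<longleftrightarrow> (\<forall>e \<in># E. fst e \<in> V \<and> snd e \<in> V \<and> fst e \<noteq> snd e)"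

definition mult_bounded :: "nat \<Rightarrow> edge multiset \<Rightarrow> bool" where
  "mult_bounded C E \<longleftrightarrow> (\<forall>u v. u \<noteq> v \<longrightarrow> count E (u,v) + count E (v,u) \<le> C)"

definition num_edges :: "nat \<Rightarrow> nat" where
  "num_edges n = nat \<lfloor>10 * real n * ln (real n)\<rfloor>"

definition num_parts :: "real \<Rightarrow> nat \<Rightarrow> nat" where
  "num_parts \<delta> n = nat \<lfloor>real n powr (1/2 - \<delta>)\<rfloor>"

definition case1 :: "real \<Rightarrow> nat \<Rightarrow> nat \<Rightarrow> edge list \<Rightarrow> bool" where
  "case1 c C n xs \<longleftrightarrow>
     (let E = mset xs in
        length xs = num_edges n \<and> multigraph_on {..<n} E \<and> mult_bounded C E \<and>
        edge_expansion {..<n} E \<ge> c * ln (real n))"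

definition case2 :: "real \<Rightarrow> nat \<Rightarrow> real \<Rightarrow> nat \<Rightarrow> edge list \<Rightarrow> bool" where
  "case2 c C \<delta> n xs \<longleftrightarrow>
     (let E = mset xs; t = num_parts \<delta> n; m = num_edges n in
        length xs = m \<and> multigraph_on {..<n} E \<and> mult_bounded C E \<and>
        (\<exists>P :: nat \<Rightarrow> nat set.
           (\<Union>i<t. P i) = {..<n} \<and>
           (\<forall>i<t. \<forall>j<t. i \<noteq> j \<longrightarrow> P i \<inter> P j = {}) \<and>
           (\<forall>i<t. n div t \<le> card (P i) \<and> card (P i) \<le> n div t + 1) \<and>
           (\<forall>e \<in># E. \<exists>i<t. fst e \<in> P i \<and> snd e \<in> P i) \<and>
           (\<forall>i<t. let Ei = filter_mset (\<lambda>e. fst e \<in> P i) E in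
                    m div t \<le> size Ei \<and> size Ei \<le> m div t + 1 \<and>
                    edge_expansion (P i) Ei \<ge> c * ln (real n))))"

text \<open>Randomized one-pass streaming algorithm: memory states are naturals; fresh randomness
  at each step (not stored).\<close>
record salg =
  init :: "nat pmf"
  step :: "nat \<Rightarrow> edge \<Rightarrow> nat pmf"
  out  :: "nat \<Rightarrow> bool pmf"

definition space_bounded :: "nat \<Rightarrow> salg \<Rightarrow> bool" where
  "space_bounded s A \<longleftrightarrow>
     set_pmf (init A) \<subseteq> {..<2^s} \<and> (\<forall>q < 2^s. \<forall>e. set_pmf (step A q e) \<subseteq> {..<2^s})"

definition run :: "salg \<Rightarrow> edge list \<Rightarrow> nat pmf" where
  "run A xs = fold (\<lambda>e p. bind_pmf p (\<lambda>q. step A q e)) xs (init A)"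

definition accept_prob :: "salg \<Rightarrow> edge list \<Rightarrow> real" where
  "accept_prob A xs = measure_pmf.prob (bind_pmf (run A xs) (out A)) {True}"

definition distinguishes :: "real \<Rightarrow> salg \<Rightarrow> (edge list \<Rightarrow> bool) \<Rightarrow> (edge list \<Rightarrow> bool) \<Rightarrow> bool" where
  "distinguishes \<epsilon> A F1 F2 \<longleftrightarrow>
     (\<forall>xs. F1 xs \<longrightarrow> accept_prob A xs \<ge> 1/2 + \<epsilon>) \<and>
     (\<forall>xs. F2 xs \<longrightarrow> accept_prob A xs \<le> 1/2 - \<epsilon>)"

end

theory Submission
  imports Defs "HOL-Real_Asymp.Real_Asymp"
begin

text \<open>Both families are produced by one random process. The vertices are split into about n/t blocks of
  t vertices, and in each of T, about 20 H ln n, rounds a uniformly random pair of blocks (an edge of a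
  base graph on H + H vertices) is joined by a perfect matching. If the matchings are independent and
  uniform, the result is a random lift of a random base graph, which is an expander with high
  probability. If instead every block carries a hidden random labeling of its vertices by 1, ..., t, and
  the matchings join equal labels, the result consists of t disjoint copies of the base graph.

  A streaming algorithm sees the difference only through what its memory reveals about the hidden
  labelings. By the chain rule, the divergence between the memory distributions in the two cases grows
  in each round by the average, over pairs of blocks, of the divergence from uniform of the hidden
  matching given the memory state. Revealing the labels one at a time and bounding the pairwise
  correlations of label positions by a level-two inequality (an event of probability M determines a total
  squared correlation of order at most (1 + ln (1/M))^2), the sum over all pairs of blocks is
  O(t (s + 1)^2) for s bits of memory. After T rounds the divergence is O(T t (s + 1)^2 / H^2), which
  is O(t^2 (s + 1)^2 ln n / n) and tends to 0 when s = o(n^\<delta> / ln n).\<close>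

section \<open>Averages and the level-two inequality\<close>

text \<open>A single matching may fit into the memory, so no useful bound holds for a fixed pair of
  blocks. What helps is that the pair is drawn after the memory has been fixed, and that the
  level-two bound holds for the sum over all pairs at once, whatever their number. That bound
  controls only second moments of positions, while the divergence of a whole bijection is needed:
  each revealed label is therefore paid for by the chi-square divergence of one pair of positions,
  and the estimate becomes an induction on the number of labels. The divergence is taken from the
  hidden model to the independent one, because in the latter the next matching is uniform given the
  memory. The constants come from one balance. At least 18 \<open>H\<close> ln n rounds give base
  cuts of 7 ln n times their weight. Passing to the lift costs a factor 2/5 and a factor of about
  1/2, and the exponential moment must still beat the number of vertex sets, which needs a rate
  above 1: 7 * (19/40) * (2/5) - 1/20 >= 5/4. The expansion that remains is ln n / 20.\<close>

definition avg :: "'a set \<Rightarrow> ('a \<Rightarrow> real) \<Rightarrow> real" where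
  "avg A f = (\<Sum>x\<in>A. f x) / real (card A)"

lemma avg_mono: "(\<And>x. x \<in> A \<Longrightarrow> f x \<le> g x) \<Longrightarrow> avg A f \<le> avg A g"
  by (simp add: avg_def divide_right_mono sum_mono)

lemma avg_cong: "A = B \<Longrightarrow> (\<And>x. x \<in> B \<Longrightarrow> f x = g x) \<Longrightarrow> avg A f = avg B g"
  by (simp add: avg_def)

lemma avg_const: "finite A \<Longrightarrow> A \<noteq> {} \<Longrightarrow> avg A (\<lambda>_. c) = c"
  by (simp add: avg_def)

lemma avg_cmult: "avg A (\<lambda>x. c * f x) = c * avg A f"
  by (simp add: avg_def sum_distrib_left)

lemma avg_multc: "avg A (\<lambda>x. f x * c) = avg A f * c"
  by (simp add: avg_def sum_distrib_right)

lemma avg_add: "avg A (\<lambda>x. f x + g x) = avg A f + avg A g"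
  by (simp add: avg_def sum.distrib add_divide_distrib)

lemma avg_diff: "avg A (\<lambda>x. f x - g x) = avg A f - avg A g"
  by (simp add: avg_def sum_subtractf diff_divide_distrib)

lemma avg_sum: "avg A (\<lambda>x. \<Sum>i\<in>I. f i x) = (\<Sum>i\<in>I. avg A (f i))"
  unfolding avg_def by (subst sum.swap) (simp add: sum_divide_distrib)

lemma avg_swap: "avg A (\<lambda>x. avg B (f x)) = avg B (\<lambda>y. avg A (\<lambda>x. f x y))"
  unfolding avg_def by (simp add: sum_divide_distrib[symmetric] sum.swap[of f] mult.commute)

lemma avg_nonneg: "(\<And>x. x \<in> A \<Longrightarrow> 0 \<le> f x) \<Longrightarrow> 0 \<le> avg A f"
  by (simp add: avg_def sum_nonneg)

lemma avg_PiE_prod: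
  assumes "finite I" "\<And>i. i \<in> I \<Longrightarrow> finite (B i)"
  shows "avg (PiE I B) (\<lambda>x. \<Prod>i\<in>I. f i (x i)) = (\<Prod>i\<in>I. avg (B i) (f i))"
  using assms by (simp add: avg_def prod_sum_PiE card_PiE prod_dividef)

text \<open>The tail bound in Y is applied to the linear form in G' whose weights are the linear statistics
  of G in x; the size of these weights is then controlled by the tail bound in X.\<close>

lemma level_two:
  fixes G :: "'a \<Rightarrow> 'c \<Rightarrow> real" and G' :: "'b \<Rightarrow> 'd \<Rightarrow> real"
  assumes fin: "finite X" "finite Y" "finite P" "finite R" and ne: "X \<noteq> {}" "Y \<noteq> {}"
    and K: "K \<ge> 0"
    and sub: "\<And>w. avg X (\<lambda>x. exp (\<Sum>a\<in>P. w a * G x a)) \<le> exp (K * (\<Sum>a\<in>P. (w a)\<^sup>2))"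
    and sub': "\<And>w. avg Y (\<lambda>y. exp (\<Sum>b\<in>R. w b * G' y b)) \<le> exp (K * (\<Sum>b\<in>R. (w b)\<^sup>2))"
    and f0: "\<And>x y. x \<in> X \<Longrightarrow> y \<in> Y \<Longrightarrow> 0 \<le> f x y"
    and f1: "\<And>x y. x \<in> X \<Longrightarrow> y \<in> Y \<Longrightarrow> f x y \<le> 1"
    and M: "M = avg X (\<lambda>x. avg Y (f x))" "M > 0"
  shows "(\<Sum>a\<in>P. \<Sum>b\<in>R. (avg X (\<lambda>x. avg Y (\<lambda>y. f x y * (G x a * G' y b))) / M)\<^sup>2)
         \<le> (1 + K * (2 * (K+1)\<^sup>2 + 4))\<^sup>2 * (1 + ln (1/M))\<^sup>2"
proof -
  \<comment> \<open>\<open>E\<close> is the expectation under the density \<open>f / M\<close>.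
    Since f <= 1, returning to the plain average costs only a factor 1 / M
    (\<open>E_le\<close>).\<close>
  define E where "E h = avg X (\<lambda>x. avg Y (\<lambda>y. f x y * h x y)) / M" for h
  have E_mono: "E h \<le> E k" if "\<And>x y. x \<in> X \<Longrightarrow> y \<in> Y \<Longrightarrow> h x y \<le> k x y" for h k
    unfolding E_def using M(2) that f0
    by (intro divide_right_mono avg_mono mult_left_mono) auto
  have E_add: "E (\<lambda>x y. h x y + k x y) = E h + E k" for h k
    by (simp add: E_def avg_add distrib_left add_divide_distrib)
  have E_cmult: "E (\<lambda>x y. c * h x y) = c * E h" for c h
    by (simp add: E_def mult.left_commute[of _ c] avg_cmult)
  have E_sum: "E (\<lambda>x y. \<Sum>i\<in>I. h i x y) = (\<Sum>i\<in>I. E (h i))" for I :: "'e set" and h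
    by (simp add: E_def sum_distrib_left avg_sum sum_divide_distrib)
  have E_const: "E (\<lambda>x y. c) = c" for c
    using M by (simp add: E_def avg_multc)
  have E_le: "E h \<le> avg X (\<lambda>x. avg Y (\<lambda>y. h x y)) / M"
    if "\<And>x y. x \<in> X \<Longrightarrow> y \<in> Y \<Longrightarrow> 0 \<le> h x y" for h
    unfolding E_def using M(2) that f0 f1
    by (intro divide_right_mono avg_mono) (auto intro: mult_left_le_one_le)
  have M1: "M \<le> 1"
  proof -
    have "M \<le> avg X (\<lambda>x. avg Y (\<lambda>y. 1))"
      unfolding M(1) using f1 by (intro avg_mono) auto
    then show ?thesis using fin ne by (simp add: avg_const)
  qed
  define \<Gamma> where "\<Gamma> = 1 + ln (1/M)"
  have \<Gamma>1: "\<Gamma> \<ge> 1" using M1 M(2) by (simp add: \<Gamma>_def ln_div)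
  have expG: "exp (- \<Gamma>) = M * exp (-1)"
    using M(2) by (simp add: \<Gamma>_def exp_diff exp_add exp_minus ln_div field_simps)
  define m where "m a b = E (\<lambda>x y. G x a * G' y b)" for a b
  define F2 where "F2 = (\<Sum>a\<in>P. \<Sum>b\<in>R. (m a b)\<^sup>2)"
  define w where "w x b = (\<Sum>a\<in>P. m a b * G x a)" for x b
  have Ew: "E (\<lambda>x y. (w x b)\<^sup>2) \<le> (\<Sum>a\<in>P. (m a b)\<^sup>2) * (2 * (K+1)\<^sup>2 + 4) * \<Gamma>" for b
  proof (cases "(\<Sum>a\<in>P. (m a b)\<^sup>2) = 0")
    case True
    then have "w x b = 0" for x
      using fin by (simp add: w_def sum_nonneg_eq_0_iff)
    then show ?thesis using True by (simp add: E_const)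
  next
    case False
    define n2 where "n2 = (\<Sum>a\<in>P. (m a b)\<^sup>2)"
    have n2: "n2 > 0" using False sum_nonneg[of P "\<lambda>a. (m a b)\<^sup>2"] by (simp add: n2_def order_less_le)
    \<comment> \<open>The scale at which the squared weights of \<open>\<theta> * w x b\<close> add
      up to \<Gamma>, so that the exponential moment is at most \<open>exp (K * \<Gamma>)\<close>
      before the density is taken into account.\<close>
    define \<theta> where "\<theta> = sqrt (\<Gamma> / n2)"
    have th2: "\<theta>\<^sup>2 = \<Gamma> / n2" using \<Gamma>1 n2 by (simp add: \<theta>_def)
    \<comment> \<open>Truncation level: exp (- L) cancels \<open>exp (K * \<Gamma>) / M\<close> up
      to exp (- 1), so values beyond L contribute only a constant.\<close>
    define L where "L = (K+1) * \<Gamma>"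
    have pt: "v\<^sup>2 \<le> 2 * L\<^sup>2 + 4 * exp (\<bar>v\<bar> - L)" for v
    proof (cases "\<bar>v\<bar> \<le> L")
      case True
      then have "v\<^sup>2 \<le> L\<^sup>2" by (metis abs_ge_zero power2_abs power_mono)
      moreover have "0 \<le> L\<^sup>2" "0 \<le> exp (\<bar>v\<bar> - L)" by auto
      ultimately show ?thesis by linarith
    next
      case False
      define u where "u = \<bar>v\<bar> - L"
      have "u\<^sup>2 \<le> 2 * exp u"
        using exp_lower_Taylor_quadratic[of u] False by (simp add: u_def)
      moreover have "v\<^sup>2 = (L + u)\<^sup>2" by (simp add: u_def)
      moreover have "(L+u)\<^sup>2 \<le> 2 * L\<^sup>2 + 2 * u\<^sup>2"
        using zero_le_power2[of "L - u"] by (simp add: power2_eq_square algebra_simps)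
      ultimately show ?thesis by (simp add: u_def)
    qed
    have lin: "E (\<lambda>x y. exp (s * \<theta> * w x b)) \<le> exp (K * \<Gamma>) / M" if "s\<^sup>2 = 1" for s
    proof -
      have "E (\<lambda>x y. exp (s * \<theta> * w x b)) \<le> avg X (\<lambda>x. avg Y (\<lambda>y. exp (s * \<theta> * w x b))) / M"
        by (rule E_le) simp
      also have "avg X (\<lambda>x. avg Y (\<lambda>y. exp (s * \<theta> * w x b))) = avg X (\<lambda>x. exp (\<Sum>a\<in>P. (s * \<theta> * m a b) * G x a))"
        using fin ne by (simp add: avg_const w_def sum_distrib_left mult.assoc)
      also have "\<dots> \<le> exp (K * (\<Sum>a\<in>P. (s * \<theta> * m a b)\<^sup>2))" by (rule sub)
      also have "(\<Sum>a\<in>P. (s * \<theta> * m a b)\<^sup>2) = \<Gamma>"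
      proof -
        have "(\<Sum>a\<in>P. (s * \<theta> * m a b)\<^sup>2) = (s\<^sup>2 * \<theta>\<^sup>2) * n2"
          by (simp add: power_mult_distrib sum_distrib_left n2_def)
        then show ?thesis using that th2 n2 by simp
      qed
      finally show ?thesis using M(2) by (simp add: divide_right_mono)
    qed
    have "E (\<lambda>x y. (\<theta> * w x b)\<^sup>2)
        \<le> E (\<lambda>x y. 2 * L\<^sup>2 + (4 * exp (- L)) * (exp (1 * \<theta> * w x b) + exp ((-1) * \<theta> * w x b)))"
    proof (rule E_mono)
      fix x y
      define v where "v = \<theta> * w x b"
      have "exp \<bar>v\<bar> \<le> exp v + exp (- v)" by (simp add: abs_if)
      then have "4 * (exp (- L) * exp \<bar>v\<bar>) \<le> 4 * (exp (- L) * (exp v + exp (- v)))"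
        by (intro mult_left_mono) auto
      moreover have "exp (\<bar>v\<bar> - L) = exp (- L) * exp \<bar>v\<bar>"
        by (simp add: exp_diff exp_minus field_simps)
      ultimately have "v\<^sup>2 \<le> 2 * L\<^sup>2 + 4 * (exp (- L) * (exp v + exp (- v)))"
        using pt[of v] by linarith
      then show "(\<theta> * w x b)\<^sup>2 \<le> 2 * L\<^sup>2 + (4 * exp (- L)) * (exp (1 * \<theta> * w x b) + exp ((-1) * \<theta> * w x b))"
        by (simp add: v_def mult.assoc)
    qed
    also have "\<dots> = 2 * L\<^sup>2 + 4 * exp (-L) * (E (\<lambda>x y. exp (1 * \<theta> * w x b)) + E (\<lambda>x y. exp ((-1) * \<theta> * w x b)))"
      by (simp only: E_add E_cmult E_const)
    also have "\<dots> \<le> 2 * L\<^sup>2 + 4 * exp (-L) * (exp (K * \<Gamma>) / M + exp (K * \<Gamma>) / M)"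
      by (intro add_left_mono mult_left_mono add_mono lin) auto
    also have "\<dots> = 2 * L\<^sup>2 + 8 * exp (-1)"
    proof -
      have "exp (-L) * exp (K * \<Gamma>) = M * exp (-1)"
        by (simp add: L_def expG[symmetric] algebra_simps flip: exp_add)
      then show ?thesis using M(2) by (simp add: field_simps)
    qed
    also have "\<dots> \<le> 2 * L\<^sup>2 + 4"
      using exp_ge_add_one_self[of 1] by (simp add: exp_minus field_simps)
    also have "\<dots> \<le> (2 * (K+1)\<^sup>2 + 4) * \<Gamma>\<^sup>2"
    proof -
      have "1 \<le> \<Gamma>\<^sup>2" using \<Gamma>1 by simp
      moreover have "L\<^sup>2 = (K+1)\<^sup>2 * \<Gamma>\<^sup>2" by (simp only: L_def power_mult_distrib)
      ultimately show ?thesis by (simp only: distrib_right mult.assoc)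
    qed
    finally have "(\<Gamma> / n2) * E (\<lambda>x y. (w x b)\<^sup>2) \<le> (2 * (K+1)\<^sup>2 + 4) * \<Gamma>\<^sup>2"
      by (simp only: power_mult_distrib E_cmult th2)
    then have "\<Gamma> * E (\<lambda>x y. (w x b)\<^sup>2) \<le> \<Gamma> * (n2 * (2 * (K+1)\<^sup>2 + 4) * \<Gamma>)"
      using n2 by (simp add: field_simps power2_eq_square)
    then show ?thesis using \<Gamma>1 by (simp add: n2_def)
  qed
  \<comment> \<open>The Gibbs variational inequality for the density \<open>f / M\<close>, obtained
    from exp u >= 1 + u at u = h - L. Subtracting the quadratic term makes the average over Y of
    \<open>exp (h x y)\<close> at most 1 for every x; the expectation of that term is controlled by
    \<open>Ew\<close>.\<close>
  have ineq: "\<kappa> * F2 - K * \<kappa>\<^sup>2 * (F2 * (2 * (K+1)\<^sup>2 + 4) * \<Gamma>) \<le> \<Gamma>" for \<kappa> :: real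
  proof -
    define h where "h x y = \<kappa> * (\<Sum>b\<in>R. w x b * G' y b) - K * \<kappa>\<^sup>2 * (\<Sum>b\<in>R. (w x b)\<^sup>2)" for x y
    have e1: "avg X (\<lambda>x. avg Y (\<lambda>y. exp (h x y))) \<le> 1"
    proof -
      have "avg Y (\<lambda>y. exp (h x y)) \<le> 1" for x
      proof -
        have "avg Y (\<lambda>y. exp (h x y)) = avg Y (\<lambda>y. exp (\<Sum>b\<in>R. (\<kappa> * w x b) * G' y b)) * exp (- (K * (\<Sum>b\<in>R. (\<kappa> * w x b)\<^sup>2)))"
          by (simp add: h_def avg_multc[symmetric] sum_distrib_left power_mult_distrib mult.assoc flip: exp_add)
        also have "\<dots> \<le> exp (K * (\<Sum>b\<in>R. (\<kappa> * w x b)\<^sup>2)) * exp (- (K * (\<Sum>b\<in>R. (\<kappa> * w x b)\<^sup>2)))"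
          by (intro mult_right_mono sub') auto
        finally show ?thesis by (simp flip: exp_add)
      qed
      then have "avg X (\<lambda>x. avg Y (\<lambda>y. exp (h x y))) \<le> avg X (\<lambda>x. 1)" by (intro avg_mono)
      then show ?thesis using fin ne by (simp add: avg_const)
    qed
    define L where "L = ln (1/M)"
    have eL: "exp (- L) = M" using M(2) by (simp add: L_def ln_div)
    have Eexp: "E (\<lambda>x y. exp (h x y)) \<le> 1 / M"
      using E_le[of "\<lambda>x y. exp (h x y)"] divide_right_mono[OF e1, of M] M(2) by simp
    have "E h \<le> E (\<lambda>x y. (L - 1) + exp (-L) * exp (h x y))"
    proof (rule E_mono)
      fix x y show "h x y \<le> (L - 1) + exp (-L) * exp (h x y)"
        using exp_ge_add_one_self[of "h x y - L"] by (simp add: exp_diff exp_minus field_simps)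
    qed
    also have "\<dots> = L - 1 + M * E (\<lambda>x y. exp (h x y))"
      by (simp only: E_add E_cmult E_const eL)
    also have "\<dots> \<le> L - 1 + M * (1 / M)"
      by (intro add_left_mono mult_left_mono Eexp) (use M in auto)
    also have "\<dots> = L" using M(2) by simp
    finally have EhL: "E h \<le> L" .
    have "E (\<lambda>x y. \<Sum>b\<in>R. w x b * G' y b) = F2"
    proof -
      have "E (\<lambda>x y. \<Sum>b\<in>R. w x b * G' y b) = (\<Sum>b\<in>R. \<Sum>a\<in>P. E (\<lambda>x y. m a b * (G x a * G' y b)))"
        by (simp add: w_def sum_distrib_right E_sum mult.assoc)
      also have "\<dots> = (\<Sum>b\<in>R. \<Sum>a\<in>P. (m a b)\<^sup>2)"
        by (simp only: E_cmult flip: m_def) (simp add: power2_eq_square)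
      finally show ?thesis unfolding F2_def by (subst sum.swap) 
    qed
    moreover have "E h = \<kappa> * E (\<lambda>x y. \<Sum>b\<in>R. w x b * G' y b) + (- K * \<kappa>\<^sup>2) * E (\<lambda>x y. \<Sum>b\<in>R. (w x b)\<^sup>2)"
      unfolding E_cmult[symmetric] E_add[symmetric] by (simp add: h_def[abs_def])
    ultimately have "E h = \<kappa> * F2 - K * \<kappa>\<^sup>2 * (\<Sum>b\<in>R. E (\<lambda>x y. (w x b)\<^sup>2))"
      by (simp add: E_sum)
    moreover have "(\<Sum>b\<in>R. E (\<lambda>x y. (w x b)\<^sup>2)) \<le> F2 * (2 * (K+1)\<^sup>2 + 4) * \<Gamma>"
    proof -
      have "(\<Sum>b\<in>R. E (\<lambda>x y. (w x b)\<^sup>2)) \<le> (\<Sum>b\<in>R. (\<Sum>a\<in>P. (m a b)\<^sup>2) * (2 * (K+1)\<^sup>2 + 4) * \<Gamma>)"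
        by (intro sum_mono Ew)
      also have "\<dots> = F2 * (2 * (K+1)\<^sup>2 + 4) * \<Gamma>"
      proof -
        have "F2 = (\<Sum>b\<in>R. \<Sum>a\<in>P. (m a b)\<^sup>2)" unfolding F2_def by (rule sum.swap)
        then show ?thesis by (simp add: sum_distrib_right)
      qed
      finally show ?thesis .
    qed
    then have "K * \<kappa>\<^sup>2 * (\<Sum>b\<in>R. E (\<lambda>x y. (w x b)\<^sup>2)) \<le> K * \<kappa>\<^sup>2 * (F2 * (2 * (K+1)\<^sup>2 + 4) * \<Gamma>)"
      using K by (intro mult_left_mono) auto
    ultimately show ?thesis using EhL by (simp add: \<Gamma>_def L_def)
  qed
  have F2pos: "F2 \<ge> 0" by (simp add: F2_def sum_nonneg)
  have "F2 \<le> (1 + K * (2 * (K+1)\<^sup>2 + 4))\<^sup>2 * \<Gamma>\<^sup>2"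
  proof (cases "F2 = 0")
    case False
    \<comment> \<open>\<open>ineq\<close> is used at \<kappa> = 1 / F, which turns the linear term
      into F and the factor \<kappa>^2 F2 into 1.\<close>
    define F where "F = sqrt F2"
    have F: "F > 0" "F2 = F\<^sup>2" using False F2pos by (auto simp: F_def)
    have F1: "(1/F) * F2 = F" "(1/F)\<^sup>2 * F2 = 1" using F by (auto simp: power2_eq_square)
    have "K * (1/F)\<^sup>2 * (F2 * (2 * (K+1)\<^sup>2 + 4) * \<Gamma>) = ((1/F)\<^sup>2 * F2) * (K * (2 * (K+1)\<^sup>2 + 4) * \<Gamma>)"
      by (simp only: mult_ac)
    with ineq[of "1/F"] F1 have "F - K * (2 * (K+1)\<^sup>2 + 4) * \<Gamma> \<le> \<Gamma>" by simp
    then have "F \<le> (1 + K * (2 * (K+1)\<^sup>2 + 4)) * \<Gamma>" by (simp only: distrib_right mult_1_left)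
    then have "F\<^sup>2 \<le> ((1 + K * (2 * (K+1)\<^sup>2 + 4)) * \<Gamma>)\<^sup>2" using F by (intro power_mono) auto
    then show ?thesis by (simp add: F power_mult_distrib)
  qed simp
  then show ?thesis by (simp add: F2_def m_def E_def \<Gamma>_def)
qed

section \<open>Uniform random bijections\<close>

text \<open>Bijections are extensional, with value \<open>undefined\<close> outside A. This makes
  the set finite and lets deleting a point and inserting it again be exact inverses.\<close>

definition bijs :: "'a set \<Rightarrow> 'b set \<Rightarrow> ('a \<Rightarrow> 'b) set" where
  "bijs A B = {f \<in> A \<rightarrow>\<^sub>E B. bij_betw f A B}"

lemma finite_bijs: "finite A \<Longrightarrow> finite B \<Longrightarrow> finite (bijs A B)"
  by (simp add: bijs_def finite_PiE)

lemma bijsD: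
  assumes "f \<in> bijs A B"
  shows "f \<in> A \<rightarrow>\<^sub>E B" "bij_betw f A B" "inj_on f A" "f ` A = B" "\<And>a. a \<in> A \<Longrightarrow> f a \<in> B"
  using assms by (auto simp: bijs_def bij_betw_def)

lemma bijsI:
  assumes "\<And>a. a \<in> A \<Longrightarrow> f a \<in> B" "\<And>a. a \<notin> A \<Longrightarrow> f a = undefined"
    and "inj_on f A" "finite A" "finite B" "card A = card B"
  shows "f \<in> bijs A B"
proof -
  have "f ` A = B" using assms card_image[of f A] by (intro card_subset_eq) auto
  then show ?thesis using assms by (auto simp: bijs_def bij_betw_def PiE_def extensional_def)
qed

lemma bijs_upd:
  assumes y: "y \<in> bijs (A - {a}) (B - {b})" and "a \<in> A" "b \<in> B"
  shows "y(a := b) \<in> bijs A B"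
proof -
  have "bij_betw (y(a := b)) (insert a (A - {a})) (insert b (B - {b}))"
    using bijsD(2)[OF y] by (intro bij_betw_combine[of _ "{a}" "{b}", simplified] ) (auto simp: bij_betw_def inj_on_def)
  then show ?thesis using assms bijsD[OF y] by (auto simp: bijs_def insert_absorb PiE_def extensional_def)
qed

lemma bijs_del:
  assumes y: "y \<in> bijs A B" and "a \<in> A"
  shows "y(a := undefined) \<in> bijs (A - {a}) (B - {y a})"
  using bijsD(1,3,4)[OF y] assms(2)
  by (auto simp: bijs_def PiE_def extensional_def bij_betw_def inj_on_def)

text \<open>One of two decompositions of a bijection: here by the value at a fixed position, in
  \<open>bij_betw_bijs_value\<close> by the position of a fixed value. The first serves counting and
  negative association, the second the revealing of a label.\<close>

lemma bij_betw_bijs_position: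
  assumes "a \<in> A"
  shows "bij_betw (\<lambda>p. (snd p)(a := fst p)) (Sigma B (\<lambda>b. bijs (A - {a}) (B - {b}))) (bijs A B)"
proof (rule bij_betw_byWitness[where f' = "\<lambda>y. (y a, y(a := undefined))"])
  show "\<forall>p\<in>Sigma B (\<lambda>b. bijs (A - {a}) (B - {b})). (((snd p)(a := fst p)) a, ((snd p)(a := fst p))(a := undefined)) = p"
  proof
    fix p assume "p \<in> Sigma B (\<lambda>b. bijs (A - {a}) (B - {b}))"
    then have "snd p \<in> bijs (A - {a}) (B - {fst p})" by (cases p) auto
    then have "snd p \<in> (A - {a}) \<rightarrow>\<^sub>E (B - {fst p})" by (rule bijsD(1))
    then have "snd p a = undefined" by (auto simp: PiE_def extensional_def)
    then show "(((snd p)(a := fst p)) a, ((snd p)(a := fst p))(a := undefined)) = p"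
      by (simp add: fun_upd_idem prod_eq_iff)
  qed
  show "(\<lambda>y. (y a, y(a := undefined))) ` bijs A B \<subseteq> Sigma B (\<lambda>b. bijs (A - {a}) (B - {b}))"
    using assms by (auto intro: bijs_del bijsD(5))
qed (use assms in \<open>auto intro: bijs_upd\<close>)

lemma sum_bijs_position:
  assumes "finite A" "finite B" "a \<in> A"
  shows "(\<Sum>y\<in>bijs A B. F y) = (\<Sum>b\<in>B. \<Sum>y\<in>bijs (A - {a}) (B - {b}). F (y(a := b)))"
  using sum.reindex_bij_betw[OF bij_betw_bijs_position[OF assms(3)], of F B, symmetric] assms
  by (simp add: sum.Sigma finite_bijs case_prod_unfold)

lemma bij_betw_bijs_value:
  assumes b: "b \<in> B"
  shows "bij_betw (\<lambda>p. (snd p)(fst p := b)) (Sigma A (\<lambda>a. bijs (A - {a}) (B - {b}))) (bijs A B)"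
  unfolding bij_betw_def
proof
  show "inj_on (\<lambda>p. (snd p)(fst p := b)) (Sigma A (\<lambda>a. bijs (A - {a}) (B - {b})))"
  proof (rule inj_onI)
    fix p q assume p: "p \<in> Sigma A (\<lambda>a. bijs (A - {a}) (B - {b}))" and q: "q \<in> Sigma A (\<lambda>a. bijs (A - {a}) (B - {b}))"
      and eq: "(snd p)(fst p := b) = (snd q)(fst q := b)"
    have P: "fst p \<in> A" "snd p \<in> bijs (A - {fst p}) (B - {b})" using p by auto
    have Q: "fst q \<in> A" "snd q \<in> bijs (A - {fst q}) (B - {b})" using q by auto
    have f: "fst p = fst q"
      using fun_cong[OF eq, of "fst p"] bijsD(5)[OF Q(2), of "fst p"] P(1) by (auto split: if_splits)
    have "snd p (fst p) = undefined" "snd q (fst q) = undefined"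
      using bijsD(1)[OF P(2)] bijsD(1)[OF Q(2)] by (auto simp: PiE_def extensional_def)
    moreover have "snd p a = snd q a" if "a \<noteq> fst p" for a
      using fun_cong[OF eq, of a] that f by simp
    ultimately have "snd p a = snd q a" for a using f by (cases "a = fst p") auto
    then have "snd p = snd q" by (rule ext)
    then show "p = q" using f by (simp add: prod_eq_iff)
  qed
  show "(\<lambda>p. (snd p)(fst p := b)) ` Sigma A (\<lambda>a. bijs (A - {a}) (B - {b})) = bijs A B"
  proof
    show "bijs A B \<subseteq> (\<lambda>p. (snd p)(fst p := b)) ` Sigma A (\<lambda>a. bijs (A - {a}) (B - {b}))"
    proof
      fix y assume y: "y \<in> bijs A B"
      then obtain a where a: "a \<in> A" "y a = b" using bijsD(4)[OF y] b by (metis imageE)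
      have "y(a := undefined) \<in> bijs (A - {a}) (B - {b})" using bijs_del[OF y a(1)] a(2) by simp
      moreover have "y = (y(a := undefined))(a := b)" using a by auto
      ultimately show "y \<in> (\<lambda>p. (snd p)(fst p := b)) ` Sigma A (\<lambda>a. bijs (A - {a}) (B - {b}))"
        using a by (intro image_eqI[where x = "(a, y(a := undefined))"]) auto
    qed
  qed (use b in \<open>auto intro: bijs_upd\<close>)
qed

lemma card_bijs:
  assumes "finite A" "finite B" "card A = card B"
  shows "card (bijs A B) = fact (card A)"
  using assms
proof (induction "card A" arbitrary: A B)
  case 0
  then have "bijs A B = {\<lambda>_. undefined}" by (auto simp: bijs_def bij_betw_def)
  then show ?case using 0 by simp
next
  case (Suc k)
  then obtain a where a: "a \<in> A" by (metis card.empty equals0I nat.distinct(1))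
  have "card (bijs A B) = (\<Sum>b\<in>B. card (bijs (A - {a}) (B - {b})))"
    using sum_bijs_position[OF Suc.prems(1,2) a, of "\<lambda>_. 1::nat"] by simp
  also have "\<dots> = (\<Sum>b\<in>B. fact k)"
  proof (intro sum.cong refl)
    fix b assume "b \<in> B"
    moreover have "k = card (A - {a})" using Suc.hyps(2) Suc.prems(1) a by simp
    ultimately show "card (bijs (A - {a}) (B - {b})) = fact k"
      using Suc.hyps(1)[of "A - {a}" "B - {b}"] Suc.prems a by simp
  qed
  also have "\<dots> = Suc k * fact k" using Suc.hyps(2) Suc.prems(3) by simp
  also have "\<dots> = fact (card A)" using Suc.hyps(2) by (simp flip: Suc.hyps(2))
  finally show ?case .
qed

lemma bijs_nonempty:
  assumes "finite A" "finite B" "card A = card B" shows "bijs A B \<noteq> {}"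
  using card_bijs[OF assms] by force

lemma avg_bijs_position:
  assumes "finite A" "finite B" "card A = card B" "a \<in> A"
  shows "avg (bijs A B) F = avg B (\<lambda>b. avg (bijs (A - {a}) (B - {b})) (\<lambda>y. F (y(a := b))))"
proof -
  have pos: "card A > 0" using assms by (auto simp: card_gt_0_iff)
  have "card (bijs (A - {a}) (B - {b})) = fact (card A - 1)" if "b \<in> B" for b
    using assms that by (subst card_bijs) auto
  then have "avg B (\<lambda>b. avg (bijs (A - {a}) (B - {b})) (\<lambda>y. F (y(a := b))))
     = (\<Sum>y\<in>bijs A B. F y) / fact (card A - 1) / card B"
    by (simp add: avg_def sum_bijs_position[OF assms(1,2,4)] sum_divide_distrib)
  also have "\<dots> = avg (bijs A B) F"
  proof -
    have "(fact (card A) :: real) = real (card A) * fact (card A - 1)" using fact_reduce[OF pos] .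
    then show ?thesis using pos assms(3) by (simp add: avg_def card_bijs[OF assms(1-3)] mult.commute)
  qed
  finally show ?thesis by simp
qed

section \<open>Negative association and sub-Gaussian bounds for uniform bijections\<close>

lemma chebyshev_opposite:
  fixes \<phi> h :: "'a \<Rightarrow> real"
  assumes "\<And>x y. x \<in> A \<Longrightarrow> y \<in> A \<Longrightarrow> (\<phi> x - \<phi> y) * (h x - h y) \<le> 0"
  shows "avg A (\<lambda>x. \<phi> x * h x) \<le> avg A \<phi> * avg A h"
proof (cases "finite A \<and> A \<noteq> {}")
  case True
  have "avg A (\<lambda>x. avg A (\<lambda>y. (\<phi> x - \<phi> y) * (h x - h y))) \<le> avg A (\<lambda>x. avg A (\<lambda>y. 0))"
    using assms by (intro avg_mono) auto
  also have "\<dots> = 0" by (simp add: avg_def)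
  also have "(\<lambda>x. avg A (\<lambda>y. (\<phi> x - \<phi> y) * (h x - h y)))
     = (\<lambda>x. \<phi> x * h x + avg A (\<lambda>y. \<phi> y * h y) - \<phi> x * avg A h - avg A \<phi> * h x)"
  proof
    fix x
    have "(\<lambda>y. (\<phi> x - \<phi> y) * (h x - h y)) = (\<lambda>y. \<phi> x * h x + \<phi> y * h y - \<phi> x * h y - \<phi> y * h x)"
      by (auto simp: algebra_simps)
    then show "avg A (\<lambda>y. (\<phi> x - \<phi> y) * (h x - h y))
      = \<phi> x * h x + avg A (\<lambda>y. \<phi> y * h y) - \<phi> x * avg A h - avg A \<phi> * h x"
      using True by (simp add: avg_add avg_diff avg_cmult avg_multc avg_const)
  qed
  finally show ?thesis using True
    by (simp add: avg_add avg_diff avg_cmult avg_multc avg_const)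
qed (auto simp: avg_def)

text \<open>Fixing y i = b removes b from the values available elsewhere, so the average of the
  remaining product is antitone in \<open>rk b\<close> while \<open>\<phi> i\<close> is monotone;
  Chebyshev's sum inequality then splits off one factor. The argument depends on one ranking shared
  by all positions.\<close>

lemma bijs_negative_association:
  fixes \<phi> :: "'a \<Rightarrow> 'b \<Rightarrow> real" and rk :: "'b \<Rightarrow> real"
  assumes fin: "finite A" "finite B" "card A = card B" and I: "I \<subseteq> A"
    and nn: "\<And>i b. i \<in> I \<Longrightarrow> b \<in> B \<Longrightarrow> 0 \<le> \<phi> i b"
    and mono: "\<And>i b c. i \<in> I \<Longrightarrow> b \<in> B \<Longrightarrow> c \<in> B \<Longrightarrow> rk b \<le> rk c \<Longrightarrow> \<phi> i b \<le> \<phi> i c"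
  shows "avg (bijs A B) (\<lambda>y. \<Prod>i\<in>I. \<phi> i (y i)) \<le> (\<Prod>i\<in>I. avg B (\<phi> i))"
proof -
  have "finite I" using I fin finite_subset by blast
  then show ?thesis using I nn mono
  proof (induction I)
    case empty
    then show ?case using fin by (simp add: avg_const finite_bijs bijs_nonempty)
  next
    case (insert i I)
    have iA: "i \<in> A" using insert by simp
    define P where "P y = (\<Prod>j\<in>I. \<phi> j (y j))" for y
    define h where "h b = avg (bijs (A - {i}) (B - {b})) (\<lambda>y. P (y(i := b)))" for b
    have anti: "h c \<le> h b" if bc: "b \<in> B" "c \<in> B" "rk b \<le> rk c" for b c
    proof -
      \<comment> \<open>\<open>\<tau> b c\<close> writes b wherever y takes the value c. This
        carries arrangements avoiding b bijectively to those avoiding c, and for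
        \<open>rk b \<le> rk c\<close> it can only lower the factors.\<close>
      define \<tau> where "\<tau> b c y = (\<lambda>j. if j \<in> A - {i} then (if y j = c then b else y j) else undefined)" for b c :: 'b and y :: "'a \<Rightarrow> 'b"
      have t: "\<tau> b c y \<in> bijs (A - {i}) (B - {c})"
        if bc: "b \<in> B" "c \<in> B" and y: "y \<in> bijs (A - {i}) (B - {b})" for b c y
        using bijsD[OF y] bc fin iA
        by (intro bijsI) (auto simp: \<tau>_def inj_on_def)
      have tt: "\<tau> c b (\<tau> b c y) = y" if bc: "b \<in> B" "c \<in> B" and y: "y \<in> bijs (A - {i}) (B - {b})" for b c y
      proof
        fix j show "\<tau> c b (\<tau> b c y) j = y j"
          using bijsD(5)[OF y, of j] bijsD(1)[OF y] by (auto simp: \<tau>_def PiE_def extensional_def)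
      qed
      have "(\<Sum>y\<in>bijs (A - {i}) (B - {c}). P (y(i := c))) = (\<Sum>y\<in>bijs (A - {i}) (B - {b}). P ((\<tau> b c y)(i := c)))"
        using t tt bc
        by (intro sum.reindex_bij_witness[of _ "\<tau> b c" "\<tau> c b"]) auto
      also have "\<dots> \<le> (\<Sum>y\<in>bijs (A - {i}) (B - {b}). P (y(i := b)))"
      proof (rule sum_mono)
        fix y assume y: "y \<in> bijs (A - {i}) (B - {b})"
        show "P ((\<tau> b c y)(i := c)) \<le> P (y(i := b))"
          unfolding P_def
        proof (intro prod_mono conjI)
          fix j assume j: "j \<in> I"
          then have ji: "j \<noteq> i" "j \<in> A - {i}" using insert by auto
          have yj: "y j \<in> B" using bijsD(5)[OF y ji(2)] by simp
          show "0 \<le> \<phi> j (((\<tau> b c y)(i := c)) j)"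
            using insert.prems(2)[of j] j ji yj bc by (auto simp: \<tau>_def)
          show "\<phi> j (((\<tau> b c y)(i := c)) j) \<le> \<phi> j ((y(i := b)) j)"
            using insert.prems(3)[of j b c] j ji bc by (auto simp: \<tau>_def)
        qed
      qed
      finally have "(\<Sum>y\<in>bijs (A - {i}) (B - {c}). P (y(i := c))) \<le> (\<Sum>y\<in>bijs (A - {i}) (B - {b}). P (y(i := b)))" .
      moreover have "card (bijs (A - {i}) (B - {c})) = card (bijs (A - {i}) (B - {b}))"
        using bc fin iA by (simp add: card_bijs)
      ultimately show ?thesis by (simp add: h_def avg_def divide_right_mono)
    qed
    have "avg (bijs A B) (\<lambda>y. \<Prod>j\<in>insert i I. \<phi> j (y j)) = avg (bijs A B) (\<lambda>y. \<phi> i (y i) * P y)"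
      using insert by (simp add: P_def)
    also have "\<dots> = avg B (\<lambda>b. \<phi> i b * h b)"
      by (subst avg_bijs_position[OF fin iA]) (simp add: h_def avg_cmult)
    also have "\<dots> \<le> avg B (\<phi> i) * avg B h"
    proof (rule chebyshev_opposite)
      fix b c assume bc: "b \<in> B" "c \<in> B"
      show "(\<phi> i b - \<phi> i c) * (h b - h c) \<le> 0"
        using bc anti[of b c] anti[of c b] insert.prems(3)[of i b c] insert.prems(3)[of i c b]
        by (cases "rk b \<le> rk c") (auto intro: mult_nonpos_nonneg mult_nonneg_nonpos)
    qed
    also have "avg B h = avg (bijs A B) P"
      by (subst avg_bijs_position[OF fin iA]) (simp add: h_def[abs_def])
    also have "avg B (\<phi> i) * \<dots> \<le> avg B (\<phi> i) * (\<Prod>j\<in>I. avg B (\<phi> j))"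
      unfolding P_def using insert by (intro mult_left_mono insert.IH avg_nonneg) auto
    finally show ?case using insert by simp
  qed
qed

text \<open>For a centered bounded variable the linear term averages out, which leaves a bound of
  Gaussian type valid for all parameters, small or large.\<close>

lemma exp_le_add_exp_square: "exp x \<le> x + exp (x\<^sup>2)" for x :: real
proof (cases "\<bar>x\<bar> \<le> 1")
  case True
  have "exp x \<le> 1 + x + x\<^sup>2"
  proof (cases "x \<ge> 0")
    case False
    define y where "y = - x"
    have y: "y \<ge> 0" using False by (simp add: y_def)
    have "1 + y + y\<^sup>2/2 \<le> exp y" using exp_lower_Taylor_quadratic[OF y] .
    moreover have "1 \<le> (1 - y + y\<^sup>2) * (1 + y + y\<^sup>2/2)"
    proof -
      have "(1 - y + y\<^sup>2) * (1 + y + y\<^sup>2/2) = 1 + y\<^sup>2/2 + y^3/2 + y^4/2"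
        by (simp add: power2_eq_square power3_eq_cube power4_eq_xxxx field_simps)
      then show ?thesis using y by simp
    qed
    moreover have "1 - y + y\<^sup>2 \<ge> 0"
      using zero_le_power2[of "y - 1/2"] by (simp add: power2_eq_square algebra_simps)
    ultimately have "1 \<le> (1 - y + y\<^sup>2) * exp y"
      by (meson mult_left_mono order_trans)
    then have "exp (- y) \<le> 1 - y + y\<^sup>2" by (simp add: exp_minus field_simps)
    then show ?thesis by (simp add: y_def)
  qed (use True exp_bound in auto)
  then show ?thesis using exp_ge_add_one_self[of "x\<^sup>2"] by linarith
next
  case False
  show ?thesis
  proof (cases "x \<ge> 0")
    case True
    then have "exp x \<le> exp (x\<^sup>2)" using False by (simp add: power2_eq_square)
    then show ?thesis using True by linarith
  next
    case neg: False
    have "x * (x + 1) \<ge> 0" using False neg by (intro mult_nonpos_nonpos) auto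
    then have "0 \<le> x\<^sup>2 + x" by (simp add: power2_eq_square algebra_simps)
    then have "1 \<le> x + exp (x\<^sup>2)" using exp_ge_add_one_self[of "x\<^sup>2"] by linarith
    then show ?thesis using neg by (smt (verit) exp_le_one_iff)
  qed
qed

lemma avg_exp_centered:
  assumes B: "finite B" "B \<noteq> {}" and g: "\<And>b. b \<in> B \<Longrightarrow> \<bar>g b\<bar> \<le> c" "(\<Sum>b\<in>B. g b) = 0"
  shows "avg B (\<lambda>b. exp (w * g b)) \<le> exp (c\<^sup>2 * w\<^sup>2)"
proof -
  have "avg B (\<lambda>b. exp (w * g b)) \<le> avg B (\<lambda>b. w * g b + exp (c\<^sup>2 * w\<^sup>2))"
  proof (rule avg_mono)
    fix b assume "b \<in> B"
    then have "(g b)\<^sup>2 \<le> c\<^sup>2" using g(1) by (metis abs_ge_zero power2_abs power_mono)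
    then have "(w * g b)\<^sup>2 \<le> c\<^sup>2 * w\<^sup>2" by (simp add: power_mult_distrib mult.commute[of "w\<^sup>2"] mult_right_mono)
    then show "exp (w * g b) \<le> w * g b + exp (c\<^sup>2 * w\<^sup>2)"
      using exp_le_add_exp_square[of "w * g b"] by (smt (verit) exp_le_cancel_iff)
  qed
  also have "\<dots> = exp (c\<^sup>2 * w\<^sup>2)"
    using B g(2) by (simp add: avg_add avg_const avg_cmult) (simp add: avg_def)
  finally show ?thesis .
qed

lemma avg_cauchy_schwarz:
  assumes "\<And>x. x \<in> A \<Longrightarrow> 0 \<le> f x" "\<And>x. x \<in> A \<Longrightarrow> 0 \<le> g x"
    and f: "avg A (\<lambda>x. (f x)\<^sup>2) \<le> a\<^sup>2" and g: "avg A (\<lambda>x. (g x)\<^sup>2) \<le> b\<^sup>2" and ab: "a > 0" "b > 0"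
  shows "avg A (\<lambda>x. f x * g x) \<le> a * b"
proof -
  have "avg A (\<lambda>x. f x * g x) \<le> avg A (\<lambda>x. (b / (2*a)) * (f x)\<^sup>2 + (a / (2*b)) * (g x)\<^sup>2)"
  proof (rule avg_mono)
    fix x
    have "0 \<le> (b * f x - a * g x)\<^sup>2 / (2 * a * b)" using ab by simp
    also have "\<dots> = (b / (2*a)) * (f x)\<^sup>2 + (a / (2*b)) * (g x)\<^sup>2 - f x * g x"
      using ab by (simp add: field_simps power2_eq_square)
    finally show "f x * g x \<le> (b / (2*a)) * (f x)\<^sup>2 + (a / (2*b)) * (g x)\<^sup>2" by simp
  qed
  also have "\<dots> = (b / (2*a)) * avg A (\<lambda>x. (f x)\<^sup>2) + (a / (2*b)) * avg A (\<lambda>x. (g x)\<^sup>2)"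
    by (simp only: avg_add avg_cmult)
  also have "\<dots> \<le> (b / (2*a)) * a\<^sup>2 + (a / (2*b)) * b\<^sup>2"
    using f g ab by (intro add_mono mult_left_mono) auto
  also have "\<dots> = a * b" using ab by (simp add: field_simps power2_eq_square)
  finally show ?thesis .
qed

text \<open>Negative association needs factors monotone in one common order, which weights of both
  signs destroy. The positions are therefore split by the sign of w and recombined by
  Cauchy-Schwarz: squaring replaces w by 2 w, the square root halves the resulting exponent 4 c^2,
  and this gives the constant 2 c^2.\<close>

lemma bijs_subgaussian:
  assumes fin: "finite A" "finite B" "card A = card B" "B \<noteq> {}"
    and g: "\<And>b. b \<in> B \<Longrightarrow> \<bar>g b\<bar> \<le> c" "(\<Sum>b\<in>B. g b) = 0"
  shows "avg (bijs A B) (\<lambda>y. exp (\<Sum>i\<in>A. w i * g (y i))) \<le> exp (2 * c\<^sup>2 * (\<Sum>i\<in>A. (w i)\<^sup>2))"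
proof -
  define P where "P = {i\<in>A. w i \<ge> 0}"
  define N where "N = {i\<in>A. w i < 0}"
  have PN: "A = P \<union> N" "P \<inter> N = {}" "finite P" "finite N" using fin by (auto simp: P_def N_def)
  have half: "avg (bijs A B) (\<lambda>y. (exp (\<Sum>i\<in>I. w i * g (y i)))\<^sup>2) \<le> (exp (2 * c\<^sup>2 * (\<Sum>i\<in>I. (w i)\<^sup>2)))\<^sup>2"
    if I: "I \<subseteq> A" and s: "\<And>i. i \<in> I \<Longrightarrow> 0 \<le> s * w i" "s = 1 \<or> s = -1" for I and s :: real
  proof -
    have fI: "finite I" using I fin finite_subset by blast
    have "avg (bijs A B) (\<lambda>y. (exp (\<Sum>i\<in>I. w i * g (y i)))\<^sup>2)
      = avg (bijs A B) (\<lambda>y. \<Prod>i\<in>I. exp (2 * w i * g (y i)))"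
      using fI by (simp add: exp_sum[symmetric] sum_distrib_left mult.assoc flip: exp_double)
    also have "\<dots> \<le> (\<Prod>i\<in>I. avg B (\<lambda>b. exp (2 * w i * g b)))"
    proof (rule bijs_negative_association[where rk = "\<lambda>b. s * g b"])
      fix i b c assume "i \<in> I" and le: "s * g b \<le> s * g c"
      have "(s * w i) * (s * g b) \<le> (s * w i) * (s * g c)" by (rule mult_left_mono[OF le s(1)[OF \<open>i \<in> I\<close>]])
      then have "w i * g b \<le> w i * g c" using s(2) by auto
      then show "exp (2 * w i * g b) \<le> exp (2 * w i * g c)" by simp
    qed (use fin I in auto)
    also have "\<dots> \<le> (\<Prod>i\<in>I. exp (c\<^sup>2 * (2 * w i)\<^sup>2))"
      by (intro prod_mono conjI avg_nonneg avg_exp_centered[OF fin(2,4) g]) auto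
    also have "\<dots> = (exp (2 * c\<^sup>2 * (\<Sum>i\<in>I. (w i)\<^sup>2)))\<^sup>2"
      using fI by (simp add: exp_sum[symmetric] sum_distrib_left power_mult_distrib mult.assoc flip: exp_double)
        (simp add: mult_ac)
    finally show ?thesis .
  qed
  have "avg (bijs A B) (\<lambda>y. exp (\<Sum>i\<in>A. w i * g (y i)))
      = avg (bijs A B) (\<lambda>y. exp (\<Sum>i\<in>P. w i * g (y i)) * exp (\<Sum>i\<in>N. w i * g (y i)))"
    using PN by (simp add: sum.union_disjoint exp_add)
  also have "\<dots> \<le> exp (2 * c\<^sup>2 * (\<Sum>i\<in>P. (w i)\<^sup>2)) * exp (2 * c\<^sup>2 * (\<Sum>i\<in>N. (w i)\<^sup>2))"
    using half[of P 1] half[of N "-1"] by (intro avg_cauchy_schwarz) (auto simp: P_def N_def)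
  also have "\<dots> = exp (2 * c\<^sup>2 * (\<Sum>i\<in>A. (w i)\<^sup>2))"
    using PN by (simp add: sum.union_disjoint distrib_left flip: exp_add)
  finally show ?thesis .
qed

lemma PiE_bijs_subgaussian:
  assumes I: "finite I" and fin: "\<And>u. u \<in> I \<Longrightarrow> finite (A u) \<and> card (A u) = card B" "finite B" "B \<noteq> {}"
    and g: "\<And>b. b \<in> B \<Longrightarrow> \<bar>g b\<bar> \<le> c" "(\<Sum>b\<in>B. g b) = 0"
  shows "avg (PiE I (\<lambda>u. bijs (A u) B)) (\<lambda>x. exp (\<Sum>(u,a)\<in>Sigma I A. w (u,a) * g (x u a)))
     \<le> exp (2 * c\<^sup>2 * (\<Sum>p\<in>Sigma I A. (w p)\<^sup>2))"
proof -
  have "avg (PiE I (\<lambda>u. bijs (A u) B)) (\<lambda>x. exp (\<Sum>(u,a)\<in>Sigma I A. w (u,a) * g (x u a)))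
    = avg (PiE I (\<lambda>u. bijs (A u) B)) (\<lambda>x. \<Prod>u\<in>I. exp (\<Sum>a\<in>A u. w (u,a) * g (x u a)))"
    using I fin by (simp add: exp_sum[symmetric] sum.Sigma)
  also have "\<dots> = (\<Prod>u\<in>I. avg (bijs (A u) B) (\<lambda>x. exp (\<Sum>a\<in>A u. w (u,a) * g (x a))))"
    using I fin by (subst avg_PiE_prod[where f = "\<lambda>u x. exp (\<Sum>a\<in>A u. w (u,a) * g (x a))"]) (auto simp: finite_bijs)
  also have "\<dots> \<le> (\<Prod>u\<in>I. exp (2 * c\<^sup>2 * (\<Sum>a\<in>A u. (w (u,a))\<^sup>2)))"
    using fin g by (intro prod_mono conjI avg_nonneg bijs_subgaussian) auto
  also have "\<dots> = exp (2 * c\<^sup>2 * (\<Sum>p\<in>Sigma I A. (w p)\<^sup>2))"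
    using I fin by (simp add: exp_sum[symmetric] sum_distrib_left sum.Sigma case_prod_unfold)
  finally show ?thesis .
qed

section \<open>Relative entropy of a mixture of bijections\<close>

text \<open>Each summand uses the tangent bound ln z <= z - 1 at z = b i (T / S) / a i. Allowing
  \<open>S\<close> to exceed the sum of b matters in \<open>kl_bijs_mixture\<close>, where the
  reference weights sum to at most the comparison mass.\<close>

lemma log_sum_inequality:
  fixes a b :: "'i \<Rightarrow> real"
  assumes I: "finite I" and a: "\<And>i. i \<in> I \<Longrightarrow> 0 \<le> a i" and b: "\<And>i. i \<in> I \<Longrightarrow> 0 \<le> b i"
    and ab: "\<And>i. i \<in> I \<Longrightarrow> a i > 0 \<Longrightarrow> b i > 0" and S: "(\<Sum>i\<in>I. b i) \<le> S"
  shows "(\<Sum>i\<in>I. a i) * ln ((\<Sum>i\<in>I. a i) / S) \<le> (\<Sum>i\<in>I. a i * ln (a i / b i))"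
proof (cases "(\<Sum>i\<in>I. a i) = 0")
  case True
  then have "a i = 0" if "i \<in> I" for i using sum_nonneg_eq_0_iff[OF I] a that by blast
  then show ?thesis by simp
next
  case False
  define T where "T = (\<Sum>i\<in>I. a i)"
  have T: "T > 0" using False sum_nonneg[of I a] a by (simp add: T_def order_less_le)
  obtain i where i: "i \<in> I" "a i > 0" using False a by (metis order_less_le sum.neutral)
  have "0 < b i" using ab i by simp
  also have "b i \<le> (\<Sum>i\<in>I. b i)" using I b i by (intro member_le_sum) auto
  finally have S0: "S > 0" using S by simp
  have "a i * ln (T / S) + (a i - b i * (T / S)) \<le> a i * ln (a i / b i)" if i: "i \<in> I" for i
  proof (cases "a i = 0")
    case True then show ?thesis using b[OF i] T S0 by simp
  next
    case False
    then have ai: "a i > 0" "b i > 0" using a[OF i] ab[OF i] by auto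
    have "ln (b i * (T / S) / a i) \<le> b i * (T / S) / a i - 1"
      using ai T S0 by (intro ln_le_minus_one) auto
    moreover have "ln (b i * (T / S) / a i) = ln (T / S) - ln (a i / b i)"
      using ai T S0 by (simp add: ln_div ln_mult)
    ultimately have "a i * (ln (T / S) - ln (a i / b i)) \<le> a i * (b i * (T / S) / a i - 1)"
      using ai by (intro mult_left_mono) auto
    then show ?thesis using ai by (simp add: algebra_simps)
  qed
  then have "(\<Sum>i\<in>I. a i * ln (T / S) + (a i - b i * (T / S))) \<le> (\<Sum>i\<in>I. a i * ln (a i / b i))"
    by (rule sum_mono)
  moreover have "(\<Sum>i\<in>I. a i * ln (T / S) + (a i - b i * (T / S))) = T * ln (T / S) + (T - (\<Sum>i\<in>I. b i) * (T / S))"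
    by (simp only: sum.distrib sum_subtractf sum_distrib_right[symmetric] T_def)
  moreover have "(\<Sum>i\<in>I. b i) * (T / S) \<le> T"
    using mult_right_mono[OF S, of "T / S"] T S0 by simp
  ultimately show ?thesis by (simp add: T_def)
qed

text \<open>The total mass of m times the divergence of the normalized m from the uniform distribution on
  the bijections.\<close>

definition kl_bijs :: "'a set \<Rightarrow> 'b set \<Rightarrow> (('a \<Rightarrow> 'b) \<Rightarrow> real) \<Rightarrow> real" where
  "kl_bijs S S' m = (\<Sum>\<mu>\<in>bijs S S'. m \<mu> * ln (m \<mu> * fact (card S) / (\<Sum>\<nu>\<in>bijs S S'. m \<nu>)))"

lemma kl_bijs_cmult: "c > 0 \<Longrightarrow> kl_bijs S S' (\<lambda>\<mu>. c * m \<mu>) = c * kl_bijs S S' m"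
  by (simp add: kl_bijs_def sum_distrib_left mult.assoc flip: sum_distrib_left)

lemma sum_bijs_through:
  assumes "finite S" "finite S'" "a \<in> S" "b \<in> S'"
  shows "(\<Sum>\<mu>\<in>{\<mu>\<in>bijs S S'. \<mu> a = b}. F (\<mu>(a := undefined))) = (\<Sum>\<mu>\<in>bijs (S - {a}) (S' - {b}). F \<mu>)"
proof (rule sum.reindex_bij_witness[where i = "\<lambda>\<mu>. \<mu>(a := b)" and j = "\<lambda>\<mu>. \<mu>(a := undefined)"])
  fix \<mu> assume m: "\<mu> \<in> bijs (S - {a}) (S' - {b})"
  show "(\<mu>(a := b))(a := undefined) = \<mu>" using bijsD(1)[OF m] by (auto simp: PiE_def extensional_def)
  show "\<mu>(a := b) \<in> {\<mu> \<in> bijs S S'. \<mu> a = b}" using bijs_upd[OF m assms(3,4)] by simp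
qed (use assms in \<open>auto dest: bijs_del\<close>)

text \<open>A chain rule for a matching revealed in two stages: w fixes one edge, from
  \<open>\<alpha> w\<close> to \<open>\<beta> w\<close>, and \<open>m w\<close> distributes the
  rest. For a uniform matching and an independent uniform \<alpha>, the edge is uniform on S x S'.
  Beyond the divergences of the rests one thus pays the divergence of the edge from uniform, relaxed
  to a chi-square divergence by ln z <= z - 1. The last two summands are M times this chi-square
  divergence.\<close>

lemma kl_bijs_mixture:
  fixes m :: "'w \<Rightarrow> ('a \<Rightarrow> 'b) \<Rightarrow> real"
  assumes S: "finite S" "finite S'" "card S = k" "card S' = k" "k > 0" and \<Omega>: "finite \<Omega>"
    and \<alpha>: "\<And>w. w \<in> \<Omega> \<Longrightarrow> \<alpha> w \<in> S" and \<beta>: "\<And>w. w \<in> \<Omega> \<Longrightarrow> \<beta> w \<in> S'"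
    and m0: "\<And>w \<mu>. w \<in> \<Omega> \<Longrightarrow> 0 \<le> m w \<mu>"
    and Mw: "\<And>w. w \<in> \<Omega> \<Longrightarrow> Mw w = (\<Sum>\<mu>\<in>bijs (S - {\<alpha> w}) (S' - {\<beta> w}). m w \<mu>)"
    and P': "\<And>a b. a \<in> S \<Longrightarrow> b \<in> S' \<Longrightarrow> P' a b = (\<Sum>w\<in>{w\<in>\<Omega>. \<alpha> w = a \<and> \<beta> w = b}. Mw w)"
    and tot: "\<And>\<mu>. \<mu> \<in> bijs S S' \<Longrightarrow> mtot \<mu> = (\<Sum>w\<in>{w\<in>\<Omega>. \<mu> (\<alpha> w) = \<beta> w}. m w (\<mu>(\<alpha> w := undefined)))"
    and M: "M = (\<Sum>\<mu>\<in>bijs S S'. mtot \<mu>)" "M > 0"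
  shows "kl_bijs S S' mtot \<le> (\<Sum>w\<in>\<Omega>. kl_bijs (S - {\<alpha> w}) (S' - {\<beta> w}) (m w))
     + real k ^ 2 / M * (\<Sum>a\<in>S. \<Sum>b\<in>S'. (P' a b)\<^sup>2) - M"
proof -
  \<comment> \<open>The formula of \<open>P'\<close> on all pairs, also outside S x S', so that
    nonnegativity holds without side conditions.\<close>
  define P where P: "P a b = (\<Sum>w\<in>{w\<in>\<Omega>. \<alpha> w = a \<and> \<beta> w = b}. Mw w)" for a b
  define f1 :: real where "f1 = fact (k - 1)"
  have f1: "f1 > 0" "fact k = real k * f1" using S(5) by (auto simp: f1_def fact_reduce[of k])
  \<comment> \<open>\<open>L w\<close> is the density of the edge of w relative to the uniform law
    on S x S'. Dividing by it in \<open>c\<close> makes the edges equally likely in the reference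
    measure, which is why the \<open>c w\<close> compatible with one bijection sum to at most M /
    k!.\<close>
  define L where "L w = real k ^ 2 / M * P (\<alpha> w) (\<beta> w)" for w
  define c where "c w = Mw w / f1 / L w" for w
  have Mw0: "0 \<le> Mw w" if "w \<in> \<Omega>" for w using Mw that m0 by (simp add: sum_nonneg)
  have P0: "0 \<le> P a b" for a b unfolding P by (intro sum_nonneg Mw0) simp
  have Ppos: "P (\<alpha> w) (\<beta> w) > 0" if "w \<in> \<Omega>" "Mw w > 0" for w
  proof -
    have "Mw w \<le> P (\<alpha> w) (\<beta> w)" unfolding P using that Mw0 \<Omega> by (intro member_le_sum) auto
    then show ?thesis using that by simp
  qed
  have Lpos: "L w > 0" if "w \<in> \<Omega>" "Mw w > 0" for w
    using Ppos[OF that] M S(5) by (simp add: L_def)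
  have L0: "L w \<ge> 0" for w using P0 M by (simp add: L_def)
  have m_le: "m w \<mu> \<le> Mw w" if "w \<in> \<Omega>" "\<mu> \<in> bijs (S - {\<alpha> w}) (S' - {\<beta> w})" for w \<mu>
    unfolding Mw[OF that(1)] using that m0 S by (intro member_le_sum) (auto simp: finite_bijs)
  have restr: "\<mu>(\<alpha> w := undefined) \<in> bijs (S - {\<alpha> w}) (S' - {\<beta> w})"
    if "w \<in> \<Omega>" "\<mu> \<in> bijs S S'" "\<mu> (\<alpha> w) = \<beta> w" for w \<mu>
    using bijs_del[OF that(2) \<alpha>[OF that(1)]] that(3) by simp
  have step: "mtot \<mu> * ln (mtot \<mu> * fact k / M)
     \<le> (\<Sum>w\<in>{w\<in>\<Omega>. \<mu> (\<alpha> w) = \<beta> w}. m w (\<mu>(\<alpha> w := undefined)) * ln (m w (\<mu>(\<alpha> w := undefined)) / c w))"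
    if \<mu>: "\<mu> \<in> bijs S S'" for \<mu>
  proof -
    have csum: "(\<Sum>w\<in>{w\<in>\<Omega>. \<mu> (\<alpha> w) = \<beta> w}. c w) \<le> M / fact k"
    proof -
      have "(\<Sum>w\<in>{w\<in>\<Omega>. \<mu> (\<alpha> w) = \<beta> w}. c w) = (\<Sum>a\<in>S. \<Sum>w\<in>{w\<in>{w\<in>\<Omega>. \<mu> (\<alpha> w) = \<beta> w}. \<alpha> w = a}. c w)"
        using \<Omega> S \<alpha> by (intro sum.group[symmetric]) auto
      also have "\<dots> \<le> (\<Sum>a\<in>S. M / (real k ^ 2 * f1))"
      proof (rule sum_mono)
        fix a assume "a \<in> S"
        have "(\<Sum>w\<in>{w\<in>{w\<in>\<Omega>. \<mu> (\<alpha> w) = \<beta> w}. \<alpha> w = a}. c w)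
          = (\<Sum>w\<in>{w\<in>\<Omega>. \<alpha> w = a \<and> \<beta> w = \<mu> a}. Mw w * (1 / f1 / (real k ^ 2 / M * P a (\<mu> a))))"
          by (intro sum.cong) (auto simp: c_def L_def)
        also have "\<dots> = P a (\<mu> a) / f1 / (real k ^ 2 / M * P a (\<mu> a))"
          unfolding sum_distrib_right[symmetric] P[symmetric] by simp
        also have "\<dots> \<le> M / (real k ^ 2 * f1)"
          using P0[of a "\<mu> a"] f1 M S(5) by (cases "P a (\<mu> a) = 0") (auto simp: field_simps)
        finally show "(\<Sum>w\<in>{w\<in>{w\<in>\<Omega>. \<mu> (\<alpha> w) = \<beta> w}. \<alpha> w = a}. c w) \<le> M / (real k ^ 2 * f1)" .
      qed
      also have "\<dots> = M / fact k" using S f1 by (simp add: field_simps power2_eq_square)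
      finally show ?thesis .
    qed
    have "(\<Sum>w\<in>{w\<in>\<Omega>. \<mu> (\<alpha> w) = \<beta> w}. m w (\<mu>(\<alpha> w := undefined))) * ln ((\<Sum>w\<in>{w\<in>\<Omega>. \<mu> (\<alpha> w) = \<beta> w}. m w (\<mu>(\<alpha> w := undefined))) / (M / fact k))
       \<le> (\<Sum>w\<in>{w\<in>\<Omega>. \<mu> (\<alpha> w) = \<beta> w}. m w (\<mu>(\<alpha> w := undefined)) * ln (m w (\<mu>(\<alpha> w := undefined)) / c w))"
    proof (rule log_sum_inequality)
      fix w assume w: "w \<in> {w\<in>\<Omega>. \<mu> (\<alpha> w) = \<beta> w}"
      show "0 \<le> m w (\<mu>(\<alpha> w := undefined))" using w m0 by simp
      show "0 \<le> c w" using w Mw0[of w] f1 L0[of w] by (simp add: c_def)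
      assume "0 < m w (\<mu>(\<alpha> w := undefined))"
      then have "Mw w > 0" using m_le[of w] restr[of w \<mu>] w \<mu> by fastforce
      then show "c w > 0" using Lpos[of w] f1 w by (simp add: c_def)
    qed (use \<Omega> csum in auto)
    then show ?thesis unfolding tot[OF \<mu>] by simp
  qed
  have "kl_bijs S S' mtot = (\<Sum>\<mu>\<in>bijs S S'. mtot \<mu> * ln (mtot \<mu> * fact k / M))"
    by (simp add: kl_bijs_def S M(1))
  also have "\<dots> \<le> (\<Sum>\<mu>\<in>bijs S S'. \<Sum>w\<in>{w\<in>\<Omega>. \<mu> (\<alpha> w) = \<beta> w}. m w (\<mu>(\<alpha> w := undefined)) * ln (m w (\<mu>(\<alpha> w := undefined)) / c w))"
    by (intro sum_mono step)
  also have "\<dots> = (\<Sum>w\<in>\<Omega>. \<Sum>\<mu>\<in>{\<mu>\<in>bijs S S'. \<mu> (\<alpha> w) = \<beta> w}. m w (\<mu>(\<alpha> w := undefined)) * ln (m w (\<mu>(\<alpha> w := undefined)) / c w))"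
    using \<Omega> S by (intro sum.swap_restrict) (auto simp: finite_bijs)
  also have "\<dots> = (\<Sum>w\<in>\<Omega>. \<Sum>\<mu>\<in>bijs (S - {\<alpha> w}) (S' - {\<beta> w}). m w \<mu> * ln (m w \<mu> / c w))"
  proof (rule sum.cong[OF refl])
    fix w assume w: "w \<in> \<Omega>"
    show "(\<Sum>\<mu>\<in>{\<mu>\<in>bijs S S'. \<mu> (\<alpha> w) = \<beta> w}. m w (\<mu>(\<alpha> w := undefined)) * ln (m w (\<mu>(\<alpha> w := undefined)) / c w))
      = (\<Sum>\<mu>\<in>bijs (S - {\<alpha> w}) (S' - {\<beta> w}). m w \<mu> * ln (m w \<mu> / c w))"
      by (rule sum_bijs_through[OF S(1,2) \<alpha>[OF w] \<beta>[OF w], of "\<lambda>\<mu>. m w \<mu> * ln (m w \<mu> / c w)"])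
  qed
  also have "\<dots> \<le> (\<Sum>w\<in>\<Omega>. kl_bijs (S - {\<alpha> w}) (S' - {\<beta> w}) (m w) + Mw w * (L w - 1))"
  proof (rule sum_mono)
    fix w assume w: "w \<in> \<Omega>"
    have "m w \<mu> * ln (m w \<mu> / c w) \<le> m w \<mu> * ln (m w \<mu> * f1 / Mw w) + m w \<mu> * (L w - 1)"
      if \<mu>: "\<mu> \<in> bijs (S - {\<alpha> w}) (S' - {\<beta> w})" for \<mu>
    proof (cases "m w \<mu> = 0")
      case False
      then have pos: "m w \<mu> > 0" using m0[OF w, of \<mu>] by simp
      then have "Mw w > 0" using m_le[OF w \<mu>] by simp
      then have "ln (m w \<mu> / c w) = ln (m w \<mu> * f1 / Mw w) + ln (L w)"
        using pos Lpos[OF w] f1 by (simp add: c_def ln_mult ln_div)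
      then show ?thesis using ln_le_minus_one[OF Lpos[OF w \<open>Mw w > 0\<close>]] pos by (simp flip: distrib_left)
    qed simp
    then have "(\<Sum>\<mu>\<in>bijs (S - {\<alpha> w}) (S' - {\<beta> w}). m w \<mu> * ln (m w \<mu> / c w))
      \<le> (\<Sum>\<mu>\<in>bijs (S - {\<alpha> w}) (S' - {\<beta> w}). m w \<mu> * ln (m w \<mu> * f1 / Mw w) + m w \<mu> * (L w - 1))"
      by (rule sum_mono)
    also have "\<dots> = kl_bijs (S - {\<alpha> w}) (S' - {\<beta> w}) (m w) + Mw w * (L w - 1)"
      using \<alpha>[OF w] S by (simp add: sum.distrib kl_bijs_def f1_def Mw[OF w] flip: sum_distrib_right)
    finally show "(\<Sum>\<mu>\<in>bijs (S - {\<alpha> w}) (S' - {\<beta> w}). m w \<mu> * ln (m w \<mu> / c w))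
      \<le> kl_bijs (S - {\<alpha> w}) (S' - {\<beta> w}) (m w) + Mw w * (L w - 1)" .
  qed
  also have "\<dots> = (\<Sum>w\<in>\<Omega>. kl_bijs (S - {\<alpha> w}) (S' - {\<beta> w}) (m w)) + (\<Sum>w\<in>\<Omega>. Mw w * L w) - (\<Sum>w\<in>\<Omega>. Mw w)"
    by (simp add: sum.distrib sum_subtractf algebra_simps)
  also have "(\<Sum>w\<in>\<Omega>. Mw w) = M"
  proof -
    have "M = (\<Sum>\<mu>\<in>bijs S S'. \<Sum>w\<in>{w\<in>\<Omega>. \<mu> (\<alpha> w) = \<beta> w}. m w (\<mu>(\<alpha> w := undefined)))"
      by (simp add: M(1) tot)
    also have "\<dots> = (\<Sum>w\<in>\<Omega>. \<Sum>\<mu>\<in>{\<mu>\<in>bijs S S'. \<mu> (\<alpha> w) = \<beta> w}. m w (\<mu>(\<alpha> w := undefined)))"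
      using \<Omega> S by (intro sum.swap_restrict) (auto simp: finite_bijs)
    also have "\<dots> = (\<Sum>w\<in>\<Omega>. Mw w)"
    proof (rule sum.cong[OF refl])
      fix w assume w: "w \<in> \<Omega>"
      show "(\<Sum>\<mu>\<in>{\<mu>\<in>bijs S S'. \<mu> (\<alpha> w) = \<beta> w}. m w (\<mu>(\<alpha> w := undefined))) = Mw w"
        unfolding Mw[OF w] by (rule sum_bijs_through[OF S(1,2) \<alpha>[OF w] \<beta>[OF w]])
    qed
    finally show ?thesis by simp
  qed
  also have "(\<Sum>w\<in>\<Omega>. Mw w * L w) = real k ^ 2 / M * (\<Sum>a\<in>S. \<Sum>b\<in>S'. (P a b)\<^sup>2)"
  proof -
    have "(\<Sum>w\<in>\<Omega>. Mw w * L w) = (\<Sum>p\<in>S\<times>S'. \<Sum>w\<in>{w\<in>\<Omega>. (\<alpha> w, \<beta> w) = p}. Mw w * L w)"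
      using \<Omega> S \<alpha> \<beta> by (intro sum.group[symmetric]) auto
    also have "\<dots> = (\<Sum>p\<in>S\<times>S'. real k ^ 2 / M * (P (fst p) (snd p))\<^sup>2)"
    proof (rule sum.cong[OF refl])
      fix p assume "p \<in> S \<times> S'"
      have "(\<Sum>w\<in>{w\<in>\<Omega>. (\<alpha> w, \<beta> w) = p}. Mw w * L w)
        = (\<Sum>w\<in>{w\<in>\<Omega>. \<alpha> w = fst p \<and> \<beta> w = snd p}. Mw w * (real k ^ 2 / M * P (fst p) (snd p)))"
        by (intro sum.cong) (auto simp: L_def)
      then show "(\<Sum>w\<in>{w\<in>\<Omega>. (\<alpha> w, \<beta> w) = p}. Mw w * L w) = real k ^ 2 / M * (P (fst p) (snd p))\<^sup>2"
        unfolding sum_distrib_right[symmetric] P[symmetric] by (simp add: power2_eq_square)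
    qed
    finally show ?thesis by (simp add: sum.cartesian_product case_prod_unfold sum_distrib_left)
  qed
  also have "(\<Sum>a\<in>S. \<Sum>b\<in>S'. (P a b)\<^sup>2) = (\<Sum>a\<in>S. \<Sum>b\<in>S'. (P' a b)\<^sup>2)"
    by (intro sum.cong refl) (simp add: P P')
  finally show ?thesis by simp
qed

section \<open>Hidden labelings\<close>

definition signs :: "'b set \<Rightarrow> ('b \<Rightarrow> real) set" where "signs B = (B \<rightarrow>\<^sub>E {-1, 1})"

lemma avg_signs_mult:
  assumes "finite B" "b \<in> B" "c \<in> B"
  shows "avg (signs B) (\<lambda>g. g b * g c) = of_bool (b = c)"
proof (cases "b = c")
  case True
  have "g c * g c = 1" if "g \<in> signs B" for g using that assms by (auto simp: signs_def PiE_def Pi_def)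
  then have "avg (signs B) (\<lambda>g. g b * g c) = avg (signs B) (\<lambda>g. 1)" using True by (intro avg_cong) auto
  then show ?thesis using True assms by (simp add: signs_def avg_const finite_PiE PiE_eq_empty_iff)
next
  case False
  have "avg (signs B) (\<lambda>g. g b * g c) = avg (signs B) (\<lambda>g. \<Prod>i\<in>B. if i = b \<or> i = c then g i else 1)"
  proof (intro avg_cong refl)
    fix g
    have "(\<Prod>i\<in>B. if i = b \<or> i = c then g i else 1) = (\<Prod>i\<in>{b,c}. g i)"
      using assms by (intro prod.mono_neutral_cong_right) auto
    then show "g b * g c = (\<Prod>i\<in>B. if i = b \<or> i = c then g i else 1)" using False by simp
  qed
  also have "\<dots> = (\<Prod>i\<in>B. avg {-1,1} (\<lambda>s. if i = b \<or> i = c then s else 1))"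
    unfolding signs_def using assms by (intro avg_PiE_prod) auto
  also have "\<dots> = 0" using assms by (intro prod_zero) (auto intro!: bexI[of _ b] simp: avg_def)
  finally show ?thesis using False by simp
qed

text \<open>The covariance of centered random signs is the indicator of equal labels minus its
  uniform value. The centered agreement of two positions thus becomes an average of products of one
  statistic per side, the form that \<open>level_two\<close> accepts.\<close>

lemma avg_signs_centered:
  assumes "finite B" "b \<in> B" "c \<in> B"
  shows "avg (signs B) (\<lambda>g. (g b - avg B g) * (g c - avg B g)) = of_bool (b = c) - 1 / card B"
proof -
  have one: "avg (signs B) (\<lambda>g. g b * avg B g) = 1 / card B" if "b \<in> B" for b
  proof -
    have "avg (signs B) (\<lambda>g. g b * avg B g) = avg B (\<lambda>d. avg (signs B) (\<lambda>g. g b * g d))"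
      by (simp add: avg_cmult[symmetric] avg_swap[of "signs B"])
    also have "\<dots> = avg B (\<lambda>d. of_bool (b = d))"
      using assms that by (intro avg_cong refl avg_signs_mult) auto
    also have "\<dots> = 1 / card B" using assms that by (simp add: avg_def of_bool_def)
    finally show ?thesis .
  qed
  have two: "avg (signs B) (\<lambda>g. avg B g * avg B g) = 1 / card B"
  proof -
    have "avg (signs B) (\<lambda>g. avg B g * avg B g) = avg B (\<lambda>d. avg (signs B) (\<lambda>g. g d * avg B g))"
      by (subst avg_swap) (simp add: avg_multc)
    also have "\<dots> = avg B (\<lambda>d. 1 / card B)" by (intro avg_cong refl one)
    finally show ?thesis using assms avg_const[of B "1 / card B"] by auto
  qed
  have "(\<lambda>g. (g b - avg B g) * (g c - avg B g)) = (\<lambda>g. g b * g c - g b * avg B g - g c * avg B g + avg B g * avg B g)"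
    by (auto simp: algebra_simps)
  then show ?thesis using assms by (simp add: avg_add avg_diff avg_signs_mult one two)
qed

lemma avg_square_le: "(avg A h)\<^sup>2 \<le> avg A (\<lambda>x. (h x)\<^sup>2)"
proof (cases "finite A \<and> A \<noteq> {}")
  case True
  have "0 \<le> avg A (\<lambda>x. (h x - avg A h)\<^sup>2)" by (intro avg_nonneg) simp
  also have "(\<lambda>x. (h x - avg A h)\<^sup>2) = (\<lambda>x. (h x)\<^sup>2 - (2 * avg A h) * h x + (avg A h)\<^sup>2)"
    by (auto simp: power2_eq_square algebra_simps)
  also have "avg A \<dots> = avg A (\<lambda>x. (h x)\<^sup>2) - (avg A h)\<^sup>2"
    using True by (simp add: avg_add avg_diff avg_cmult avg_const) (simp add: power2_eq_square)
  finally show ?thesis by simp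
qed (auto simp: avg_def)

text \<open>The position sets depend on the block because the induction deletes a different position
  in each block; in the application they start out equal.\<close>

definition labelings :: "'i set \<Rightarrow> ('i \<Rightarrow> 'a set) \<Rightarrow> 'b set \<Rightarrow> ('i \<Rightarrow> 'a \<Rightarrow> 'b) set" where
  "labelings I A B = PiE I (\<lambda>u. bijs (A u) B)"

lemma labelings_finite_nonempty:
  assumes "finite I" "finite B" "\<And>u. u \<in> I \<Longrightarrow> finite (A u) \<and> card (A u) = card B"
  shows "finite (labelings I A B)" "labelings I A B \<noteq> {}"
  using assms by (auto simp: labelings_def finite_bijs PiE_eq_empty_iff bijs_nonempty intro!: finite_PiE)

definition agree :: "('i \<Rightarrow> 'a \<Rightarrow> 'b) set \<Rightarrow> ('j \<Rightarrow> 'c \<Rightarrow> 'b) set \<Rightarrow>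
    (('i \<Rightarrow> 'a \<Rightarrow> 'b) \<Rightarrow> ('j \<Rightarrow> 'c \<Rightarrow> 'b) \<Rightarrow> real) \<Rightarrow> 'i \<Rightarrow> 'j \<Rightarrow> 'a \<Rightarrow> 'c \<Rightarrow> real" where
  "agree X Y f u v a b = avg X (\<lambda>x. avg Y (\<lambda>y. f x y * of_bool (x u a = y v b)))"

text \<open>Random centered signs on the labels turn agreement of labels into products of linear statistics.
  Here 1329 = 1 + K (2 (K + 1)^2 + 4) with the sub-Gaussian constant K = 8.\<close>

lemma labelings_level_two:
  assumes I: "finite I" "finite J" and B: "finite B" "B \<noteq> {}"
    and A: "\<And>u. u \<in> I \<Longrightarrow> finite (A u) \<and> card (A u) = card B"
    and A': "\<And>v. v \<in> J \<Longrightarrow> finite (A' v) \<and> card (A' v) = card B"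
    and X: "X = labelings I A B" and Y: "Y = labelings J A' B"
    and f0: "\<And>x y. x \<in> X \<Longrightarrow> y \<in> Y \<Longrightarrow> 0 \<le> f x y"
    and f1: "\<And>x y. x \<in> X \<Longrightarrow> y \<in> Y \<Longrightarrow> f x y \<le> 1"
    and M: "M = avg X (\<lambda>x. avg Y (f x))" "M > 0"
  shows "(\<Sum>u\<in>I. \<Sum>v\<in>J. \<Sum>a\<in>A u. \<Sum>b\<in>A' v. (agree X Y f u v a b / M - 1 / card B)\<^sup>2)
     \<le> 1329\<^sup>2 * (1 + ln (1/M))\<^sup>2"
proof -
  have fX: "finite X" "X \<noteq> {}"
    unfolding X using labelings_finite_nonempty[where I = I and B = B and A = A] I B A by blast+
  have fY: "finite Y" "Y \<noteq> {}"
    unfolding Y using labelings_finite_nonempty[where I = J and B = B and A = A'] I B A' by blast+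
  define h where "h g b = g b - avg B g" for g :: "'c \<Rightarrow> real" and b
  define m where "m g p q = avg X (\<lambda>x. avg Y (\<lambda>y. f x y * (h g (x (fst p) (snd p)) * h g (y (fst q) (snd q))))) / M"
    for g and p q
  \<comment> \<open>Signs minus their mean are at most 2 in absolute value, so
    \<open>PiE_bijs_subgaussian\<close> yields the constant 2 * 2^2 = 8.\<close>
  have hb: "\<bar>h g b\<bar> \<le> 2" if "g \<in> signs B" "b \<in> B" for g b
  proof -
    have "\<bar>g c\<bar> \<le> 1" if "c \<in> B" for c using \<open>g \<in> signs B\<close> that by (auto simp: signs_def PiE_def Pi_def)
    then have "avg B (\<lambda>_. -1) \<le> avg B g" "avg B g \<le> avg B (\<lambda>_. 1)" "\<bar>g b\<bar> \<le> 1"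
      using \<open>b \<in> B\<close> by (auto intro!: avg_mono simp: abs_le_iff minus_le_iff)
    then show ?thesis using B by (simp add: avg_const h_def)
  qed
  have hs: "(\<Sum>b\<in>B. h g b) = 0" for g using B by (simp add: h_def sum_subtractf avg_def)
  have lev: "(\<Sum>p\<in>Sigma I A. \<Sum>q\<in>Sigma J A'. (m g p q)\<^sup>2) \<le> 1329\<^sup>2 * (1 + ln (1/M))\<^sup>2" if g: "g \<in> signs B" for g
  proof -
    have "(\<Sum>p\<in>Sigma I A. \<Sum>q\<in>Sigma J A'. (m g p q)\<^sup>2)
      \<le> (1 + 8 * (2 * (8+1)\<^sup>2 + 4))\<^sup>2 * (1 + ln (1/M))\<^sup>2"
      unfolding m_def
    proof (rule level_two)
      show "avg X (\<lambda>x. exp (\<Sum>a\<in>Sigma I A. w a * h g (x (fst a) (snd a)))) \<le> exp (8 * (\<Sum>a\<in>Sigma I A. (w a)\<^sup>2))" for w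
        using PiE_bijs_subgaussian[OF I(1) A B hb[OF g] hs, where w = w]
        by (simp add: X labelings_def case_prod_unfold)
      show "avg Y (\<lambda>x. exp (\<Sum>a\<in>Sigma J A'. w a * h g (x (fst a) (snd a)))) \<le> exp (8 * (\<Sum>a\<in>Sigma J A'. (w a)\<^sup>2))" for w
        using PiE_bijs_subgaussian[OF I(2) A' B hb[OF g] hs, where w = w]
        by (simp add: Y labelings_def case_prod_unfold)
    qed (use fX fY f0 f1 M I A A' in auto)
    then show ?thesis by simp
  qed
  have inB: "x u a \<in> B" if "x \<in> X" "u \<in> I" "a \<in> A u" for x u a
    using that by (auto simp: X labelings_def dest!: PiE_mem bijsD(5))
  have inB': "y v b \<in> B" if "y \<in> Y" "v \<in> J" "b \<in> A' v" for y v b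
    using that by (auto simp: Y labelings_def dest!: PiE_mem bijsD(5))
  have rep: "agree X Y f u v a b / M - 1 / card B = avg (signs B) (\<lambda>g. m g (u,a) (v,b))"
    if ab: "u \<in> I" "v \<in> J" "a \<in> A u" "b \<in> A' v" for u v a b
  proof -
    have "avg (signs B) (\<lambda>g. m g (u,a) (v,b))
      = avg X (\<lambda>x. avg Y (\<lambda>y. avg (signs B) (\<lambda>g. f x y * (h g (x u a) * h g (y v b))))) / M"
      by (simp add: m_def divide_inverse avg_multc avg_swap[of "signs B"])
    also have "avg X (\<lambda>x. avg Y (\<lambda>y. avg (signs B) (\<lambda>g. f x y * (h g (x u a) * h g (y v b)))))
      = avg X (\<lambda>x. avg Y (\<lambda>y. f x y * (of_bool (x u a = y v b) - 1 / card B)))"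
      unfolding h_def avg_cmult
      using B inB inB' ab by (intro avg_cong refl) (simp add: avg_signs_centered)
    also have "\<dots> = agree X Y f u v a b - M * (1 / card B)"
      by (simp only: right_diff_distrib avg_diff avg_multc M(1) agree_def)
    finally show ?thesis using M(2) by (simp add: diff_divide_distrib)
  qed
  have "(\<Sum>u\<in>I. \<Sum>v\<in>J. \<Sum>a\<in>A u. \<Sum>b\<in>A' v. (agree X Y f u v a b / M - 1 / card B)\<^sup>2)
     = (\<Sum>u\<in>I. \<Sum>v\<in>J. \<Sum>a\<in>A u. \<Sum>b\<in>A' v. (avg (signs B) (\<lambda>g. m g (u,a) (v,b)))\<^sup>2)"
    by (intro sum.cong refl) (simp add: rep)
  also have "\<dots> \<le> (\<Sum>u\<in>I. \<Sum>v\<in>J. \<Sum>a\<in>A u. \<Sum>b\<in>A' v. avg (signs B) (\<lambda>g. (m g (u,a) (v,b))\<^sup>2))"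
    by (intro sum_mono avg_square_le)
  also have "\<dots> = avg (signs B) (\<lambda>g. \<Sum>u\<in>I. \<Sum>v\<in>J. \<Sum>a\<in>A u. \<Sum>b\<in>A' v. (m g (u,a) (v,b))\<^sup>2)"
    by (simp add: avg_sum)
  also have "\<dots> = avg (signs B) (\<lambda>g. \<Sum>p\<in>Sigma I A. \<Sum>q\<in>Sigma J A'. (m g p q)\<^sup>2)"
  proof (intro avg_cong refl)
    fix g
    have "(\<Sum>u\<in>I. \<Sum>v\<in>J. \<Sum>a\<in>A u. \<Sum>b\<in>A' v. (m g (u,a) (v,b))\<^sup>2)
      = (\<Sum>u\<in>I. \<Sum>a\<in>A u. \<Sum>v\<in>J. \<Sum>b\<in>A' v. (m g (u,a) (v,b))\<^sup>2)"
      by (intro sum.cong refl sum.swap)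
    also have "\<dots> = (\<Sum>p\<in>Sigma I A. \<Sum>q\<in>Sigma J A'. (m g p q)\<^sup>2)"
    proof -
      have "(\<Sum>v\<in>J. \<Sum>b\<in>A' v. (m g p (v,b))\<^sup>2) = (\<Sum>q\<in>Sigma J A'. (m g p q)\<^sup>2)" for p
        using I A' by (subst sum.Sigma) (auto simp: case_prod_unfold)
      moreover have "(\<Sum>u\<in>I. \<Sum>a\<in>A u. G (u,a)) = (\<Sum>p\<in>Sigma I A. G p)" for G :: "_ \<Rightarrow> real"
        using I A by (subst sum.Sigma) (auto simp: case_prod_unfold)
      ultimately show ?thesis by simp
    qed
    finally show "(\<Sum>u\<in>I. \<Sum>v\<in>J. \<Sum>a\<in>A u. \<Sum>b\<in>A' v. (m g (u,a) (v,b))\<^sup>2) = (\<Sum>p\<in>Sigma I A. \<Sum>q\<in>Sigma J A'. (m g p q)\<^sup>2)" .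
  qed
  also have "\<dots> \<le> avg (signs B) (\<lambda>g. 1329\<^sup>2 * (1 + ln (1/M))\<^sup>2)" by (intro avg_mono lev)
  also have "\<dots> = 1329\<^sup>2 * (1 + ln (1/M))\<^sup>2"
    using B by (intro avg_const) (auto simp: signs_def finite_PiE PiE_eq_empty_iff)
  finally show ?thesis .
qed

text \<open>The unnormalized law, under the density f, of the hidden matching between blocks u and
  v. It is phrased as agreement of labels, equivalent to \<mu> = \<open>matching\<close> by
  \<open>matching_unique\<close>, because this condition factors when one label is removed.\<close>

definition match_mass :: "('i \<Rightarrow> 'a \<Rightarrow> 'b) set \<Rightarrow> ('j \<Rightarrow> 'c \<Rightarrow> 'b) set \<Rightarrow> 'a set \<Rightarrow>
    (('i \<Rightarrow> 'a \<Rightarrow> 'b) \<Rightarrow> ('j \<Rightarrow> 'c \<Rightarrow> 'b) \<Rightarrow> real) \<Rightarrow> 'i \<Rightarrow> 'j \<Rightarrow> ('a \<Rightarrow> 'c) \<Rightarrow> real" where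
  "match_mass X Y S f u v \<mu> = avg X (\<lambda>x. avg Y (\<lambda>y. f x y * of_bool (\<forall>a\<in>S. y v (\<mu> a) = x u a)))"

definition matching :: "'a set \<Rightarrow> 'c set \<Rightarrow> ('a \<Rightarrow> 'b) \<Rightarrow> ('c \<Rightarrow> 'b) \<Rightarrow> 'a \<Rightarrow> 'c" where
  "matching S S' p q = (\<lambda>a\<in>S. the_inv_into S' q (p a))"

lemma matching_bijs:
  assumes "p \<in> bijs S B" "q \<in> bijs S' B" "finite S" "finite S'" "finite B"
  shows "matching S S' p q \<in> bijs S S'" and "a \<in> S \<Longrightarrow> q (matching S S' p q a) = p a"
proof -
  note p = bijsD[OF assms(1)] and q = bijsD[OF assms(2)]
  have m: "matching S S' p q a \<in> S' \<and> q (matching S S' p q a) = p a" if "a \<in> S" for a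
    using that p(5)[OF that] q(3,4) by (auto simp: matching_def f_the_inv_into_f intro!: the_inv_into_into)
  have "inj_on (matching S S' p q) S"
  proof (rule inj_onI)
    fix a b assume "a \<in> S" "b \<in> S" "matching S S' p q a = matching S S' p q b"
    then show "a = b" using m[of a] m[of b] inj_onD[OF p(3), of a b] by simp
  qed
  moreover have "card S = card S'" using bij_betw_same_card[OF p(2)] bij_betw_same_card[OF q(2)] by simp
  ultimately show "matching S S' p q \<in> bijs S S'"
    using m assms by (intro bijsI) (auto simp: matching_def)
  show "a \<in> S \<Longrightarrow> q (matching S S' p q a) = p a" using m by simp
qed

lemma matching_unique:
  assumes "p \<in> bijs S B" "q \<in> bijs S' B" "finite S" "finite S'" "finite B" "\<mu> \<in> bijs S S'"
  shows "(\<forall>a\<in>S. q (\<mu> a) = p a) \<longleftrightarrow> \<mu> = matching S S' p q"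
proof
  assume *: "\<forall>a\<in>S. q (\<mu> a) = p a"
  show "\<mu> = matching S S' p q"
  proof
    fix a
    note mb = matching_bijs[OF assms(1-5)]
    show "\<mu> a = matching S S' p q a"
    proof (cases "a \<in> S")
      case True
      then have "q (\<mu> a) = q (matching S S' p q a)" using * mb(2) by simp
      then show ?thesis using bijsD(3)[OF assms(2)] bijsD(5)[OF assms(6) True] bijsD(5)[OF mb(1) True]
        by (auto dest: inj_onD)
    qed (use bijsD(1)[OF assms(6)] in \<open>auto simp: matching_def PiE_def extensional_def\<close>)
  qed
qed (use matching_bijs[OF assms(1-5)] in auto)

lemma sum_matching:
  assumes "p \<in> bijs S B" "q \<in> bijs S' B" "finite S" "finite S'" "finite B"
  shows "(\<Sum>\<mu>\<in>bijs S S'. of_bool (\<forall>a\<in>S. q (\<mu> a) = p a)) = (1::real)"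
proof -
  have "(\<Sum>\<mu>\<in>bijs S S'. of_bool (\<forall>a\<in>S. q (\<mu> a) = p a)) = (\<Sum>\<mu>\<in>bijs S S'. of_bool (\<mu> = matching S S' p q) :: real)"
    using matching_unique[OF assms] by (intro sum.cong) auto
  also have "\<dots> = 1" using matching_bijs(1)[OF assms] assms by (simp add: of_bool_def finite_bijs)
  finally show ?thesis .
qed

lemma sum_match_mass:
  assumes "u \<in> I" "v \<in> J" "finite B" "finite (A u)" "finite (A' v)"
  shows "(\<Sum>\<mu>\<in>bijs (A u) (A' v). match_mass (labelings I A B) (labelings J A' B) (A u) f u v \<mu>)
     = avg (labelings I A B) (\<lambda>x. avg (labelings J A' B) (f x))"
  unfolding match_mass_def avg_sum[symmetric] sum_distrib_left[symmetric]
proof (intro avg_cong refl)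
  fix x y assume "x \<in> labelings I A B" "y \<in> labelings J A' B"
  then have "x u \<in> bijs (A u) B" "y v \<in> bijs (A' v) B" using assms by (auto simp: labelings_def)
  from sum_matching[OF this assms(4,5,3)]
  show "f x y * (\<Sum>\<mu>\<in>bijs (A u) (A' v). of_bool (\<forall>a\<in>A u. y v (\<mu> a) = x u a)) = f x y"
    by (simp only: mult_1_right)
qed

section \<open>Revealing one label at a time: divergence of the hidden matchings\<close>

definition extend :: "'i set \<Rightarrow> 'b \<Rightarrow> ('i \<Rightarrow> 'a) \<Rightarrow> ('i \<Rightarrow> 'a \<Rightarrow> 'b) \<Rightarrow> 'i \<Rightarrow> 'a \<Rightarrow> 'b" where
  "extend I l z x = (\<lambda>u\<in>I. (x u)(z u := l))"

text \<open>\<open>bij_betw_bijs_value\<close> applied in every block at once. The position of l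
  varies freely from block to block, and what remains is a labeling problem with one label
  fewer.\<close>

lemma bij_betw_extend:
  assumes l: "l \<in> B"
  shows "bij_betw (\<lambda>p. extend I l (fst p) (snd p))
     (Sigma (PiE I A) (\<lambda>z. labelings I (\<lambda>u. A u - {z u}) (B - {l}))) (labelings I A B)"
  unfolding bij_betw_def
proof
  let ?D = "Sigma (PiE I A) (\<lambda>z. labelings I (\<lambda>u. A u - {z u}) (B - {l}))"
  let ?P = "\<lambda>u. Sigma (A u) (\<lambda>a. bijs (A u - {a}) (B - {l}))"
  have comp: "(fst p u, snd p u) \<in> ?P u" if "p \<in> ?D" "u \<in> I" for p u
    using that by (auto simp: labelings_def PiE_def Pi_def)
  have bb: "bij_betw (\<lambda>p. (snd p)(fst p := l)) (?P u) (bijs (A u) B)" for u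
    by (rule bij_betw_bijs_value[OF l])
  show "inj_on (\<lambda>p. extend I l (fst p) (snd p)) ?D"
  proof (rule inj_onI)
    fix p q assume p: "p \<in> ?D" and q: "q \<in> ?D" and eq: "extend I l (fst p) (snd p) = extend I l (fst q) (snd q)"
    have e: "(fst p u, snd p u) = (fst q u, snd q u)" if u: "u \<in> I" for u
      using fun_cong[OF eq, of u] u
      by (intro inj_onD[OF bij_betw_imp_inj_on[OF bb[of u]] _ comp[OF p u] comp[OF q u]]) (simp add: extend_def)
    have "fst p \<in> PiE I A" "fst q \<in> PiE I A" "snd p \<in> extensional I" "snd q \<in> extensional I"
      using p q by (auto simp: labelings_def PiE_def)
    then have "fst p = fst q" "snd p = snd q"
      using e by (auto intro!: extensionalityI[of _ I] simp: PiE_def)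
    then show "p = q" by (simp add: prod_eq_iff)
  qed
  show "(\<lambda>p. extend I l (fst p) (snd p)) ` ?D = labelings I A B"
  proof
    show "(\<lambda>p. extend I l (fst p) (snd p)) ` ?D \<subseteq> labelings I A B"
    proof (rule image_subsetI)
      fix p assume p: "p \<in> ?D"
      show "extend I l (fst p) (snd p) \<in> labelings I A B"
        unfolding labelings_def
      proof (rule PiE_I)
        fix u assume u: "u \<in> I"
        have "extend I l (fst p) (snd p) u = (\<lambda>p. (snd p)(fst p := l)) (fst p u, snd p u)" using u by (simp add: extend_def)
        then show "extend I l (fst p) (snd p) u \<in> bijs (A u) B"
          using bij_betw_apply[OF bb[of u] comp[OF p u]] by simp
      qed (simp add: extend_def)
    qed
    show "labelings I A B \<subseteq> (\<lambda>p. extend I l (fst p) (snd p)) ` ?D"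
    proof
      fix x assume x: "x \<in> labelings I A B"
      have "\<forall>u\<in>I. \<exists>r. r \<in> ?P u \<and> (snd r)(fst r := l) = x u"
      proof
        fix u assume "u \<in> I"
        then have "x u \<in> bijs (A u) B" using x by (auto simp: labelings_def)
        then have "x u \<in> (\<lambda>p. (snd p)(fst p := l)) ` ?P u" using bij_betw_imp_surj_on[OF bb[of u]] by simp
        then obtain r where "x u = (snd r)(fst r := l)" "r \<in> ?P u" by (rule imageE)
        then show "\<exists>r. r \<in> ?P u \<and> (snd r)(fst r := l) = x u" by (intro exI[of _ r]) simp
      qed
      from bchoice[OF this] obtain r where r: "\<And>u. u \<in> I \<Longrightarrow> r u \<in> ?P u \<and> (snd (r u))(fst (r u) := l) = x u" by blast
      define p where "p = ((\<lambda>u\<in>I. fst (r u)), (\<lambda>u\<in>I. snd (r u)))"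
      have "p \<in> ?D"
      proof -
        have "fst (r u) \<in> A u" "snd (r u) \<in> bijs (A u - {fst (r u)}) (B - {l})" if "u \<in> I" for u
          using r[OF that] by (cases "r u"; simp)+
        then show ?thesis by (auto simp: p_def labelings_def)
      qed
      moreover have "extend I l (fst p) (snd p) = x"
      proof
        fix u show "extend I l (fst p) (snd p) u = x u"
        proof (cases "u \<in> I")
          case True then show ?thesis using r[OF True] by (simp add: p_def extend_def)
        next
          case False
          then have "x u = undefined" using x unfolding labelings_def by (rule PiE_arb[rotated])
          then show ?thesis using False by (simp add: extend_def)
        qed
      qed
      ultimately show "x \<in> (\<lambda>p. extend I l (fst p) (snd p)) ` ?D" by (intro image_eqI[where x = p]) simp_all
    qed
  qed
qed

lemma avg_labelings_extend:
  assumes I: "finite I" and B: "finite B" "l \<in> B"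
    and A: "\<And>u. u \<in> I \<Longrightarrow> finite (A u) \<and> card (A u) = card B"
  shows "avg (labelings I A B) F = avg (PiE I A) (\<lambda>z. avg (labelings I (\<lambda>u. A u - {z u}) (B - {l})) (\<lambda>x. F (extend I l z x)))"
proof -
  define c where "c = (fact (card B - 1) :: real) ^ card I"
  let ?L = "\<lambda>z. labelings I (\<lambda>u. A u - {z u}) (B - {l})"
  have fin: "finite (PiE I A)" "finite (?L z)" for z
    using I A B by (auto simp: labelings_def intro!: finite_PiE finite_bijs)
  have card: "real (card (?L z)) = c" if z: "z \<in> PiE I A" for z
  proof -
    have "card (bijs (A u - {z u}) (B - {l})) = fact (card B - 1)" if "u \<in> I" for u
      using that z A[OF that] B by (subst card_bijs) (auto simp: PiE_mem)
    then show ?thesis using I by (simp add: labelings_def card_PiE c_def)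
  qed
  have "card (labelings I A B) = card (Sigma (PiE I A) ?L)"
    using bij_betw_same_card[OF bij_betw_extend[OF B(2), of I A]] by simp
  also have "real \<dots> = card (PiE I A) * c" using fin card by simp
  finally have cardX: "real (card (labelings I A B)) = card (PiE I A) * c" .
  have "(\<Sum>x\<in>labelings I A B. F x) = (\<Sum>p\<in>Sigma (PiE I A) ?L. F (extend I l (fst p) (snd p)))"
    by (rule sum.reindex_bij_betw[OF bij_betw_extend[OF B(2), of I A], symmetric])
  also have "\<dots> = (\<Sum>z\<in>PiE I A. \<Sum>x\<in>?L z. F (extend I l z x))"
    using fin by (subst sum.Sigma) (auto simp: case_prod_unfold)
  finally have "avg (labelings I A B) F = (\<Sum>z\<in>PiE I A. (\<Sum>x\<in>?L z. F (extend I l z x)) / c) / card (PiE I A)"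
    by (simp add: avg_def cardX sum_divide_distrib mult.commute)
  also have "\<dots> = avg (PiE I A) (\<lambda>z. avg (?L z) (\<lambda>x. F (extend I l z x)))"
    using card by (simp add: avg_def)
  finally show ?thesis .
qed

lemma avg_Times: "finite A \<Longrightarrow> finite B \<Longrightarrow> avg (A \<times> B) F = avg A (\<lambda>a. avg B (\<lambda>b. F (a, b)))"
proof -
  have "(\<Sum>p\<in>A \<times> B. F p) = (\<Sum>a\<in>A. \<Sum>b\<in>B. F (a, b))" by (simp add: sum.cartesian_product)
  then show ?thesis by (simp add: avg_def sum_divide_distrib[symmetric] card_cartesian_product mult.commute)
qed

text \<open>Reveal the positions of one random label in every block. The quadratic term bounds the divergence
  of the pair of positions in blocks u and v; the average is the same quantity for the other labels.\<close>

lemma kl_match_step: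
  fixes f :: "('i \<Rightarrow> 'a \<Rightarrow> 'b) \<Rightarrow> ('j \<Rightarrow> 'c \<Rightarrow> 'b) \<Rightarrow> real"
  assumes I: "finite I" "finite J" and B: "finite B" "card B = Suc k"
    and A: "\<And>u. u \<in> I \<Longrightarrow> finite (A u) \<and> card (A u) = card B"
    and A': "\<And>v. v \<in> J \<Longrightarrow> finite (A' v) \<and> card (A' v) = card B"
    and uv: "u \<in> I" "v \<in> J"
    and f0: "\<And>x y. x \<in> labelings I A B \<Longrightarrow> y \<in> labelings J A' B \<Longrightarrow> 0 \<le> f x y"
    and M: "M = avg (labelings I A B) (\<lambda>x. avg (labelings J A' B) (f x))" "M > 0"
  shows "kl_bijs (A u) (A' v) (match_mass (labelings I A B) (labelings J A' B) (A u) f u v)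
    \<le> M * (\<Sum>a\<in>A u. \<Sum>b\<in>A' v. (agree (labelings I A B) (labelings J A' B) f u v a b / M - 1 / card B)\<^sup>2)
     + avg (B \<times> PiE I A \<times> PiE J A') (\<lambda>(l, z, z').
         kl_bijs (A u - {z u}) (A' v - {z' v})
           (match_mass (labelings I (\<lambda>u. A u - {z u}) (B - {l})) (labelings J (\<lambda>v. A' v - {z' v}) (B - {l}))
             (A u - {z u}) (\<lambda>x y. f (extend I l z x) (extend J l z' y)) u v))"
proof -
  let ?X = "labelings I A B" and ?Y = "labelings J A' B"
  let ?X' = "\<lambda>l z. labelings I (\<lambda>u. A u - {z u}) (B - {l})" and ?Y' = "\<lambda>l z. labelings J (\<lambda>v. A' v - {z v}) (B - {l})"
  \<comment> \<open>A revealed label with its position in every block of both sides. Positions are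
    revealed in all blocks, not only in u and v, so that the same reduced problem serves every
    pair.\<close>
  define \<Omega> where "\<Omega> = B \<times> PiE I A \<times> PiE J A'"
  have Bne: "B \<noteq> {}" using B by auto
  have Ane: "PiE I A \<noteq> {}" "PiE J A' \<noteq> {}" using A A' B by (fastforce simp: PiE_eq_empty_iff)+
  have finP: "finite (PiE I A)" "finite (PiE J A')" using I A A' by (auto intro!: finite_PiE)
  have \<Omega>: "finite \<Omega>" "\<Omega> \<noteq> {}" using B finP Bne Ane by (auto simp: \<Omega>_def)
  define n where "n = real (card \<Omega>)"
  have n: "n > 0" using \<Omega> by (simp add: n_def card_gt_0_iff)
  have dec: "avg ?X (\<lambda>x. avg ?Y (\<lambda>y. H x y)) = avg (PiE I A) (\<lambda>z. avg (PiE J A') (\<lambda>z'. avg (?X' l z) (\<lambda>x. avg (?Y' l z') (\<lambda>y. H (extend I l z x) (extend J l z' y)))))"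
    if l: "l \<in> B" for l H
  proof -
    have eX: "avg ?X F = avg (PiE I A) (\<lambda>z. avg (?X' l z) (\<lambda>x. F (extend I l z x)))" for F
      by (rule avg_labelings_extend) (use I B A l in auto)
    have eY: "avg ?Y F = avg (PiE J A') (\<lambda>z. avg (?Y' l z) (\<lambda>x. F (extend J l z x)))" for F
      by (rule avg_labelings_extend) (use I B A' l in auto)
    have "avg ?X (\<lambda>x. avg ?Y (\<lambda>y. H x y))
      = avg (PiE I A) (\<lambda>z. avg (?X' l z) (\<lambda>x. avg (PiE J A') (\<lambda>z'. avg (?Y' l z') (\<lambda>y. H (extend I l z x) (extend J l z' y)))))"
      by (simp only: eX eY)
    also have "\<dots> = avg (PiE I A) (\<lambda>z. avg (PiE J A') (\<lambda>z'. avg (?X' l z) (\<lambda>x. avg (?Y' l z') (\<lambda>y. H (extend I l z x) (extend J l z' y)))))"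
      by (intro avg_cong refl) (rule avg_swap)
    finally show ?thesis .
  qed
  have dec\<Omega>: "avg B (\<lambda>l. avg ?X (\<lambda>x. avg ?Y (\<lambda>y. H l x y)))
      = avg \<Omega> (\<lambda>(l,z,z'). avg (?X' l z) (\<lambda>x. avg (?Y' l z') (\<lambda>y. H l (extend I l z x) (extend J l z' y))))" for H
  proof -
    have "avg B (\<lambda>l. avg ?X (\<lambda>x. avg ?Y (\<lambda>y. H l x y))) = avg B (\<lambda>l. avg (PiE I A) (\<lambda>z. avg (PiE J A') (\<lambda>z'. avg (?X' l z) (\<lambda>x. avg (?Y' l z') (\<lambda>y. H l (extend I l z x) (extend J l z' y))))))"
      by (intro avg_cong refl dec)
    then show ?thesis using B finP by (simp add: \<Omega>_def avg_Times)
  qed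
  define \<alpha> where "\<alpha> w = (case w of (l, z, z') \<Rightarrow> z u)" for w :: "'b \<times> ('i \<Rightarrow> 'a) \<times> ('j \<Rightarrow> 'c)"
  define \<beta> where "\<beta> w = (case w of (l, z, z') \<Rightarrow> z' v)" for w :: "'b \<times> ('i \<Rightarrow> 'a) \<times> ('j \<Rightarrow> 'c)"
  define mass where "mass w = (case w of (l, z, z') \<Rightarrow>
     match_mass (?X' l z) (?Y' l z') (A u - {z u}) (\<lambda>x y. f (extend I l z x) (extend J l z' y)) u v)" for w
  define Mw where "Mw w = (case w of (l, z, z') \<Rightarrow> (1/n) *
     avg (?X' l z) (\<lambda>x. avg (?Y' l z') (\<lambda>y. f (extend I l z x) (extend J l z' y))))" for w
  have extX: "extend I l z x \<in> ?X" if "l \<in> B" "z \<in> PiE I A" "x \<in> ?X' l z" for l z x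
    using bij_betw_apply[OF bij_betw_extend[OF that(1), of I A], of "(z, x)"] that by simp
  have extY: "extend J l z y \<in> ?Y" if "l \<in> B" "z \<in> PiE J A'" "y \<in> ?Y' l z" for l z y
    using bij_betw_apply[OF bij_betw_extend[OF that(1), of J A'], of "(z, y)"] that by simp
  \<comment> \<open>This equivalence supplies the hypothesis \<open>tot\<close> of the mixture
    lemma. An edge at another position cannot end at \<open>z' v\<close>, because \<mu> is
    injective.\<close>
  have agr: "(\<forall>a\<in>A u. extend J l z' y v (\<mu> a) = extend I l z x u a)
      \<longleftrightarrow> \<mu> (z u) = z' v \<and> (\<forall>a\<in>A u - {z u}. y v ((\<mu>(z u := undefined)) a) = x u a)"
    if w: "l \<in> B" "z \<in> PiE I A" "z' \<in> PiE J A'" "x \<in> ?X' l z" "y \<in> ?Y' l z'" and \<mu>: "\<mu> \<in> bijs (A u) (A' v)"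
    for l z z' x y \<mu>
  proof -
    have zu: "z u \<in> A u" using w uv by auto
    have xu: "x u \<in> bijs (A u - {z u}) (B - {l})" and yv: "y v \<in> bijs (A' v - {z' v}) (B - {l})"
      using w uv by (auto simp: labelings_def)
    have \<mu>zu: "\<mu> (z u) \<in> A' v" using bijsD(5)[OF \<mu> zu] .
    have at: "extend J l z' y v (\<mu> (z u)) = extend I l z x u (z u) \<longleftrightarrow> \<mu> (z u) = z' v"
      using uv bijsD(5)[OF yv, of "\<mu> (z u)"] \<mu>zu by (auto simp: extend_def)
    have oth: "extend J l z' y v (\<mu> a) = extend I l z x u a \<longleftrightarrow> y v ((\<mu>(z u := undefined)) a) = x u a"
      if "\<mu> (z u) = z' v" "a \<in> A u - {z u}" for a
    proof -
      have "\<mu> a \<noteq> z' v" using inj_onD[OF bijsD(3)[OF \<mu>], of a "z u"] that zu by auto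
      then show ?thesis using uv that by (auto simp: extend_def)
    qed
    show ?thesis using at oth zu by blast
  qed
  have "kl_bijs (A u) (A' v) (match_mass ?X ?Y (A u) f u v)
    \<le> (\<Sum>w\<in>\<Omega>. kl_bijs (A u - {\<alpha> w}) (A' v - {\<beta> w}) (\<lambda>\<mu>. (1/n) * mass w \<mu>))
      + real (card B) ^ 2 / M * (\<Sum>a\<in>A u. \<Sum>b\<in>A' v. (M / card B * (agree ?X ?Y f u v a b / M))\<^sup>2) - M"
  proof (rule kl_bijs_mixture[where Mw = Mw])
    show "finite (A u)" "finite (A' v)" "card (A u) = card B" "card (A' v) = card B" using A A' uv by auto
    show "card B > 0" using B by simp
    show "\<alpha> w \<in> A u" if "w \<in> \<Omega>" for w using that uv by (auto simp: \<Omega>_def \<alpha>_def)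
    show "\<beta> w \<in> A' v" if "w \<in> \<Omega>" for w using that uv by (auto simp: \<Omega>_def \<beta>_def)
    show "0 \<le> 1 / n * mass w \<mu>" if "w \<in> \<Omega>" for w \<mu>
    proof -
      obtain l z z' where w: "w = (l, z, z')" by (cases w)
      have "0 \<le> mass w \<mu>"
        using that unfolding w mass_def match_mass_def prod.case
        by (intro avg_nonneg mult_nonneg_nonneg f0 extX extY) (auto simp: \<Omega>_def)
      then show ?thesis using n by simp
    qed
    show "Mw w = (\<Sum>\<mu>\<in>bijs (A u - {\<alpha> w}) (A' v - {\<beta> w}). 1 / n * mass w \<mu>)" if "w \<in> \<Omega>" for w
    proof -
      obtain l z z' where w: "w = (l, z, z')" by (cases w)
      show ?thesis
        using sum_match_mass[OF uv, where B = "B - {l}" and A = "\<lambda>u. A u - {z u}" and A' = "\<lambda>v. A' v - {z' v}"] A A' B uv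
        by (simp add: w \<alpha>_def \<beta>_def mass_def Mw_def flip: sum_divide_distrib)
    qed
    \<comment> \<open>Because l is averaged over all labels and not fixed, the law of the pair of
      positions is the probability of equal labels divided by the number of labels, which is the
      quantity that \<open>labelings_level_two\<close> bounds.\<close>
    show "M / card B * (agree ?X ?Y f u v a b / M) = (\<Sum>w\<in>{w\<in>\<Omega>. \<alpha> w = a \<and> \<beta> w = b}. Mw w)"
      if ab: "a \<in> A u" "b \<in> A' v" for a b
    proof -
      have "(\<Sum>w\<in>{w\<in>\<Omega>. \<alpha> w = a \<and> \<beta> w = b}. Mw w) = (\<Sum>w\<in>\<Omega>. of_bool (\<alpha> w = a \<and> \<beta> w = b) * Mw w)"
        using \<Omega> by (intro sum.mono_neutral_cong_left) auto
      also have "\<dots> = avg \<Omega> (\<lambda>w. of_bool (\<alpha> w = a \<and> \<beta> w = b) * (n * Mw w))"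
        using n by (simp add: avg_def[of \<Omega>] sum_divide_distrib flip: n_def)
      also have "\<dots> = avg \<Omega> (\<lambda>(l,z,z'). avg (?X' l z) (\<lambda>x. avg (?Y' l z') (\<lambda>y. f (extend I l z x) (extend J l z' y) * of_bool (extend I l z x u a = l \<and> extend J l z' y v b = l))))"
      proof (intro avg_cong refl)
        fix w assume w: "w \<in> \<Omega>"
        obtain l z z' where lz: "w = (l, z, z')" by (cases w)
        have "avg (?X' l z) (\<lambda>x. avg (?Y' l z') (\<lambda>y. f (extend I l z x) (extend J l z' y) * of_bool (extend I l z x u a = l \<and> extend J l z' y v b = l)))
          = avg (?X' l z) (\<lambda>x. avg (?Y' l z') (\<lambda>y. of_bool (z u = a \<and> z' v = b) * f (extend I l z x) (extend J l z' y)))"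
        proof (intro avg_cong refl)
          fix x y assume x: "x \<in> ?X' l z" and y: "y \<in> ?Y' l z'"
          have xu: "x u \<in> bijs (A u - {z u}) (B - {l})" and yv: "y v \<in> bijs (A' v - {z' v}) (B - {l})"
            using x y uv by (auto simp: labelings_def)
          have "z u = a \<longleftrightarrow> extend I l z x u a = l"
            using bijsD(5)[OF xu, of a] uv ab by (auto simp: extend_def)
          moreover have "z' v = b \<longleftrightarrow> extend J l z' y v b = l"
            using bijsD(5)[OF yv, of b] uv ab by (auto simp: extend_def)
          ultimately show "f (extend I l z x) (extend J l z' y) * of_bool (extend I l z x u a = l \<and> extend J l z' y v b = l)
            = of_bool (z u = a \<and> z' v = b) * f (extend I l z x) (extend J l z' y)"
            by simp
        qed
        then show "of_bool (\<alpha> w = a \<and> \<beta> w = b) * (n * Mw w) = (case w of (l,z,z') \<Rightarrow> avg (?X' l z) (\<lambda>x. avg (?Y' l z') (\<lambda>y. f (extend I l z x) (extend J l z' y) * of_bool (extend I l z x u a = l \<and> extend J l z' y v b = l))))"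
          using n by (simp add: lz \<alpha>_def \<beta>_def Mw_def avg_cmult)
      qed
      also have "\<dots> = avg B (\<lambda>l. avg ?X (\<lambda>x. avg ?Y (\<lambda>y. f x y * of_bool (x u a = l \<and> y v b = l))))"
        by (rule dec\<Omega>[symmetric])
      also have "\<dots> = avg ?X (\<lambda>x. avg ?Y (\<lambda>y. avg B (\<lambda>l. f x y * of_bool (x u a = l \<and> y v b = l))))"
        by (subst avg_swap) (intro avg_cong refl avg_swap)
      also have "\<dots> = avg ?X (\<lambda>x. avg ?Y (\<lambda>y. f x y * of_bool (x u a = y v b) * (1 / card B)))"
      proof (intro avg_cong refl)
        fix x y assume "x \<in> ?X" "y \<in> ?Y"
        then have "x u a \<in> B" "y v b \<in> B" using uv ab by (auto simp: labelings_def dest!: PiE_mem bijsD(5))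
        then have "(\<Sum>l\<in>B. of_bool (x u a = l \<and> y v b = l)) = (of_bool (x u a = y v b) :: real)"
          using B by (cases "x u a = y v b") (auto simp: of_bool_def intro!: sum.neutral)
        then show "avg B (\<lambda>l. f x y * of_bool (x u a = l \<and> y v b = l)) = f x y * of_bool (x u a = y v b) * (1 / card B)"
          by (simp only: avg_cmult avg_def) simp
      qed
      also have "\<dots> = M / card B * (agree ?X ?Y f u v a b / M)"
        unfolding avg_multc agree_def using M(2) by simp
      finally show ?thesis ..
    qed
    show "match_mass ?X ?Y (A u) f u v \<mu> = (\<Sum>w\<in>{w\<in>\<Omega>. \<mu> (\<alpha> w) = \<beta> w}. 1 / n * mass w (\<mu>(\<alpha> w := undefined)))"
      if \<mu>: "\<mu> \<in> bijs (A u) (A' v)" for \<mu>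
    proof -
      have "match_mass ?X ?Y (A u) f u v \<mu> = avg B (\<lambda>l. match_mass ?X ?Y (A u) f u v \<mu>)"
        using B Bne by (simp add: avg_const)
      also have "\<dots> = avg \<Omega> (\<lambda>(l,z,z'). avg (?X' l z) (\<lambda>x. avg (?Y' l z') (\<lambda>y. f (extend I l z x) (extend J l z' y) * of_bool (\<forall>a\<in>A u. extend J l z' y v (\<mu> a) = extend I l z x u a))))"
        unfolding match_mass_def by (rule dec\<Omega>)
      also have "\<dots> = avg \<Omega> (\<lambda>w. of_bool (\<mu> (\<alpha> w) = \<beta> w) * mass w (\<mu>(\<alpha> w := undefined)))"
      proof (intro avg_cong refl)
        fix w assume w: "w \<in> \<Omega>"
        obtain l z z' where lz: "w = (l, z, z')" by (cases w)
        have "avg (?X' l z) (\<lambda>x. avg (?Y' l z') (\<lambda>y. f (extend I l z x) (extend J l z' y) * of_bool (\<forall>a\<in>A u. extend J l z' y v (\<mu> a) = extend I l z x u a)))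
          = avg (?X' l z) (\<lambda>x. avg (?Y' l z') (\<lambda>y. of_bool (\<mu> (z u) = z' v) * (f (extend I l z x) (extend J l z' y) * of_bool (\<forall>a\<in>A u - {z u}. y v ((\<mu>(z u := undefined)) a) = x u a))))"
          using w by (intro avg_cong refl) (subst agr[OF _ _ _ _ _ \<mu>], auto simp: \<Omega>_def lz)
        then show "(case w of (l,z,z') \<Rightarrow> avg (?X' l z) (\<lambda>x. avg (?Y' l z') (\<lambda>y. f (extend I l z x) (extend J l z' y) * of_bool (\<forall>a\<in>A u. extend J l z' y v (\<mu> a) = extend I l z x u a))))
          = of_bool (\<mu> (\<alpha> w) = \<beta> w) * mass w (\<mu>(\<alpha> w := undefined))"
          by (simp only: lz \<alpha>_def \<beta>_def mass_def match_mass_def avg_cmult prod.case)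
      qed
      also have "\<dots> = (\<Sum>w\<in>\<Omega>. of_bool (\<mu> (\<alpha> w) = \<beta> w) * (1 / n * mass w (\<mu>(\<alpha> w := undefined))))"
        by (simp add: avg_def n_def sum_divide_distrib)
      also have "\<dots> = (\<Sum>w\<in>{w\<in>\<Omega>. \<mu> (\<alpha> w) = \<beta> w}. 1 / n * mass w (\<mu>(\<alpha> w := undefined)))"
        using \<Omega> by (intro sum.mono_neutral_cong_right) auto
      finally show ?thesis .
    qed
    show "M = (\<Sum>\<mu>\<in>bijs (A u) (A' v). match_mass ?X ?Y (A u) f u v \<mu>)"
      using A A' uv B by (simp add: M(1) sum_match_mass)
    show "finite \<Omega>" "M > 0" using \<Omega> M by blast+
  qed
  moreover have "(\<Sum>w\<in>\<Omega>. kl_bijs (A u - {\<alpha> w}) (A' v - {\<beta> w}) (\<lambda>\<mu>. (1/n) * mass w \<mu>))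
    = avg \<Omega> (\<lambda>w. kl_bijs (A u - {\<alpha> w}) (A' v - {\<beta> w}) (mass w))"
    using n by (subst kl_bijs_cmult) (simp_all add: avg_def n_def sum_divide_distrib)
  moreover have "avg \<Omega> (\<lambda>w. kl_bijs (A u - {\<alpha> w}) (A' v - {\<beta> w}) (mass w)) = avg \<Omega> (\<lambda>(l, z, z').
         kl_bijs (A u - {z u}) (A' v - {z' v})
           (match_mass (?X' l z) (?Y' l z') (A u - {z u}) (\<lambda>x y. f (extend I l z x) (extend J l z' y)) u v))"
    by (intro avg_cong) (auto simp: mass_def \<alpha>_def \<beta>_def)
  \<comment> \<open>Every position of block u has its label at exactly one position of block v, so
    the normalized agreements sum to \<open>card B\<close>; expanding the square then shows that the
    chi-square term is the sum of centered squares.\<close>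
  moreover have "real (card B) ^ 2 / M * (\<Sum>a\<in>A u. \<Sum>b\<in>A' v. (M / card B * (agree ?X ?Y f u v a b / M))\<^sup>2) - M
    = M * (\<Sum>a\<in>A u. \<Sum>b\<in>A' v. (agree ?X ?Y f u v a b / M - 1 / card B)\<^sup>2)"
  proof -
    define p where "p a b = agree ?X ?Y f u v a b / M" for a b
    define K where "K = real (card B)"
    have K: "K > 0" using B by (simp add: K_def)
    have "(\<Sum>a\<in>A u. \<Sum>b\<in>A' v. agree ?X ?Y f u v a b)
       = avg ?X (\<lambda>x. avg ?Y (\<lambda>y. f x y * (\<Sum>a\<in>A u. \<Sum>b\<in>A' v. of_bool (x u a = y v b))))"
      by (simp add: agree_def avg_sum sum_distrib_left)
    also have "\<dots> = avg ?X (\<lambda>x. avg ?Y (\<lambda>y. f x y * K))"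
    proof (intro avg_cong refl)
      fix x y assume "x \<in> ?X" "y \<in> ?Y"
      then have xu: "x u \<in> bijs (A u) B" and yv: "y v \<in> bijs (A' v) B" using uv by (auto simp: labelings_def)
      have "(\<Sum>b\<in>A' v. of_bool (x u a = y v b)) = (1::real)" if a: "a \<in> A u" for a
      proof -
        have "(\<Sum>b\<in>A' v. of_bool (x u a = y v b)) = (\<Sum>c\<in>B. of_bool (x u a = c) :: real)"
          by (rule sum.reindex_bij_betw[OF bijsD(2)[OF yv]])
        then show ?thesis using bijsD(5)[OF xu a] B by (simp add: of_bool_def)
      qed
      then show "f x y * (\<Sum>a\<in>A u. \<Sum>b\<in>A' v. of_bool (x u a = y v b)) = f x y * K"
        using A uv by (simp add: K_def)
    qed
    also have "\<dots> = M * K" by (simp add: avg_multc M(1))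
    finally have ps: "(\<Sum>a\<in>A u. \<Sum>b\<in>A' v. p a b) = K"
      using M(2) by (simp add: p_def flip: sum_divide_distrib)
    have "(\<Sum>a\<in>A u. \<Sum>b\<in>A' v. (p a b - 1/K)\<^sup>2)
       = (\<Sum>a\<in>A u. \<Sum>b\<in>A' v. (p a b)\<^sup>2 - 2/K * p a b + 1/K\<^sup>2)"
      using K by (intro sum.cong refl) (simp add: power2_eq_square field_simps)
    also have "\<dots> = (\<Sum>a\<in>A u. \<Sum>b\<in>A' v. (p a b)\<^sup>2) - 2/K * (\<Sum>a\<in>A u. \<Sum>b\<in>A' v. p a b) + K * (K * (1/K\<^sup>2))"
      using A A' uv by (simp add: sum.distrib sum_subtractf sum_distrib_left K_def)
    also have "\<dots> = (\<Sum>a\<in>A u. \<Sum>b\<in>A' v. (p a b)\<^sup>2) - 1"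
      using K by (simp add: ps power2_eq_square)
    finally have "M * (\<Sum>a\<in>A u. \<Sum>b\<in>A' v. (p a b - 1/K)\<^sup>2) = M * (\<Sum>a\<in>A u. \<Sum>b\<in>A' v. (p a b)\<^sup>2) - M"
      by (simp add: right_diff_distrib)
    moreover have "K\<^sup>2 / M * (\<Sum>a\<in>A u. \<Sum>b\<in>A' v. (M / K * p a b)\<^sup>2) = M * (\<Sum>a\<in>A u. \<Sum>b\<in>A' v. (p a b)\<^sup>2)"
      unfolding sum_distrib_left using K M(2) by (intro sum.cong refl) (simp add: power2_eq_square field_simps)
    ultimately show ?thesis unfolding p_def K_def by linarith
  qed
  ultimately show ?thesis unfolding \<Omega>_def by linarith
qed

lemma extend_labelings:
  assumes "l \<in> B" "z \<in> PiE I A" "x \<in> labelings I (\<lambda>u. A u - {z u}) (B - {l})"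
  shows "extend I l z x \<in> labelings I A B"
  using bij_betw_apply[OF bij_betw_extend[OF assms(1), of I A], of "(z, x)"] assms by simp

lemma kl_bijs_nonneg:
  assumes "finite S" "finite S'" "card S = card S'" and m: "\<And>\<mu>. \<mu> \<in> bijs S S' \<Longrightarrow> 0 \<le> m \<mu>"
  shows "0 \<le> kl_bijs S S' m"
proof -
  define M where "M = (\<Sum>\<mu>\<in>bijs S S'. m \<mu>)"
  have le: "m \<mu> \<le> M" if "\<mu> \<in> bijs S S'" for \<mu>
    unfolding M_def using that m assms by (intro member_le_sum) (auto simp: finite_bijs)
  have M0: "M \<ge> 0" by (simp add: M_def m sum_nonneg)
  have "M * ln (M / M) \<le> (\<Sum>\<mu>\<in>bijs S S'. m \<mu> * ln (m \<mu> / (M / fact (card S))))"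
    unfolding M_def[symmetric]
  proof (subst (1 2) M_def, rule log_sum_inequality)
    fix \<mu> assume \<mu>: "\<mu> \<in> bijs S S'"
    show "0 \<le> m \<mu>" by (rule m[OF \<mu>])
    show "0 \<le> M / fact (card S)" using M0 by simp
    show "0 < m \<mu> \<Longrightarrow> 0 < M / fact (card S)" using le[OF \<mu>] by simp
  next
    show "(\<Sum>\<mu>\<in>bijs S S'. M / fact (card S)) \<le> M" using assms by (simp add: card_bijs)
  qed (use assms in \<open>simp add: finite_bijs\<close>)
  then show ?thesis by (cases "M = 0") (simp_all add: kl_bijs_def flip: M_def)
qed

text \<open>\<open>f q x y\<close> plays the role of the probability of memory state q given the
  labelings. Revealing one label in all blocks costs, summed over all pairs of blocks, at most the
  level-two bound, which does not grow with the number of blocks. The masses of the states change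
  with each revealed label, so \<open>C\<close> has to bound the cost for every probability
  vector.\<close>

lemma matching_information:
  fixes f :: "'q \<Rightarrow> ('i \<Rightarrow> 'a \<Rightarrow> 'b) \<Rightarrow> ('j \<Rightarrow> 'c \<Rightarrow> 'b) \<Rightarrow> real"
  assumes Q: "finite Q" and I: "finite I" "finite J"
    and C: "\<And>M. (\<And>q. q \<in> Q \<Longrightarrow> 0 \<le> M q) \<Longrightarrow> (\<Sum>q\<in>Q. M q) = 1 \<Longrightarrow>
       (\<Sum>q\<in>Q. M q * (1329\<^sup>2 * (1 + ln (1 / M q))\<^sup>2)) \<le> C"
    and B: "finite B" "card B = k"
    and A: "\<And>u. u \<in> I \<Longrightarrow> finite (A u) \<and> card (A u) = card B"
    and A': "\<And>v. v \<in> J \<Longrightarrow> finite (A' v) \<and> card (A' v) = card B"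
    and f0: "\<And>q x y. q \<in> Q \<Longrightarrow> x \<in> labelings I A B \<Longrightarrow> y \<in> labelings J A' B \<Longrightarrow> 0 \<le> f q x y"
    and f1: "\<And>x y. x \<in> labelings I A B \<Longrightarrow> y \<in> labelings J A' B \<Longrightarrow> (\<Sum>q\<in>Q. f q x y) = 1"
  shows "(\<Sum>q\<in>Q. \<Sum>u\<in>I. \<Sum>v\<in>J. kl_bijs (A u) (A' v)
      (match_mass (labelings I A B) (labelings J A' B) (A u) (f q) u v)) \<le> real k * C"
  using B A A' f0 f1
proof (induction k arbitrary: B A A' f)
  case 0
  have "A u = {}" if "u \<in> I" for u using 0 that by fastforce
  moreover have "A' v = {}" if "v \<in> J" for v using 0 that by fastforce
  moreover have "bijs {} {} = {\<lambda>_::'a. undefined :: 'c}" by (auto simp: bijs_def bij_betw_def)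
  ultimately show ?case by (auto simp: kl_bijs_def intro!: sum_nonpos)
next
  case (Suc k)
  let ?X = "labelings I A B" and ?Y = "labelings J A' B"
  define M where "M q = avg ?X (\<lambda>x. avg ?Y (f q x))" for q
  define \<Omega> where "\<Omega> = B \<times> PiE I A \<times> PiE J A'"
  have Bne: "B \<noteq> {}" using Suc.prems by auto
  have \<Omega>: "finite \<Omega>" "\<Omega> \<noteq> {}"
  proof -
    have "PiE I A \<noteq> {}" "PiE J A' \<noteq> {}" using Suc.prems by (fastforce simp: PiE_eq_empty_iff)+
    then show "\<Omega> \<noteq> {}" using Bne by (simp add: \<Omega>_def)
    have "finite (PiE I A)" "finite (PiE J A')" by (rule finite_PiE; use I Suc.prems in blast)+
    then show "finite \<Omega>" using Suc.prems(1) by (simp add: \<Omega>_def)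
  qed
  have neX: "finite ?X" "?X \<noteq> {}"
    using labelings_finite_nonempty[where I = I and B = B and A = A] I Suc.prems by blast+
  have neY: "finite ?Y" "?Y \<noteq> {}"
    using labelings_finite_nonempty[where I = J and B = B and A = A'] I Suc.prems by blast+
  have le1: "f q x y \<le> 1" if "q \<in> Q" "x \<in> ?X" "y \<in> ?Y" for q x y
    unfolding Suc.prems(6)[OF that(2,3), symmetric] using that Q Suc.prems(5) by (intro member_le_sum) auto
  have M0: "0 \<le> M q" if "q \<in> Q" for q unfolding M_def using Suc.prems(5) that by (intro avg_nonneg) auto
  have M1: "(\<Sum>q\<in>Q. M q) = 1"
  proof -
    have "(\<Sum>q\<in>Q. M q) = avg ?X (\<lambda>x. avg ?Y (\<lambda>y. \<Sum>q\<in>Q. f q x y))" by (simp add: M_def avg_sum)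
    also have "\<dots> = avg ?X (\<lambda>x. avg ?Y (\<lambda>y. 1))" using Suc.prems(6) by (intro avg_cong refl) auto
    finally show ?thesis using neX neY by (simp add: avg_const)
  qed
  define R where "R q u v = (\<lambda>(l, z, z'). kl_bijs (A u - {z u}) (A' v - {z' v})
           (match_mass (labelings I (\<lambda>u. A u - {z u}) (B - {l})) (labelings J (\<lambda>v. A' v - {z' v}) (B - {l}))
             (A u - {z u}) (\<lambda>x y. f q (extend I l z x) (extend J l z' y)) u v))" for q u v
  have R0: "0 \<le> avg \<Omega> (R q u v)" if "q \<in> Q" "u \<in> I" "v \<in> J" for q u v
  proof (rule avg_nonneg)
    fix w assume w: "w \<in> \<Omega>"
    obtain l z z' where lz: "w = (l, z, z')" by (cases w)
    show "0 \<le> R q u v w"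
      unfolding R_def lz prod.case
    proof (rule kl_bijs_nonneg)
      show "finite (A u - {z u})" "finite (A' v - {z' v})" "card (A u - {z u}) = card (A' v - {z' v})"
      proof -
        have "z u \<in> A u" "z' v \<in> A' v" using w that by (auto simp: \<Omega>_def lz)
        then show "finite (A u - {z u})" "finite (A' v - {z' v})" "card (A u - {z u}) = card (A' v - {z' v})"
          using Suc.prems(3)[OF that(2)] Suc.prems(4)[OF that(3)] by auto
      qed
      show "0 \<le> match_mass (labelings I (\<lambda>u. A u - {z u}) (B - {l})) (labelings J (\<lambda>v. A' v - {z' v}) (B - {l}))
             (A u - {z u}) (\<lambda>x y. f q (extend I l z x) (extend J l z' y)) u v \<mu>" for \<mu>
        unfolding match_mass_def using w that
        by (intro avg_nonneg mult_nonneg_nonneg Suc.prems(5) extend_labelings) (auto simp: \<Omega>_def lz)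
    qed
  qed
  have one: "(\<Sum>u\<in>I. \<Sum>v\<in>J. kl_bijs (A u) (A' v) (match_mass ?X ?Y (A u) (f q) u v))
      \<le> M q * (1329\<^sup>2 * (1 + ln (1 / M q))\<^sup>2) + (\<Sum>u\<in>I. \<Sum>v\<in>J. avg \<Omega> (R q u v))" if q: "q \<in> Q" for q
  proof (cases "M q = 0")
    case True
    have "kl_bijs (A u) (A' v) (match_mass ?X ?Y (A u) (f q) u v) = 0" if "u \<in> I" "v \<in> J" for u v
    proof -
      have "(\<Sum>\<mu>\<in>bijs (A u) (A' v). match_mass ?X ?Y (A u) (f q) u v \<mu>) = 0"
        using True Suc.prems(1,3,4) that by (subst sum_match_mass) (auto simp: M_def)
      then show ?thesis by (simp add: kl_bijs_def)
    qed
    then show ?thesis using True R0[OF q] by (simp add: sum_nonneg)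
  next
    case False
    then have Mq: "M q > 0" using M0[OF q] by simp
    have "(\<Sum>u\<in>I. \<Sum>v\<in>J. kl_bijs (A u) (A' v) (match_mass ?X ?Y (A u) (f q) u v))
      \<le> (\<Sum>u\<in>I. \<Sum>v\<in>J. M q * (\<Sum>a\<in>A u. \<Sum>b\<in>A' v. (agree ?X ?Y (f q) u v a b / M q - 1 / card B)\<^sup>2) + avg \<Omega> (R q u v))"
    proof (intro sum_mono)
      fix u v assume uv: "u \<in> I" "v \<in> J"
      show "kl_bijs (A u) (A' v) (match_mass ?X ?Y (A u) (f q) u v)
        \<le> M q * (\<Sum>a\<in>A u. \<Sum>b\<in>A' v. (agree ?X ?Y (f q) u v a b / M q - 1 / card B)\<^sup>2) + avg \<Omega> (R q u v)"
        unfolding R_def \<Omega>_def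
      proof (rule kl_match_step[where k = k])
        show "M q = avg ?X (\<lambda>x. avg ?Y (f q x))" by (simp add: M_def)
      qed (use I Suc.prems q uv Mq in blast)+
    qed
    also have "\<dots> = M q * (\<Sum>u\<in>I. \<Sum>v\<in>J. \<Sum>a\<in>A u. \<Sum>b\<in>A' v. (agree ?X ?Y (f q) u v a b / M q - 1 / card B)\<^sup>2)
       + (\<Sum>u\<in>I. \<Sum>v\<in>J. avg \<Omega> (R q u v))"
      by (simp add: sum.distrib sum_distrib_left)
    also have "\<dots> \<le> M q * (1329\<^sup>2 * (1 + ln (1 / M q))\<^sup>2) + (\<Sum>u\<in>I. \<Sum>v\<in>J. avg \<Omega> (R q u v))"
    proof (intro add_right_mono mult_left_mono)
      show "(\<Sum>u\<in>I. \<Sum>v\<in>J. \<Sum>a\<in>A u. \<Sum>b\<in>A' v. (agree ?X ?Y (f q) u v a b / M q - 1 / card B)\<^sup>2)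
          \<le> 1329\<^sup>2 * (1 + ln (1 / M q))\<^sup>2"
      proof (rule labelings_level_two)
        show "M q = avg ?X (\<lambda>x. avg ?Y (f q x))" by (simp add: M_def)
      qed (rule refl | use I Suc.prems Bne q le1 Mq in blast)+
    qed (use Mq in simp)
    finally show ?thesis .
  qed
  \<comment> \<open>With the revealed positions fixed, the functions \<open>f q\<close> composed
    with \<open>extend\<close> still sum to 1 over q, so they form a family of the same kind over
    the reduced labelings.\<close>
  have IH: "(\<Sum>q\<in>Q. \<Sum>u\<in>I. \<Sum>v\<in>J. R q u v w) \<le> real k * C" if w: "w \<in> \<Omega>" for w
  proof -
    obtain l z z' where lz: "w = (l, z, z')" by (cases w)
    have l: "l \<in> B" "z \<in> PiE I A" "z' \<in> PiE J A'" using w by (auto simp: \<Omega>_def lz)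
    show ?thesis
      unfolding R_def lz prod.case
    proof (rule Suc.IH)
      show "finite (B - {l})" "card (B - {l}) = k" using Suc.prems(1,2) l by auto
      show "finite (A u - {z u}) \<and> card (A u - {z u}) = card (B - {l})" if "u \<in> I" for u
        using Suc.prems(1,2) Suc.prems(3)[OF that] PiE_mem[OF l(2) that] l by auto
      show "finite (A' v - {z' v}) \<and> card (A' v - {z' v}) = card (B - {l})" if "v \<in> J" for v
        using Suc.prems(1,2) Suc.prems(4)[OF that] PiE_mem[OF l(3) that] l by auto
    qed (use l in \<open>blast intro: Suc.prems(5,6) extend_labelings\<close>)+
  qed
  have "(\<Sum>q\<in>Q. \<Sum>u\<in>I. \<Sum>v\<in>J. kl_bijs (A u) (A' v) (match_mass ?X ?Y (A u) (f q) u v))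
     \<le> (\<Sum>q\<in>Q. M q * (1329\<^sup>2 * (1 + ln (1 / M q))\<^sup>2) + (\<Sum>u\<in>I. \<Sum>v\<in>J. avg \<Omega> (R q u v)))"
    by (intro sum_mono one)
  also have "\<dots> = (\<Sum>q\<in>Q. M q * (1329\<^sup>2 * (1 + ln (1 / M q))\<^sup>2)) + avg \<Omega> (\<lambda>w. \<Sum>q\<in>Q. \<Sum>u\<in>I. \<Sum>v\<in>J. R q u v w)"
    by (simp add: sum.distrib avg_sum)
  also have "\<dots> \<le> C + avg \<Omega> (\<lambda>w. real k * C)"
    using M0 M1 by (intro add_mono C avg_mono IH)
  also have "\<dots> = real (Suc k) * C" using \<Omega> by (simp add: avg_const algebra_simps)
  finally show ?case .
qed

text \<open>States of mass at least 4^-s have ln (1 / M) <= 2 s. For lighter ones, with v = 1 + ln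
  (1 / M), both sqrt M <= 2^-s and sqrt M * v^2 <= 32 hold, so that all 2^s of them together add at
  most 32.\<close>

lemma mass_log_square_sum:
  fixes M :: "nat \<Rightarrow> real"
  assumes M: "\<And>q. q < 2 ^ s \<Longrightarrow> 0 \<le> M q" "(\<Sum>q<2^s. M q) = 1"
  shows "(\<Sum>q<2^s. M q * (1 + ln (1 / M q))\<^sup>2) \<le> 40 * (real s + 1)\<^sup>2"
proof -
  have pt: "M q * (1 + ln (1 / M q))\<^sup>2 \<le> (1 + 2 * real s)\<^sup>2 * M q + 32 / 2 ^ s" if q: "q < 2 ^ s" for q
  proof (cases "M q = 0")
    case False
    then have Mq: "M q > 0" using M(1)[OF q] by simp
    have M1: "M q \<le> 1"
      unfolding M(2)[symmetric] using q M(1) by (intro member_le_sum) auto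
    have ge: "ln (1 / M q) \<ge> 0" using Mq M1 by (simp add: ln_div)
    show ?thesis
    proof (cases "1 / 2 ^ (2 * s) \<le> M q")
      case True
      then have "1 / M q \<le> 2 ^ (2 * s)" using Mq by (simp add: field_simps)
      then have "ln (1 / M q) \<le> ln (2 ^ (2 * s))" using Mq by simp
      also have "\<dots> = 2 * real s * ln 2" by (simp add: ln_realpow)
      also have "\<dots> \<le> 2 * real s * 1" using ln_2_less_1 by (intro mult_left_mono) auto
      finally have "(1 + ln (1 / M q))\<^sup>2 \<le> (1 + 2 * real s)\<^sup>2" using ge by (intro power_mono) auto
      then have "M q * (1 + ln (1 / M q))\<^sup>2 \<le> (1 + 2 * real s)\<^sup>2 * M q" using Mq by (simp add: mult.commute)
      then show ?thesis by (smt (verit) divide_nonneg_nonneg zero_le_power)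
    next
      case False
      define v where "v = 1 + ln (1 / M q)"
      have v: "v \<ge> 1" using ge by (simp add: v_def)
      have Mv: "M q = exp (1 - v)" using Mq by (simp add: v_def ln_div)
      have "sqrt (M q) = exp ((1 - v) / 2)"
      proof -
        have "(exp ((1 - v) / 2))\<^sup>2 = M q" by (simp add: Mv flip: exp_double)
        then show ?thesis by (metis exp_ge_zero real_sqrt_unique)
      qed
      moreover have "v\<^sup>2 \<le> 16 * exp (v / 2)"
      proof -
        have "v / 4 \<le> exp (v / 4)" using exp_ge_add_one_self[of "v/4"] by linarith
        then have "(v / 4)\<^sup>2 \<le> (exp (v / 4))\<^sup>2" using v by (intro power_mono) auto
        then show ?thesis by (simp add: power_divide flip: exp_double)
      qed
      ultimately have "sqrt (M q) * v\<^sup>2 \<le> exp ((1 - v) / 2) * (16 * exp (v / 2))"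
        by simp
      also have "\<dots> = 16 * exp (1/2)" by (simp add: flip: exp_add) (simp add: diff_divide_distrib)
      also have "\<dots> \<le> 32" using exp_half_le2 by simp
      finally have 1: "sqrt (M q) * v\<^sup>2 \<le> 32" .
      have 2: "sqrt (M q) \<le> 1 / 2 ^ s"
      proof -
        have "sqrt (M q) \<le> sqrt (1 / 2 ^ (2 * s))" using False by simp
        also have "1 / 2 ^ (2 * s) = (1 / 2 ^ s :: real)\<^sup>2" by (simp add: power_divide mult.commute flip: power_mult)
        also have "sqrt ((1 / 2 ^ s)\<^sup>2) = 1 / 2 ^ s" by simp
        finally show ?thesis .
      qed
      have "M q * v\<^sup>2 = sqrt (M q) * (sqrt (M q) * v\<^sup>2)" using Mq by (simp flip: mult.assoc)
      also have "\<dots> \<le> (1 / 2 ^ s) * 32" using 1 2 Mq by (intro mult_mono) auto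
      finally have "M q * v\<^sup>2 \<le> 32 / 2 ^ s" by simp
      moreover have "0 \<le> (1 + 2 * real s)\<^sup>2 * M q" using Mq by simp
      ultimately show ?thesis unfolding v_def by linarith
    qed
  qed simp
  have "(\<Sum>q<2^s. M q * (1 + ln (1 / M q))\<^sup>2) \<le> (\<Sum>q<(2::nat)^s. (1 + 2 * real s)\<^sup>2 * M q + 32 / 2 ^ s)"
    using pt by (intro sum_mono) auto
  also have "\<dots> = (1 + 2 * real s)\<^sup>2 + 32" by (simp add: sum.distrib M(2) flip: sum_distrib_left)
  also have "\<dots> \<le> 40 * (real s + 1)\<^sup>2" by (simp add: power2_eq_square algebra_simps)
  finally show ?thesis .
qed

lemma kl_le_round_bound:
  fixes f :: "nat \<Rightarrow> ('i \<Rightarrow> 'a \<Rightarrow> 'b) \<Rightarrow> ('j \<Rightarrow> 'c \<Rightarrow> 'b) \<Rightarrow> real"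
  assumes I: "finite I" "finite J" and B: "finite B"
    and A: "\<And>u. u \<in> I \<Longrightarrow> finite (A u) \<and> card (A u) = card B"
    and A': "\<And>v. v \<in> J \<Longrightarrow> finite (A' v) \<and> card (A' v) = card B"
    and f0: "\<And>q x y. q < 2 ^ s \<Longrightarrow> x \<in> labelings I A B \<Longrightarrow> y \<in> labelings J A' B \<Longrightarrow> 0 \<le> f q x y"
    and f1: "\<And>x y. x \<in> labelings I A B \<Longrightarrow> y \<in> labelings J A' B \<Longrightarrow> (\<Sum>q<2^s. f q x y) = 1"
  shows "(\<Sum>q<2^s. \<Sum>u\<in>I. \<Sum>v\<in>J. kl_bijs (A u) (A' v)
      (match_mass (labelings I A B) (labelings J A' B) (A u) (f q) u v)) \<le> real (card B) * (1329\<^sup>2 * 40 * (real s + 1)\<^sup>2)"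
proof (rule matching_information)
  fix M :: "nat \<Rightarrow> real" assume "\<And>q. q \<in> {..<2^s} \<Longrightarrow> 0 \<le> M q" "(\<Sum>q<2^s. M q) = 1"
  then have "1329\<^sup>2 * (\<Sum>q<2^s. M q * (1 + ln (1 / M q))\<^sup>2) \<le> 1329\<^sup>2 * (40 * (real s + 1)\<^sup>2)"
    by (intro mult_left_mono mass_log_square_sum) auto
  then show "(\<Sum>q<2^s. M q * (1329\<^sup>2 * (1 + ln (1 / M q))\<^sup>2)) \<le> 1329\<^sup>2 * 40 * (real s + 1)\<^sup>2"
    by (simp only: sum_distrib_left mult.left_commute[of _ "1329\<^sup>2"] mult.assoc)
qed (use assms in auto)

section \<open>Streaming algorithms\<close>

lemma pmf_bind_finite:
  assumes "finite A" "set_pmf p \<subseteq> A"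
  shows "pmf (bind_pmf p f) i = (\<Sum>x\<in>A. pmf p x * pmf (f x) i)"
  unfolding pmf_bind using assms
  by (subst integral_measure_pmf_real[of A]) (auto simp: mult.commute)

lemma pmf_bind_of_set:
  assumes "finite A" "A \<noteq> {}"
  shows "pmf (bind_pmf (pmf_of_set A) f) i = avg A (\<lambda>x. pmf (f x) i)"
  using assms by (subst pmf_bind_finite[of A]) (auto simp: avg_def sum_divide_distrib)

lemma sum_pmf_le_set: "finite A \<Longrightarrow> set_pmf p \<subseteq> A \<Longrightarrow> (\<Sum>x\<in>A. pmf p x) = 1"
  by (simp add: sum_pmf_eq_1)

text \<open>The first argument is a plain function because it will be a mixture of memory laws,
  written with \<open>avg\<close> over the hidden labelings.\<close>

definition kl_states :: "nat set \<Rightarrow> (nat \<Rightarrow> real) \<Rightarrow> nat pmf \<Rightarrow> real" where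
  "kl_states Q p \<nu> = (\<Sum>q\<in>Q. p q * ln (p q / pmf \<nu> q))"

text \<open>\<open>S x y\<close> and \<nu> are the memory laws in the aligned and in the independent
  model, and p is the mixture of the former. Data processing passes from the new state to the triple
  of old state, base edge and matching, and the chain rule splits the divergence of triples: the
  base edge is uniform in both models, and in the independent one the matching is uniform given the
  rest. The other conclusions are the invariants needed to iterate.\<close>

lemma round_kl:
  fixes S :: "(nat \<Rightarrow> 'a \<Rightarrow> 'b) \<Rightarrow> (nat \<Rightarrow> 'c \<Rightarrow> 'b) \<Rightarrow> nat pmf" and K :: "'e \<Rightarrow> ('a \<Rightarrow> 'c) \<Rightarrow> nat \<Rightarrow> nat pmf"
    and left right :: "'e \<Rightarrow> nat"
  assumes Q: "finite Q" and D: "finite D" "D \<noteq> {}"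
    and B: "finite B" "finite L" "finite R" "card L = card B" "card R = card B"
    and I: "finite I" "finite J" and X: "X = labelings I (\<lambda>_. L) B" and Y: "Y = labelings J (\<lambda>_. R) B"
    and lr: "\<And>e. e \<in> D \<Longrightarrow> left e \<in> I" "\<And>e. e \<in> D \<Longrightarrow> right e \<in> J"
    and SQ: "\<And>x y. x \<in> X \<Longrightarrow> y \<in> Y \<Longrightarrow> set_pmf (S x y) \<subseteq> Q" and \<nu>Q: "set_pmf \<nu> \<subseteq> Q"
    and KQ: "\<And>e \<mu> q. e \<in> D \<Longrightarrow> \<mu> \<in> bijs L R \<Longrightarrow> q \<in> Q \<Longrightarrow> set_pmf (K e \<mu> q) \<subseteq> Q"
    and ac: "\<And>x y. x \<in> X \<Longrightarrow> y \<in> Y \<Longrightarrow> set_pmf (S x y) \<subseteq> set_pmf \<nu>"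
    and p: "\<And>q. p q = avg X (\<lambda>x. avg Y (\<lambda>y. pmf (S x y) q))"
    and S': "\<And>x y. S' x y = bind_pmf (S x y) (\<lambda>q. bind_pmf (pmf_of_set D) (\<lambda>e. K e (matching L R (x (left e)) (y (right e))) q))"
    and p': "\<And>q. p' q = avg X (\<lambda>x. avg Y (\<lambda>y. pmf (S' x y) q))"
    and \<nu>': "\<nu>' = bind_pmf \<nu> (\<lambda>q. bind_pmf (pmf_of_set (D \<times> bijs L R)) (\<lambda>(e, \<mu>). K e \<mu> q))"
  shows "kl_states Q p' \<nu>' \<le> kl_states Q p \<nu> +
       avg D (\<lambda>e. \<Sum>q\<in>Q. kl_bijs L R (match_mass X Y L (\<lambda>x y. pmf (S x y) q) (left e) (right e)))"
    and "\<And>x y. x \<in> X \<Longrightarrow> y \<in> Y \<Longrightarrow> set_pmf (S' x y) \<subseteq> Q" and "set_pmf \<nu>' \<subseteq> Q"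
    and "\<And>x y. x \<in> X \<Longrightarrow> y \<in> Y \<Longrightarrow> set_pmf (S' x y) \<subseteq> set_pmf \<nu>'"
proof -
  have bne: "finite (bijs L R)" "bijs L R \<noteq> {}" using B by (auto simp: finite_bijs bijs_nonempty)
  have xb: "x (left e) \<in> bijs L B" if "x \<in> X" "e \<in> D" for x e using that lr by (auto simp: X labelings_def)
  have yb: "y (right e) \<in> bijs R B" if "y \<in> Y" "e \<in> D" for y e using that lr by (auto simp: Y labelings_def)
  have mb: "matching L R (x (left e)) (y (right e)) \<in> bijs L R" if "x \<in> X" "y \<in> Y" "e \<in> D" for x y e
    using matching_bijs(1)[OF xb yb] that B by blast
  show SQ': "set_pmf (S' x y) \<subseteq> Q" if "x \<in> X" "y \<in> Y" for x y
  proof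
    fix r assume "r \<in> set_pmf (S' x y)"
    then obtain q e where "q \<in> set_pmf (S x y)" "e \<in> D" "r \<in> set_pmf (K e (matching L R (x (left e)) (y (right e))) q)"
      using D unfolding S' by (auto simp: set_bind_pmf set_pmf_of_set)
    then show "r \<in> Q" using KQ[of e "matching L R (x (left e)) (y (right e))" q] mb[OF that, of e] SQ[OF that] by blast
  qed
  show \<nu>Q': "set_pmf \<nu>' \<subseteq> Q"
  proof
    fix r assume "r \<in> set_pmf \<nu>'"
    then obtain q e \<mu> where "q \<in> set_pmf \<nu>" "e \<in> D" "\<mu> \<in> bijs L R" "r \<in> set_pmf (K e \<mu> q)"
      using D bne unfolding \<nu>' by (auto simp: set_bind_pmf set_pmf_of_set)
    then show "r \<in> Q" using KQ[of e \<mu> q] \<nu>Q by blast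
  qed
  show ac': "set_pmf (S' x y) \<subseteq> set_pmf \<nu>'" if "x \<in> X" "y \<in> Y" for x y
  proof
    fix r assume "r \<in> set_pmf (S' x y)"
    then obtain q e where *: "q \<in> set_pmf (S x y)" "e \<in> D" "r \<in> set_pmf (K e (matching L R (x (left e)) (y (right e))) q)"
      using D unfolding S' by (auto simp: set_bind_pmf set_pmf_of_set)
    have "(e, matching L R (x (left e)) (y (right e))) \<in> set_pmf (pmf_of_set (D \<times> bijs L R))"
      using * mb[OF that] D bne by (simp add: set_pmf_of_set)
    then show "r \<in> set_pmf \<nu>'"
      unfolding \<nu>' set_bind_pmf using * ac[OF that] by (intro UN_I[of q] UN_I[of "(e, matching L R (x (left e)) (y (right e)))"]) auto
  qed
  define m where "m e q = match_mass X Y L (\<lambda>x y. pmf (S x y) q) (left e) (right e)" for e q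
  have m0: "0 \<le> m e q \<mu>" for e q \<mu> unfolding m_def match_mass_def by (intro avg_nonneg) simp
  have msum: "(\<Sum>\<mu>\<in>bijs L R. m e q \<mu>) = p q" if "e \<in> D" for e q
    unfolding m_def X Y p using lr that B
    by (subst sum_match_mass[where A = "\<lambda>_. L" and A' = "\<lambda>_. R"]) auto
  have p\<nu>: "pmf \<nu> q > 0" if "p q > 0" for q
  proof (rule ccontr)
    assume "\<not> pmf \<nu> q > 0"
    then have "q \<notin> set_pmf \<nu>" by (simp add: pmf_positive_iff)
    have "avg X (\<lambda>x. avg Y (\<lambda>y. pmf (S x y) q)) = avg X (\<lambda>x. avg Y (\<lambda>y. 0))"
      using ac \<open>q \<notin> set_pmf \<nu>\<close> by (intro avg_cong refl) (auto simp: pmf_eq_0_set_pmf)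
    also have "\<dots> = 0" by (simp add: avg_def)
    finally show False using that by (simp only: p)
  qed
  define w where "w = (\<lambda>(q, e, \<mu>). m e q \<mu> / card D)"
  define c where "c = (\<lambda>(q, e :: 'e, \<mu> :: 'a \<Rightarrow> 'c). pmf \<nu> q / card D / card (bijs L R))"
  define k where "k = (\<lambda>(q, e, \<mu>) q'. pmf (K e \<mu> q) q')"
  define \<Omega> where "\<Omega> = Q \<times> D \<times> bijs L R"
  have \<Omega>: "finite \<Omega>" using Q D bne by (simp add: \<Omega>_def)
  have cD: "real (card D) > 0" "real (card (bijs L R)) > 0" using D bne by (auto simp: card_gt_0_iff)
  \<comment> \<open>A step of the aligned model depends on the labelings only through the matching,
    so averaging them out leaves a mixture over triples with the same kernel \<open>k\<close> as in
    the independent model.\<close>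
  have p'_eq: "p' q' = (\<Sum>\<omega>\<in>\<Omega>. w \<omega> * k \<omega> q')" for q'
  proof -
    have "p' q' = avg X (\<lambda>x. avg Y (\<lambda>y. \<Sum>q\<in>Q. \<Sum>e\<in>D. \<Sum>\<mu>\<in>bijs L R.
        pmf (S x y) q * of_bool (\<forall>a\<in>L. y (right e) (\<mu> a) = x (left e) a) * (pmf (K e \<mu> q) q' / card D)))"
      unfolding p'
    proof (intro avg_cong refl)
      fix x y assume xy: "x \<in> X" "y \<in> Y"
      have "pmf (S' x y) q' = (\<Sum>q\<in>Q. pmf (S x y) q * avg D (\<lambda>e. pmf (K e (matching L R (x (left e)) (y (right e))) q) q'))"
        unfolding S' using D by (subst pmf_bind_finite[OF Q SQ[OF xy]]) (simp add: pmf_bind_of_set)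
      also have "\<dots> = (\<Sum>q\<in>Q. \<Sum>e\<in>D. \<Sum>\<mu>\<in>bijs L R.
        pmf (S x y) q * of_bool (\<forall>a\<in>L. y (right e) (\<mu> a) = x (left e) a) * (pmf (K e \<mu> q) q' / card D))"
        unfolding avg_def sum_distrib_left sum_divide_distrib
      proof (intro sum.cong refl)
        fix q e assume e: "e \<in> D"
        have "(\<Sum>\<mu>\<in>bijs L R. pmf (S x y) q * of_bool (\<forall>a\<in>L. y (right e) (\<mu> a) = x (left e) a) * (pmf (K e \<mu> q) q' / card D))
          = (\<Sum>\<mu>\<in>bijs L R. if \<mu> = matching L R (x (left e)) (y (right e)) then pmf (S x y) q * (pmf (K e \<mu> q) q' / card D) else 0)"
          using matching_unique[OF xb[OF xy(1) e] yb[OF xy(2) e] B(2,3,1)] by (intro sum.cong refl) auto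
        also have "\<dots> = pmf (S x y) q * (pmf (K e (matching L R (x (left e)) (y (right e))) q) q' / card D)"
          using bne mb[OF xy e] by simp
        finally show "pmf (S x y) q * (pmf (K e (matching L R (x (left e)) (y (right e))) q) q' / real (card D)) =
          (\<Sum>\<mu>\<in>bijs L R. pmf (S x y) q * of_bool (\<forall>a\<in>L. y (right e) (\<mu> a) = x (left e) a) * (pmf (K e \<mu> q) q' / card D))" ..
      qed
      finally show "pmf (S' x y) q' = (\<Sum>q\<in>Q. \<Sum>e\<in>D. \<Sum>\<mu>\<in>bijs L R.
        pmf (S x y) q * of_bool (\<forall>a\<in>L. y (right e) (\<mu> a) = x (left e) a) * (pmf (K e \<mu> q) q' / card D))" .
    qed
    also have "\<dots> = (\<Sum>q\<in>Q. \<Sum>e\<in>D. \<Sum>\<mu>\<in>bijs L R. m e q \<mu> * (pmf (K e \<mu> q) q' / card D))"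
      unfolding avg_sum avg_multc m_def match_mass_def ..
    also have "\<dots> = (\<Sum>\<omega>\<in>\<Omega>. w \<omega> * k \<omega> q')"
      by (simp add: \<Omega>_def sum.cartesian_product w_def k_def case_prod_unfold)
    finally show ?thesis .
  qed
  have \<nu>'_eq: "pmf \<nu>' q' = (\<Sum>\<omega>\<in>\<Omega>. c \<omega> * k \<omega> q')" for q'
  proof -
    have "pmf \<nu>' q' = (\<Sum>q\<in>Q. pmf \<nu> q * avg (D \<times> bijs L R) (\<lambda>(e, \<mu>). pmf (K e \<mu> q) q'))"
      unfolding \<nu>' using D bne by (subst pmf_bind_finite[OF Q \<nu>Q]) (simp add: pmf_bind_of_set case_prod_unfold)
    also have "\<dots> = (\<Sum>q\<in>Q. \<Sum>e\<in>D. \<Sum>\<mu>\<in>bijs L R. pmf \<nu> q / card D / card (bijs L R) * pmf (K e \<mu> q) q')"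
      using D bne by (simp add: avg_Times) (simp add: avg_def sum_divide_distrib sum_distrib_left mult.commute[of "real (card (bijs L R))"])
    also have "\<dots> = (\<Sum>\<omega>\<in>\<Omega>. c \<omega> * k \<omega> q')"
      by (simp add: \<Omega>_def sum.cartesian_product c_def k_def case_prod_unfold)
    finally show ?thesis .
  qed
  have w0: "0 \<le> w \<omega>" for \<omega> using m0 by (simp add: w_def case_prod_unfold)
  have c0: "0 \<le> c \<omega>" for \<omega> by (simp add: c_def case_prod_unfold)
  have k0: "0 \<le> k \<omega> q'" for \<omega> q' by (simp add: k_def case_prod_unfold)
  have wc: "0 < c \<omega>" if \<omega>: "\<omega> \<in> \<Omega>" "0 < w \<omega>" for \<omega>
  proof -
    obtain q e \<mu> where o: "\<omega> = (q, e, \<mu>)" by (cases \<omega>)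
    have "0 < m e q \<mu>" using \<omega> cD by (simp add: o w_def zero_less_divide_iff)
    also have "m e q \<mu> \<le> p q"
    proof -
      have e: "e \<in> D" "\<mu> \<in> bijs L R" using \<omega> by (auto simp: \<Omega>_def o)
      show ?thesis unfolding msum[OF e(1), symmetric] using e m0 bne by (intro member_le_sum) auto
    qed
    finally show ?thesis using p\<nu>[of q] cD by (simp add: o c_def)
  qed
  \<comment> \<open>Data processing: the log-sum inequality is applied for each new state, and
    afterwards the kernel weights sum to 1.\<close>
  have "kl_states Q p' \<nu>' \<le> (\<Sum>q'\<in>Q. \<Sum>\<omega>\<in>\<Omega>. k \<omega> q' * (w \<omega> * ln (w \<omega> / c \<omega>)))"
    unfolding kl_states_def
  proof (rule sum_mono)
    fix q' assume "q' \<in> Q"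
    have "p' q' * ln (p' q' / pmf \<nu>' q') \<le> (\<Sum>\<omega>\<in>\<Omega>. w \<omega> * k \<omega> q' * ln (w \<omega> * k \<omega> q' / (c \<omega> * k \<omega> q')))"
      unfolding p'_eq \<nu>'_eq
    proof (rule log_sum_inequality)
      fix \<omega> assume \<omega>: "\<omega> \<in> \<Omega>"
      show "0 \<le> w \<omega> * k \<omega> q'" "0 \<le> c \<omega> * k \<omega> q'" using w0 c0 k0 by simp_all
      assume "0 < w \<omega> * k \<omega> q'"
      then have "w \<omega> \<noteq> 0" "k \<omega> q' \<noteq> 0" by auto
      then have "0 < w \<omega>" "0 < k \<omega> q'" using w0[of \<omega>] k0[of \<omega> q'] by (simp_all add: order_less_le)
      then show "0 < c \<omega> * k \<omega> q'" using wc[OF \<omega>] by simp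
    qed (use \<Omega> in auto)
    also have "\<dots> = (\<Sum>\<omega>\<in>\<Omega>. k \<omega> q' * (w \<omega> * ln (w \<omega> / c \<omega>)))"
    proof (intro sum.cong refl)
      fix \<omega> show "w \<omega> * k \<omega> q' * ln (w \<omega> * k \<omega> q' / (c \<omega> * k \<omega> q')) = k \<omega> q' * (w \<omega> * ln (w \<omega> / c \<omega>))"
        by (cases "k \<omega> q' = 0") auto
    qed
    finally show "p' q' * ln (p' q' / pmf \<nu>' q') \<le> (\<Sum>\<omega>\<in>\<Omega>. k \<omega> q' * (w \<omega> * ln (w \<omega> / c \<omega>)))" .
  qed
  also have "\<dots> = (\<Sum>\<omega>\<in>\<Omega>. w \<omega> * ln (w \<omega> / c \<omega>))"
  proof -
    have "(\<Sum>q'\<in>Q. k \<omega> q') = 1" if "\<omega> \<in> \<Omega>" for \<omega>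
      using that KQ Q by (cases \<omega>) (auto simp: \<Omega>_def k_def intro!: sum_pmf_le_set)
    then show ?thesis by (subst sum.swap) (simp flip: sum_distrib_right)
  qed
  also have "\<dots> = (\<Sum>q\<in>Q. avg D (\<lambda>e. \<Sum>\<mu>\<in>bijs L R. m e q \<mu> * ln (m e q \<mu> * card (bijs L R) / pmf \<nu> q)))"
  proof -
    have "(\<Sum>\<omega>\<in>\<Omega>. w \<omega> * ln (w \<omega> / c \<omega>))
      = (\<Sum>q\<in>Q. \<Sum>e\<in>D. \<Sum>\<mu>\<in>bijs L R. w (q, e, \<mu>) * ln (w (q, e, \<mu>) / c (q, e, \<mu>)))"
      by (simp add: \<Omega>_def sum.cartesian_product case_prod_unfold)
    moreover have "w (q, e, \<mu>) * ln (w (q, e, \<mu>) / c (q, e, \<mu>)) = m e q \<mu> * ln (m e q \<mu> * card (bijs L R) / pmf \<nu> q) / card D" for q e \<mu>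
    proof -
      have "w (q, e, \<mu>) / c (q, e, \<mu>) = m e q \<mu> * card (bijs L R) / pmf \<nu> q"
        using cD by (cases "pmf \<nu> q = 0") (simp_all add: w_def c_def field_simps)
      then show ?thesis by (simp only:) (simp add: w_def)
    qed
    ultimately show ?thesis by (simp add: avg_def sum_divide_distrib)
  qed
  \<comment> \<open>Chain rule: the ratio is split at \<open>p q\<close>, which is the total mass of
    \<open>m e q\<close> whatever the base edge e.\<close>
  also have "\<dots> = (\<Sum>q\<in>Q. avg D (\<lambda>e. kl_bijs L R (m e q) + p q * ln (p q / pmf \<nu> q)))"
  proof (intro sum.cong avg_cong refl)
    fix q e assume e: "e \<in> D"
    have le: "m e q \<mu> \<le> p q" if "\<mu> \<in> bijs L R" for \<mu>
      unfolding msum[OF e, symmetric] using that m0 bne by (intro member_le_sum) auto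
    have "m e q \<mu> * ln (m e q \<mu> * card (bijs L R) / pmf \<nu> q)
      = m e q \<mu> * ln (m e q \<mu> * fact (card L) / p q) + m e q \<mu> * ln (p q / pmf \<nu> q)" if "\<mu> \<in> bijs L R" for \<mu>
    proof (cases "m e q \<mu> = 0")
      case False
      then have pos: "m e q \<mu> > 0" "p q > 0" using m0[of e q \<mu>] le[OF that] by auto
      have "m e q \<mu> * card (bijs L R) / pmf \<nu> q = (m e q \<mu> * fact (card L) / p q) * (p q / pmf \<nu> q)"
        using pos B by (simp add: card_bijs)
      then have "ln (m e q \<mu> * card (bijs L R) / pmf \<nu> q) = ln (m e q \<mu> * fact (card L) / p q) + ln (p q / pmf \<nu> q)"
        using pos p\<nu>[OF pos(2)] by (simp only:) (intro ln_mult_pos, auto)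
      then show ?thesis by (simp add: distrib_left)
    qed simp
    then show "(\<Sum>\<mu>\<in>bijs L R. m e q \<mu> * ln (m e q \<mu> * card (bijs L R) / pmf \<nu> q))
      = kl_bijs L R (m e q) + p q * ln (p q / pmf \<nu> q)"
      by (simp add: sum.distrib kl_bijs_def msum[OF e] flip: sum_distrib_right)
  qed
  also have "\<dots> = kl_states Q p \<nu> + avg D (\<lambda>e. \<Sum>q\<in>Q. kl_bijs L R (m e q))"
    using D by (simp add: avg_add avg_const sum.distrib kl_states_def avg_sum)
  finally show "kl_states Q p' \<nu>' \<le> kl_states Q p \<nu> +
       avg D (\<lambda>e. \<Sum>q\<in>Q. kl_bijs L R (match_mass X Y L (\<lambda>x y. pmf (S x y) q) (left e) (right e)))"
    by (simp add: m_def)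
qed

text \<open>A Pinsker-type bound through the Hellinger distance. With d and e the difference and the
  sum of square roots, ln r <= r - 1 at r = sqrt (\<nu> / p) bounds the sum of d^2 by the
  divergence; Cauchy-Schwarz combines this with the sum of (e h)^2, which is at most 4.\<close>

lemma kl_states_distance:
  assumes Q: "finite Q" and p: "\<And>q. q \<in> Q \<Longrightarrow> 0 \<le> p q" "(\<Sum>q\<in>Q. p q) = 1" and \<nu>: "set_pmf \<nu> \<subseteq> Q"
    and ac: "\<And>q. q \<in> Q \<Longrightarrow> p q > 0 \<Longrightarrow> pmf \<nu> q > 0" and h: "\<And>q. q \<in> Q \<Longrightarrow> 0 \<le> h q \<and> h q \<le> 1"
  shows "((\<Sum>q\<in>Q. pmf \<nu> q * h q) - (\<Sum>q\<in>Q. p q * h q))\<^sup>2 \<le> 4 * kl_states Q p \<nu>"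
proof -
  define d where "d q = sqrt (p q) - sqrt (pmf \<nu> q)" for q
  define e where "e q = sqrt (p q) + sqrt (pmf \<nu> q)" for q
  have \<nu>1: "(\<Sum>q\<in>Q. pmf \<nu> q) = 1" using Q \<nu> by (rule sum_pmf_le_set)
  have de: "d q * e q = p q - pmf \<nu> q" if "q \<in> Q" for q
    using p(1)[OF that] by (simp add: d_def e_def algebra_simps)
  have dd: "(d q)\<^sup>2 = p q + pmf \<nu> q - 2 * sqrt (p q) * sqrt (pmf \<nu> q)"
    and ee: "(e q)\<^sup>2 \<le> 2 * p q + 2 * pmf \<nu> q" if "q \<in> Q" for q
  proof -
    show "(d q)\<^sup>2 = p q + pmf \<nu> q - 2 * sqrt (p q) * sqrt (pmf \<nu> q)"
      using p(1)[OF that] by (simp add: d_def power2_diff)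
    moreover have "(e q)\<^sup>2 = p q + pmf \<nu> q + 2 * sqrt (p q) * sqrt (pmf \<nu> q)"
      using p(1)[OF that] by (simp add: e_def power2_sum)
    moreover have "0 \<le> (d q)\<^sup>2" by simp
    ultimately show "(e q)\<^sup>2 \<le> 2 * p q + 2 * pmf \<nu> q" by linarith
  qed
  have kl: "p q + (d q)\<^sup>2 - pmf \<nu> q \<le> p q * ln (p q / pmf \<nu> q)" if q: "q \<in> Q" for q
  proof (cases "p q = 0")
    case True then show ?thesis by (simp add: d_def)
  next
    case False
    then have pos: "p q > 0" "pmf \<nu> q > 0" using p(1)[OF q] ac[OF q] by auto
    define r where "r = sqrt (pmf \<nu> q) / sqrt (p q)"
    have r: "r > 0" using pos by (simp add: r_def)
    have "ln (p q / pmf \<nu> q) = - 2 * ln r" using pos by (simp add: r_def ln_div ln_sqrt)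
    moreover have "ln r \<le> r - 1" using r by (rule ln_le_minus_one)
    ultimately have "p q * (2 - 2 * r) \<le> p q * ln (p q / pmf \<nu> q)"
      using pos by (intro mult_left_mono) auto
    moreover have "p q * r = sqrt (p q) * sqrt (pmf \<nu> q)"
    proof -
      have "p q * r = (p q / sqrt (p q)) * sqrt (pmf \<nu> q)" by (simp add: r_def)
      then show ?thesis using pos by (simp add: real_div_sqrt)
    qed
    ultimately show ?thesis using dd[OF q] by (simp add: algebra_simps)
  qed
  have "(\<Sum>q\<in>Q. p q + (d q)\<^sup>2 - pmf \<nu> q) \<le> kl_states Q p \<nu>"
    unfolding kl_states_def by (intro sum_mono kl)
  then have H: "(\<Sum>q\<in>Q. (d q)\<^sup>2) \<le> kl_states Q p \<nu>"
    by (simp add: sum.distrib sum_subtractf p(2) \<nu>1)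
  have "(\<Sum>q\<in>Q. pmf \<nu> q * h q) - (\<Sum>q\<in>Q. p q * h q) = (\<Sum>q\<in>Q. d q * (- (e q * h q)))"
  proof -
    have "d q * (- (e q * h q)) = pmf \<nu> q * h q - p q * h q" if "q \<in> Q" for q
    proof -
      have "d q * (- (e q * h q)) = - (d q * e q) * h q" by simp
      then show ?thesis by (simp only: de[OF that]) (simp add: algebra_simps)
    qed
    then show ?thesis by (simp add: sum_subtractf)
  qed
  then have "((\<Sum>q\<in>Q. pmf \<nu> q * h q) - (\<Sum>q\<in>Q. p q * h q))\<^sup>2 \<le> (\<Sum>q\<in>Q. (d q)\<^sup>2) * (\<Sum>q\<in>Q. (- (e q * h q))\<^sup>2)"
    using Cauchy_Schwarz_ineq_sum[of d "\<lambda>q. - (e q * h q)" Q] by simp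
  also have "\<dots> \<le> kl_states Q p \<nu> * 4"
  proof (rule mult_mono[OF H])
    have "(\<Sum>q\<in>Q. (- (e q * h q))\<^sup>2) \<le> (\<Sum>q\<in>Q. 2 * p q + 2 * pmf \<nu> q)"
    proof (rule sum_mono)
      fix q assume q: "q \<in> Q"
      have "(h q)\<^sup>2 \<le> 1" using h[OF q] by (simp add: power_le_one)
      then have "(- (e q * h q))\<^sup>2 \<le> (e q)\<^sup>2" by (simp add: power_mult_distrib mult_left_le)
      then show "(- (e q * h q))\<^sup>2 \<le> 2 * p q + 2 * pmf \<nu> q" using ee[OF q] by linarith
    qed
    also have "\<dots> = 4" by (simp add: sum.distrib p(2) \<nu>1 flip: sum_distrib_left)
    finally show "(\<Sum>q\<in>Q. (- (e q * h q))\<^sup>2) \<le> 4" .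
    show "0 \<le> kl_states Q p \<nu>" using H by (meson order_trans sum_nonneg zero_le_power2)
  qed (simp add: sum_nonneg)
  finally show ?thesis by simp
qed

section \<open>Runs of an algorithm as iterates of a Markov kernel\<close>

definition run_from :: "salg \<Rightarrow> nat pmf \<Rightarrow> edge list \<Rightarrow> nat pmf" where
  "run_from A p xs = fold (\<lambda>e p. bind_pmf p (\<lambda>q. step A q e)) xs p"

definition iter_kernel :: "(nat \<Rightarrow> nat pmf) \<Rightarrow> nat \<Rightarrow> nat pmf \<Rightarrow> nat pmf" where
  "iter_kernel R j p = ((\<lambda>p. bind_pmf p R) ^^ j) p"

lemma run_from_append: "run_from A p (xs @ ys) = run_from A (run_from A p xs) ys"
  by (simp add: run_from_def)

lemma run_from_bind: "run_from A (bind_pmf p f) xs = bind_pmf p (\<lambda>q. run_from A (f q) xs)"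
  by (induction xs arbitrary: p f) (simp_all add: run_from_def bind_assoc_pmf)

lemma run_from_return: "run_from A p xs = bind_pmf p (\<lambda>q. run_from A (return_pmf q) xs)"
  using run_from_bind[of A p return_pmf xs] by (simp add: bind_return_pmf')

lemma run_eq_run_from: "run A xs = run_from A (init A) xs"
  by (simp add: run_def run_from_def)

lemma set_run_from:
  assumes "space_bounded s A" "set_pmf p \<subseteq> {..<2^s}"
  shows "set_pmf (run_from A p xs) \<subseteq> {..<2^s}"
  using assms(2)
proof (induction xs arbitrary: p)
  case (Cons e xs)
  have "set_pmf (step A q e) \<subseteq> {..<2^s}" if "q < 2^s" for q
    using assms(1) that unfolding space_bounded_def by blast
  then have "set_pmf (bind_pmf p (\<lambda>q. step A q e)) \<subseteq> {..<2^s}"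
    unfolding set_bind_pmf using Cons.prems by blast
  from Cons.IH[OF this] show ?case by (simp add: run_from_def)
qed (simp add: run_from_def)

lemma iter_kernel_bind: "iter_kernel R j (bind_pmf p f) = bind_pmf p (\<lambda>q. iter_kernel R j (f q))"
  by (induction j) (simp_all add: iter_kernel_def bind_assoc_pmf)

lemma iter_kernel_Suc: "iter_kernel R (Suc j) p = bind_pmf (iter_kernel R j p) R"
  by (simp add: iter_kernel_def)

lemma iter_kernel_Suc': "iter_kernel R (Suc j) p = iter_kernel R j (bind_pmf p R)"
  by (simp only: iter_kernel_def funpow_Suc_right o_apply)

text \<open>The rounds are drawn independently of the state, so drawing a round and sampling the
  current state commute; averaging over the whole stream then amounts to iterating the averaged
  kernel of one round.\<close>

lemma run_replicate:
  "bind_pmf (replicate_pmf T U) (\<lambda>es. run_from A p (concat (map ed es)))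
    = iter_kernel (\<lambda>q. bind_pmf U (\<lambda>e. run_from A (return_pmf q) (ed e))) T p"
proof (induction T arbitrary: p)
  case 0
  then show ?case by (simp add: bind_return_pmf run_from_def iter_kernel_def)
next
  case (Suc T)
  let ?R = "\<lambda>q. bind_pmf U (\<lambda>e. run_from A (return_pmf q) (ed e))"
  have "bind_pmf (replicate_pmf (Suc T) U) (\<lambda>es. run_from A p (concat (map ed es)))
    = bind_pmf U (\<lambda>e. iter_kernel ?R T (run_from A p (ed e)))"
    by (simp add: bind_assoc_pmf bind_return_pmf run_from_append Suc.IH)
  also have "\<dots> = iter_kernel ?R T (bind_pmf U (\<lambda>e. run_from A p (ed e)))"
    by (simp add: iter_kernel_bind)
  also have "bind_pmf U (\<lambda>e. run_from A p (ed e)) = bind_pmf p ?R"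
    by (subst run_from_return) (rule bind_commute_pmf)
  finally show ?case by (simp add: iter_kernel_Suc')
qed

text \<open>The extra element after the T rounds is rendered by \<open>ed'\<close>: in the
  application the final round is cut short, although its base edge and matching are drawn like all
  others.\<close>

definition stream_pmf :: "nat \<Rightarrow> 'e pmf \<Rightarrow> ('e \<Rightarrow> edge list) \<Rightarrow> ('e \<Rightarrow> edge list) \<Rightarrow> edge list pmf" where
  "stream_pmf T U ed ed' = bind_pmf (replicate_pmf T U) (\<lambda>es. map_pmf (\<lambda>e. concat (map ed es) @ ed' e) U)"

definition acceptance :: "salg \<Rightarrow> edge list pmf \<Rightarrow> real" where
  "acceptance A P = measure_pmf.expectation P (accept_prob A)"

lemma acceptance_eq: "acceptance A P = pmf (bind_pmf P (\<lambda>xs. bind_pmf (run A xs) (out A))) True"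
  unfolding acceptance_def accept_prob_def measure_pmf_single by (rule pmf_bind[symmetric])

lemma acceptance_stream:
  "acceptance A (stream_pmf T U ed ed') =
    pmf (bind_pmf (bind_pmf (iter_kernel (\<lambda>q. bind_pmf U (\<lambda>e. run_from A (return_pmf q) (ed e))) T (init A))
       (\<lambda>q. bind_pmf U (\<lambda>e. run_from A (return_pmf q) (ed' e)))) (out A)) True"
proof -
  have "bind_pmf (stream_pmf T U ed ed') (\<lambda>xs. bind_pmf (run A xs) (out A))
    = bind_pmf (bind_pmf (replicate_pmf T U) (\<lambda>es. bind_pmf U (\<lambda>e. run_from A (run_from A (init A) (concat (map ed es))) (ed' e)))) (out A)"
    by (simp add: stream_pmf_def bind_assoc_pmf bind_map_pmf run_eq_run_from run_from_append)
  also have "(\<lambda>es. bind_pmf U (\<lambda>e. run_from A (run_from A (init A) (concat (map ed es))) (ed' e)))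
    = (\<lambda>es. bind_pmf (run_from A (init A) (concat (map ed es))) (\<lambda>q. bind_pmf U (\<lambda>e. run_from A (return_pmf q) (ed' e))))"
    by (rule ext, subst run_from_return, rule bind_commute_pmf)
  also have "bind_pmf (replicate_pmf T U) \<dots> = bind_pmf (iter_kernel (\<lambda>q. bind_pmf U (\<lambda>e. run_from A (return_pmf q) (ed e))) T (init A))
       (\<lambda>q. bind_pmf U (\<lambda>e. run_from A (return_pmf q) (ed' e)))"
    by (simp add: run_replicate flip: bind_assoc_pmf)
  finally show ?thesis by (simp add: acceptance_eq)
qed

text \<open>\<open>round_kl\<close> is applied T + 1 times, the last time with the kernel of the
  final round, and \<open>kl_states_distance\<close> concludes. \<open>bound\<close> ranges over all
  S because the memory law changes from round to round; a uniform \<kappa> makes the costs add up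
  linearly.\<close>

lemma streaming_indistinguishable:
  fixes ed ed' :: "'e \<Rightarrow> ('a \<Rightarrow> 'c) \<Rightarrow> edge list" and left right :: "'e \<Rightarrow> nat" and B :: "'b set"
  assumes sb: "space_bounded s A" and D: "finite D" "D \<noteq> {}"
    and B: "finite B" "finite L" "finite R" "card L = card B" "card R = card B"
    and I: "finite I" "finite J" and X: "X = labelings I (\<lambda>_. L) B" and Y: "Y = labelings J (\<lambda>_. R) B"
    and lr: "\<And>e. e \<in> D \<Longrightarrow> left e \<in> I" "\<And>e. e \<in> D \<Longrightarrow> right e \<in> J"
    and bound: "\<And>S :: (nat \<Rightarrow> 'a \<Rightarrow> 'b) \<Rightarrow> (nat \<Rightarrow> 'c \<Rightarrow> 'b) \<Rightarrow> nat pmf. (\<And>x y. x \<in> X \<Longrightarrow> y \<in> Y \<Longrightarrow> set_pmf (S x y) \<subseteq> {..<2^s}) \<Longrightarrow>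
       avg D (\<lambda>e. \<Sum>q<2^s. kl_bijs L R (match_mass X Y L (\<lambda>x y. pmf (S x y) q) (left e) (right e))) \<le> \<kappa>"
  shows "(acceptance A (stream_pmf T (pmf_of_set (D \<times> bijs L R)) (\<lambda>(e, \<mu>). ed e \<mu>) (\<lambda>(e, \<mu>). ed' e \<mu>))
     - avg X (\<lambda>x. avg Y (\<lambda>y. acceptance A (stream_pmf T (pmf_of_set D)
          (\<lambda>e. ed e (matching L R (x (left e)) (y (right e)))) (\<lambda>e. ed' e (matching L R (x (left e)) (y (right e))))))))\<^sup>2
     \<le> 4 * ((real T + 1) * \<kappa>)"
proof -
  let ?Q = "{..<2^s} :: nat set"
  define K where "K e \<mu> q = run_from A (return_pmf q) (ed e \<mu>)" for e \<mu> q
  define K' where "K' e \<mu> q = run_from A (return_pmf q) (ed' e \<mu>)" for e \<mu> q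
  define Ry where "Ry K x y q = bind_pmf (pmf_of_set D) (\<lambda>e. K e (matching L R (x (left e)) (y (right e))) q)"
    for K :: "'e \<Rightarrow> ('a \<Rightarrow> 'c) \<Rightarrow> nat \<Rightarrow> nat pmf" and x :: "nat \<Rightarrow> 'a \<Rightarrow> 'b" and y :: "nat \<Rightarrow> 'c \<Rightarrow> 'b" and q
  define Rn where "Rn K q = bind_pmf (pmf_of_set (D \<times> bijs L R)) (\<lambda>(e, \<mu>). K e \<mu> q)"
    for K :: "'e \<Rightarrow> ('a \<Rightarrow> 'c) \<Rightarrow> nat \<Rightarrow> nat pmf" and q
  define S where "S j x y = iter_kernel (Ry K x y) j (init A)" for j x y
  define \<nu> where "\<nu> j = iter_kernel (Rn K) j (init A)" for j
  define mean where "mean S q = avg X (\<lambda>x. avg Y (\<lambda>y. pmf (S x y) q))" for S :: "(nat \<Rightarrow> 'a \<Rightarrow> 'b) \<Rightarrow> (nat \<Rightarrow> 'c \<Rightarrow> 'b) \<Rightarrow> nat pmf" and q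
  have Xne: "finite X" "X \<noteq> {}"
    unfolding X using labelings_finite_nonempty[where I = I and B = B and A = "\<lambda>_. L"] I B by blast+
  have Yne: "finite Y" "Y \<noteq> {}"
    unfolding Y using labelings_finite_nonempty[where I = J and B = B and A = "\<lambda>_. R"] I B by blast+
  have KQ: "set_pmf (K e \<mu> q) \<subseteq> ?Q" if "q \<in> ?Q" for e \<mu> q
    unfolding K_def using that by (intro set_run_from[OF sb]) auto
  have K'Q: "set_pmf (K' e \<mu> q) \<subseteq> ?Q" if "q \<in> ?Q" for e \<mu> q
    unfolding K'_def using that by (intro set_run_from[OF sb]) auto
  \<comment> \<open>Absolute continuity is carried along with the divergence: by the conventions for
    division by 0 and ln 0, a state impossible under \<nu> would count as 0 and hide an infinite
    divergence.\<close>
  have inv: "kl_states ?Q (mean (S j)) (\<nu> j) \<le> real j * \<kappa> \<and> (\<forall>x\<in>X. \<forall>y\<in>Y. set_pmf (S j x y) \<subseteq> ?Q)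
      \<and> set_pmf (\<nu> j) \<subseteq> ?Q \<and> (\<forall>x\<in>X. \<forall>y\<in>Y. set_pmf (S j x y) \<subseteq> set_pmf (\<nu> j))" for j
  proof (induction j)
    case 0
    have "mean (S 0) = pmf (init A)"
      using Xne Yne by (intro ext) (simp add: mean_def S_def iter_kernel_def avg_const)
    then have kl0: "kl_states ?Q (mean (S 0)) (\<nu> 0) = (\<Sum>q\<in>?Q. 0)"
      unfolding kl_states_def by (intro sum.cong refl) (auto simp: \<nu>_def iter_kernel_def)
    have init: "S 0 x y = init A" "\<nu> 0 = init A" "set_pmf (init A) \<subseteq> ?Q" for x y
      using sb by (auto simp: S_def \<nu>_def iter_kernel_def space_bounded_def)
    have "kl_states ?Q (mean (S 0)) (\<nu> 0) \<le> real 0 * \<kappa>" unfolding kl0 by simp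
    then show ?case by (intro conjI ballI) (assumption | simp only: init subset_refl)+
  next
    case (Suc j)
    have SQ: "set_pmf (S j x y) \<subseteq> ?Q" if "x \<in> X" "y \<in> Y" for x y using Suc that by blast
    note rk = round_kl[where Q = ?Q and K = K and S = "S j" and S' = "S (Suc j)" and \<nu> = "\<nu> j" and \<nu>' = "\<nu> (Suc j)"
       and p = "mean (S j)" and p' = "mean (S (Suc j))" and left = left and right = right, OF finite_lessThan D B I X Y]
    have S': "S (Suc j) x y = bind_pmf (S j x y) (\<lambda>q. bind_pmf (pmf_of_set D) (\<lambda>e. K e (matching L R (x (left e)) (y (right e))) q))" for x y
      by (simp add: S_def iter_kernel_Suc Ry_def[abs_def])
    have \<nu>': "\<nu> (Suc j) = bind_pmf (\<nu> j) (\<lambda>q. bind_pmf (pmf_of_set (D \<times> bijs L R)) (\<lambda>(e, \<mu>). K e \<mu> q))"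
      by (simp add: \<nu>_def iter_kernel_Suc Rn_def[abs_def])
    have "kl_states ?Q (mean (S (Suc j))) (\<nu> (Suc j)) \<le> kl_states ?Q (mean (S j)) (\<nu> j) +
        avg D (\<lambda>e. \<Sum>q<2^s. kl_bijs L R (match_mass X Y L (\<lambda>x y. pmf (S j x y) q) (left e) (right e)))"
      by (rule rk(1)) (use lr Suc KQ mean_def S' \<nu>' in blast)+
    also have "\<dots> \<le> real j * \<kappa> + \<kappa>" using Suc bound[of "S j", OF SQ] by (intro add_mono) auto
    finally have "kl_states ?Q (mean (S (Suc j))) (\<nu> (Suc j)) \<le> real (Suc j) * \<kappa>" by (simp add: algebra_simps)
    moreover have "set_pmf (S (Suc j) x y) \<subseteq> ?Q" if "x \<in> X" "y \<in> Y" for x y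
      by (rule rk(2)) (use lr Suc KQ mean_def S' \<nu>' that in blast)+
    moreover have "set_pmf (\<nu> (Suc j)) \<subseteq> ?Q"
      by (rule rk(3)) (use lr Suc KQ mean_def S' \<nu>' in blast)+
    moreover have "set_pmf (S (Suc j) x y) \<subseteq> set_pmf (\<nu> (Suc j))" if "x \<in> X" "y \<in> Y" for x y
      by (rule rk(4)) (use lr Suc KQ mean_def S' \<nu>' that in blast)+
    ultimately show ?case by blast
  qed
  define Sf where "Sf x y = bind_pmf (S T x y) (Ry K' x y)" for x y
  define \<nu>f where "\<nu>f = bind_pmf (\<nu> T) (Rn K')"
  note rk = round_kl[where Q = ?Q and K = K' and S = "S T" and S' = Sf and \<nu> = "\<nu> T" and \<nu>' = "\<nu>f"
       and p = "mean (S T)" and p' = "mean Sf" and left = left and right = right, OF finite_lessThan D B I X Y]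
  have S': "Sf x y = bind_pmf (S T x y) (\<lambda>q. bind_pmf (pmf_of_set D) (\<lambda>e. K' e (matching L R (x (left e)) (y (right e))) q))" for x y
    by (simp add: Sf_def Ry_def[abs_def])
  have \<nu>': "\<nu>f = bind_pmf (\<nu> T) (\<lambda>q. bind_pmf (pmf_of_set (D \<times> bijs L R)) (\<lambda>(e, \<mu>). K' e \<mu> q))"
    by (simp add: \<nu>f_def Rn_def[abs_def])
  have "kl_states ?Q (mean Sf) \<nu>f \<le> kl_states ?Q (mean (S T)) (\<nu> T) +
      avg D (\<lambda>e. \<Sum>q<2^s. kl_bijs L R (match_mass X Y L (\<lambda>x y. pmf (S T x y) q) (left e) (right e)))"
    by (rule rk(1)) (use lr inv[of T] K'Q mean_def S' \<nu>' in blast)+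
  also have "\<dots> \<le> real T * \<kappa> + \<kappa>" using inv[of T] bound[of "S T"] by (intro add_mono) auto
  finally have kl: "kl_states ?Q (mean Sf) \<nu>f \<le> (real T + 1) * \<kappa>" by (simp add: algebra_simps)
  have SfQ: "set_pmf (Sf x y) \<subseteq> ?Q" if "x \<in> X" "y \<in> Y" for x y
    by (rule rk(2)) (use lr inv[of T] K'Q mean_def S' \<nu>' that in blast)+
  have \<nu>fQ: "set_pmf \<nu>f \<subseteq> ?Q"
    by (rule rk(3)) (use lr inv[of T] K'Q mean_def S' \<nu>' in blast)+
  have Sf\<nu>: "set_pmf (Sf x y) \<subseteq> set_pmf \<nu>f" if "x \<in> X" "y \<in> Y" for x y
    by (rule rk(4)) (use lr inv[of T] K'Q mean_def S' \<nu>' that in blast)+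
  define h where "h q = pmf (out A q) True" for q
  have no: "acceptance A (stream_pmf T (pmf_of_set (D \<times> bijs L R)) (\<lambda>(e, \<mu>). ed e \<mu>) (\<lambda>(e, \<mu>). ed' e \<mu>))
      = (\<Sum>q\<in>?Q. pmf \<nu>f q * h q)"
    unfolding acceptance_stream h_def using \<nu>fQ
    by (subst pmf_bind_finite[of ?Q]) (auto simp: \<nu>f_def \<nu>_def Rn_def[abs_def] K_def K'_def case_prod_unfold)
  have yes: "avg X (\<lambda>x. avg Y (\<lambda>y. acceptance A (stream_pmf T (pmf_of_set D)
          (\<lambda>e. ed e (matching L R (x (left e)) (y (right e)))) (\<lambda>e. ed' e (matching L R (x (left e)) (y (right e)))))))
      = (\<Sum>q\<in>?Q. mean Sf q * h q)"
  proof -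
    have "avg X (\<lambda>x. avg Y (\<lambda>y. acceptance A (stream_pmf T (pmf_of_set D)
          (\<lambda>e. ed e (matching L R (x (left e)) (y (right e)))) (\<lambda>e. ed' e (matching L R (x (left e)) (y (right e)))))))
      = avg X (\<lambda>x. avg Y (\<lambda>y. \<Sum>q\<in>?Q. pmf (Sf x y) q * h q))"
    proof (intro avg_cong refl)
      fix x y assume xy: "x \<in> X" "y \<in> Y"
      show "acceptance A (stream_pmf T (pmf_of_set D)
          (\<lambda>e. ed e (matching L R (x (left e)) (y (right e)))) (\<lambda>e. ed' e (matching L R (x (left e)) (y (right e)))))
          = (\<Sum>q\<in>?Q. pmf (Sf x y) q * h q)"
        unfolding acceptance_stream h_def using SfQ[OF xy]
        by (subst pmf_bind_finite[of ?Q]) (auto simp: Sf_def S_def Ry_def[abs_def] K_def K'_def)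
    qed
    then show ?thesis by (simp add: avg_sum avg_multc mean_def)
  qed
  have "((\<Sum>q\<in>?Q. pmf \<nu>f q * h q) - (\<Sum>q\<in>?Q. mean Sf q * h q))\<^sup>2 \<le> 4 * kl_states ?Q (mean Sf) \<nu>f"
  proof (rule kl_states_distance)
    show "0 \<le> mean Sf q" for q unfolding mean_def by (intro avg_nonneg) simp
    have "(\<Sum>q\<in>?Q. mean Sf q) = avg X (\<lambda>x. avg Y (\<lambda>y. \<Sum>q\<in>?Q. pmf (Sf x y) q))" by (simp add: mean_def avg_sum)
    also have "\<dots> = avg X (\<lambda>x. avg Y (\<lambda>y. 1))"
      using SfQ by (intro avg_cong refl sum_pmf_le_set) auto
    finally show "(\<Sum>q\<in>?Q. mean Sf q) = 1" using Xne Yne by (simp add: avg_const)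
    show "pmf \<nu>f q > 0" if "mean Sf q > 0" for q
    proof (rule ccontr)
      assume "\<not> pmf \<nu>f q > 0"
      then have q: "q \<notin> set_pmf \<nu>f" by (simp add: pmf_positive_iff)
      have "mean Sf q = avg X (\<lambda>x. avg Y (\<lambda>y. 0))"
        unfolding mean_def using Sf\<nu> q by (intro avg_cong refl) (auto simp: pmf_eq_0_set_pmf)
      also have "\<dots> = 0" by (simp add: avg_def)
      finally show False using that by simp
    qed
    show "0 \<le> h q \<and> h q \<le> 1" for q by (simp add: h_def pmf_le_1)
  qed (use \<nu>fQ in auto)
  then show ?thesis unfolding no yes using kl by linarith
qed

lemma acceptance_le:
  assumes "\<And>xs. xs \<in> set_pmf P \<Longrightarrow> F xs \<Longrightarrow> accept_prob A xs \<le> a" "a \<ge> 0"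
  shows "acceptance A P \<le> a + measure_pmf.prob P {xs. \<not> F xs}"
proof -
  have ap: "0 \<le> accept_prob A xs" "accept_prob A xs \<le> 1" for xs by (simp_all add: accept_prob_def)
  have ind: "integrable (measure_pmf P) (indicator {xs. \<not> F xs} :: _ \<Rightarrow> real)"
    by (intro measure_pmf.integrable_const_bound[where B = 1]) (auto simp: indicator_def)
  have "acceptance A P \<le> measure_pmf.expectation P (\<lambda>xs. a + indicator {xs. \<not> F xs} xs)"
    unfolding acceptance_def
  proof (intro integral_mono_AE AE_pmfI)
    show "integrable (measure_pmf P) (accept_prob A)"
      using ap by (intro measure_pmf.integrable_const_bound[where B = 1]) auto
    show "integrable (measure_pmf P) (\<lambda>xs. a + indicator {xs. \<not> F xs} xs)"
      using assms(2) by (intro measure_pmf.integrable_const_bound[where B = "a + 1"]) (auto simp: indicator_def)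
    fix xs assume "xs \<in> set_pmf P"
    then show "accept_prob A xs \<le> a + indicator {xs. \<not> F xs} xs"
      using assms ap[of xs] by (auto simp: indicator_def intro: order_trans[OF ap(2)])
  qed
  also have "\<dots> = a + measure_pmf.prob P {xs. \<not> F xs}"
    by (subst Bochner_Integration.integral_add) (simp_all add: ind)
  finally show ?thesis .
qed

lemma acceptance_ge:
  assumes "\<And>xs. xs \<in> set_pmf P \<Longrightarrow> F xs \<Longrightarrow> a \<le> accept_prob A xs" "a \<le> 1"
  shows "a - measure_pmf.prob P {xs. \<not> F xs} \<le> acceptance A P"
proof -
  have ap: "0 \<le> accept_prob A xs" "accept_prob A xs \<le> 1" for xs by (simp_all add: accept_prob_def)
  have ind: "integrable (measure_pmf P) (indicator {xs. \<not> F xs} :: _ \<Rightarrow> real)"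
    by (intro measure_pmf.integrable_const_bound[where B = 1]) (auto simp: indicator_def)
  have "measure_pmf.expectation P (\<lambda>xs. a - indicator {xs. \<not> F xs} xs) \<le> acceptance A P"
    unfolding acceptance_def
  proof (intro integral_mono_AE AE_pmfI)
    show "integrable (measure_pmf P) (accept_prob A)"
      using ap by (intro measure_pmf.integrable_const_bound[where B = 1]) auto
    show "integrable (measure_pmf P) (\<lambda>xs. a - indicator {xs. \<not> F xs} xs)"
      by (intro measure_pmf.integrable_const_bound[where B = "\<bar>a\<bar> + 1"]) (auto simp: indicator_def)
    fix xs assume "xs \<in> set_pmf P"
    then show "a - indicator {xs. \<not> F xs} xs \<le> accept_prob A xs"
      using assms ap[of xs] by (auto simp: indicator_def intro: order_trans[OF _ ap(1)])
  qed
  moreover have "measure_pmf.expectation P (\<lambda>xs. a - indicator {xs. \<not> F xs} xs) = a - measure_pmf.prob P {xs. \<not> F xs}"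
    by (subst Bochner_Integration.integral_diff) (simp_all add: ind)
  ultimately show ?thesis by simp
qed

section \<open>Random base graphs\<close>

text \<open>The uniform average over lists of length T, defined by recursion so that independence
  means peeling off the head; \<open>expectation_replicate_pmf\<close> links it to
  \<open>replicate_pmf\<close>.\<close>

primrec lavg :: "nat \<Rightarrow> 'a set \<Rightarrow> ('a list \<Rightarrow> real) \<Rightarrow> real" where
  "lavg 0 D h = h []"
| "lavg (Suc T) D h = avg D (\<lambda>x. lavg T D (\<lambda>xs. h (x # xs)))"

lemma lavg_mono:
  assumes "\<And>xs. set xs \<subseteq> D \<Longrightarrow> length xs = T \<Longrightarrow> h xs \<le> k xs"
  shows "lavg T D h \<le> lavg T D k"
  using assms by (induction T arbitrary: h k) (auto intro!: avg_mono)

lemma lavg_sum: "lavg T D (\<lambda>xs. \<Sum>i\<in>I. h i xs) = (\<Sum>i\<in>I. lavg T D (h i))"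
  by (induction T arbitrary: h) (simp_all add: avg_sum)

lemma lavg_cmult: "lavg T D (\<lambda>xs. c * h xs) = c * lavg T D h"
  by (induction T arbitrary: h) (simp_all add: avg_cmult)

lemma lavg_const: "finite D \<Longrightarrow> D \<noteq> {} \<Longrightarrow> lavg T D (\<lambda>xs. c) = c"
  by (induction T) (simp_all add: avg_const)

lemma lavg_add: "lavg T D (\<lambda>xs. h xs + k xs) = lavg T D h + lavg T D k"
  by (induction T arbitrary: h k) (simp_all add: avg_add)

lemma lavg_prod_list: "lavg T D (\<lambda>xs. prod_list (map \<phi> xs)) = avg D \<phi> ^ T"
  by (induction T) (simp_all add: lavg_cmult avg_multc)

text \<open>Averages out the matchings for a fixed base graph: g sees only the base graph, and given
  that graph the matchings are independent.\<close>

lemma lavg_Times_prod_list: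
  assumes "finite D" "finite B"
  shows "lavg T (D \<times> B) (\<lambda>es. g (map fst es) * prod_list (map \<phi> es))
    = lavg T D (\<lambda>ps. g ps * prod_list (map (\<lambda>p. avg B (\<lambda>\<mu>. \<phi> (p, \<mu>))) ps))"
proof (induction T arbitrary: g)
  case (Suc T)
  have "lavg (Suc T) (D \<times> B) (\<lambda>es. g (map fst es) * prod_list (map \<phi> es))
    = avg (D \<times> B) (\<lambda>x. \<phi> x * lavg T (D \<times> B) (\<lambda>es. g (fst x # map fst es) * prod_list (map \<phi> es)))"
    unfolding lavg_cmult[symmetric] by (simp add: mult_ac)
  also have "\<dots> = avg (D \<times> B) (\<lambda>x. \<phi> x * lavg T D (\<lambda>ps. g (fst x # ps) * prod_list (map (\<lambda>p. avg B (\<lambda>\<mu>. \<phi> (p, \<mu>))) ps)))"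
    by (simp add: Suc.IH[of "\<lambda>ps. g (_ # ps)"])
  also have "\<dots> = avg D (\<lambda>p. avg B (\<lambda>\<mu>. \<phi> (p, \<mu>)) * lavg T D (\<lambda>ps. g (p # ps) * prod_list (map (\<lambda>p. avg B (\<lambda>\<mu>. \<phi> (p, \<mu>))) ps)))"
    using assms by (simp add: avg_Times avg_multc)
  also have "\<dots> = lavg (Suc T) D (\<lambda>ps. g ps * prod_list (map (\<lambda>p. avg B (\<lambda>\<mu>. \<phi> (p, \<mu>))) ps))"
    unfolding lavg_cmult[symmetric] by (simp add: mult_ac)
  finally show ?case .
qed simp

lemma lavg_map_fst:
  assumes "finite D" "finite B" "B \<noteq> {}"
  shows "lavg T (D \<times> B) (\<lambda>es. g (map fst es)) = lavg T D g"
  using lavg_Times_prod_list[OF assms(1,2), of T g "\<lambda>_. 1"] assms by (simp add: avg_const map_replicate_const)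

lemma finite_set_replicate_pmf: "finite (set_pmf p) \<Longrightarrow> finite (set_pmf (replicate_pmf T p))"
  by (simp add: set_replicate_pmf finite_lists_length_eq lists_eq_set)

lemma expectation_replicate_pmf:
  assumes "finite D" "D \<noteq> {}"
  shows "measure_pmf.expectation (replicate_pmf T (pmf_of_set D)) h = lavg T D h"
proof (induction T arbitrary: h)
  case (Suc T)
  have "measure_pmf.expectation (replicate_pmf (Suc T) (pmf_of_set D)) h
    = avg D (\<lambda>x. measure_pmf.expectation (map_pmf (\<lambda>xs. x # xs) (replicate_pmf T (pmf_of_set D))) h)"
    using assms by (simp add: map_pmf_def[symmetric] pmf_expectation_bind_pmf_of_set finite_set_replicate_pmf avg_def sum_divide_distrib sum_distrib_left divide_inverse mult.commute)
  then show ?case by (simp add: Suc.IH)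
qed simp

lemma prob_replicate_pmf:
  assumes "finite D" "D \<noteq> {}"
  shows "measure_pmf.prob (replicate_pmf T (pmf_of_set D)) {xs. P xs} = lavg T D (\<lambda>xs. of_bool (P xs))"
proof -
  have "measure_pmf.prob (replicate_pmf T (pmf_of_set D)) {xs. P xs}
    = measure_pmf.expectation (replicate_pmf T (pmf_of_set D)) (indicator {xs. P xs})" by simp
  also have "indicator {xs. P xs} = (\<lambda>xs. of_bool (P xs) :: real)" by (auto simp: indicator_def)
  finally show ?thesis by (simp only: expectation_replicate_pmf[OF assms])
qed

lemma lavg_of_bool_Ex:
  assumes "finite I" "\<And>i. i \<in> I \<Longrightarrow> lavg T D (\<lambda>xs. of_bool (P i xs)) \<le> b i"
  shows "lavg T D (\<lambda>xs. of_bool (\<exists>i\<in>I. P i xs)) \<le> (\<Sum>i\<in>I. b i)"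
proof -
  have "lavg T D (\<lambda>xs. of_bool (\<exists>i\<in>I. P i xs)) \<le> lavg T D (\<lambda>xs. \<Sum>i\<in>I. of_bool (P i xs))"
  proof (rule lavg_mono)
    fix xs
    show "of_bool (\<exists>i\<in>I. P i xs) \<le> (\<Sum>i\<in>I. of_bool (P i xs) :: real)"
    proof (cases "\<exists>i\<in>I. P i xs")
      case True
      then obtain i where i: "i \<in> I" "P i xs" by auto
      then have "of_bool (P i xs) \<le> (\<Sum>i\<in>I. of_bool (P i xs) :: real)" using assms(1) by (intro member_le_sum) auto
      then show ?thesis using i by auto
    qed (simp add: sum_nonneg)
  qed
  also have "\<dots> \<le> (\<Sum>i\<in>I. b i)" unfolding lavg_sum by (intro sum_mono assms(2))
  finally show ?thesis .
qed

text \<open>Evaluates union bounds over vertex sets whose failure probability is geometric in the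
  size of the set.\<close>

lemma sum_power_card_Pow: "finite V \<Longrightarrow> (\<Sum>X\<in>Pow V. q ^ card X) = (1 + q :: real) ^ card V"
proof (induction rule: finite_induct)
  case (insert v V)
  have inj: "inj_on (insert v) (Pow V)" using insert by (auto simp: inj_on_def)
  have "(\<Sum>X\<in>Pow (insert v V). q ^ card X) = (\<Sum>X\<in>Pow V. q ^ card X) + (\<Sum>X\<in>insert v ` Pow V. q ^ card X)"
    unfolding Pow_insert using insert by (intro sum.union_disjoint) auto
  also have "(\<Sum>X\<in>insert v ` Pow V. q ^ card X) = (\<Sum>X\<in>Pow V. q * q ^ card X)"
    unfolding sum.reindex[OF inj] using insert by (intro sum.cong refl) (auto simp: finite_subset card_insert_if)
  finally show ?case using insert by (simp add: algebra_simps flip: sum_distrib_left)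
qed simp

lemma one_plus_power_minus_one_le:
  assumes "q \<ge> 0" "real m * q \<le> 1"
  shows "(1 + q) ^ m - 1 \<le> 2 * (real m * q)"
proof -
  have "(1 + q) ^ m \<le> exp q ^ m" using assms by (intro power_mono) auto
  also have "\<dots> = exp (real m * q)" by (simp add: exp_of_nat_mult)
  also have "\<dots> \<le> 1 + real m * q + (real m * q)\<^sup>2" using assms by (intro exp_bound) auto
  also have "(real m * q)\<^sup>2 \<le> real m * q * 1" unfolding power2_eq_square using assms by (intro mult_left_mono) auto
  finally show ?thesis by linarith
qed

section \<open>Cuts and multiplicities of the random base graph\<close>

definition base_cut :: "(nat \<times> nat) list \<Rightarrow> nat set \<Rightarrow> nat set \<Rightarrow> nat" where
  "base_cut ps X Y = length (filter (\<lambda>(a, b). (a \<in> X) \<noteq> (b \<in> Y)) ps)"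

text \<open>The number of chosen vertices times the fraction of the 2 H vertices not chosen. Unlike
  the minimum of a set and its complement, this product is multiaffine in the indicators up to
  diagonal terms, which \<open>good_base_fractional\<close> relies on.\<close>

definition base_weight :: "nat \<Rightarrow> nat set \<Rightarrow> nat set \<Rightarrow> real" where
  "base_weight H X Y = real (card X + card Y) * (2 * real H - real (card X + card Y)) / (2 * real H)"

text \<open>Sets with more than half of the vertices are included, because the fractional extension
  interpolates between all 0/1 vectors. Multiplicity 2 feeds
  \<open>stream_mult_bounded\<close>.\<close>

definition good_base :: "nat \<Rightarrow> real \<Rightarrow> (nat \<times> nat) list \<Rightarrow> bool" where
  "good_base H \<beta> ps \<longleftrightarrow> set ps \<subseteq> {..<H} \<times> {..<H} \<and>
     (\<forall>X Y. X \<subseteq> {..<H} \<longrightarrow> Y \<subseteq> {..<H} \<longrightarrow> \<beta> * base_weight H X Y \<le> base_cut ps X Y) \<and>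
     (\<forall>p. count_list ps p \<le> 2)"

text \<open>The cut probability exceeds the left side by (x - y)^2 / (2 H^2), where x and y are the
  two cardinalities.\<close>

lemma avg_base_cut:
  assumes H: "H > 0" and X: "X \<subseteq> {..<H}" "Y \<subseteq> {..<H}"
  shows "base_weight H X Y / H \<le> avg ({..<H} \<times> {..<H}) (\<lambda>(a, b). of_bool ((a \<in> X) \<noteq> (b \<in> Y)))"
proof -
  define x y where "x = real (card X)" and "y = real (card Y)"
  have fin: "finite X" "finite Y" using X finite_subset by blast+
  have sX: "(\<Sum>a<H. of_bool (a \<in> X)) = x" "(\<Sum>b<H. of_bool (b \<in> Y)) = y"
    using X by (simp_all add: x_def y_def of_bool_def sum.If_cases Int_absorb2 Int_commute)
  have "(\<Sum>a<H. \<Sum>b<H. of_bool ((a \<in> X) \<noteq> (b \<in> Y)))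
     = (\<Sum>a<H. \<Sum>b<H. of_bool (a \<in> X) + of_bool (b \<in> Y) - 2 * (of_bool (a \<in> X) * of_bool (b \<in> Y)) :: real)"
    by (intro sum.cong refl) auto
  also have "\<dots> = real H * x + real H * y - 2 * (x * y)"
    by (simp add: sum.distrib sum_subtractf sX flip: sum_distrib_left sum_distrib_right)
  finally have s: "(\<Sum>a<H. \<Sum>b<H. of_bool ((a \<in> X) \<noteq> (b \<in> Y))) = real H * x + real H * y - 2 * (x * y)" .
  have "avg ({..<H} \<times> {..<H}) (\<lambda>(a, b). of_bool ((a \<in> X) \<noteq> (b \<in> Y))) = (real H * x + real H * y - 2 * (x * y)) / (real H)\<^sup>2"
    unfolding s[symmetric]
    by (subst avg_Times) (simp_all only: finite_lessThan prod.case avg_def card_lessThan power2_eq_square divide_divide_eq_left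
        sum_divide_distrib[symmetric])
  moreover have "(x + y) * (2 * real H - (x + y)) / 2 \<le> real H * x + real H * y - 2 * (x * y)"
    using zero_le_power2[of "x - y"] by (simp add: power2_eq_square field_simps)
  then have "(x + y) * (2 * real H - (x + y)) / 2 / (real H)\<^sup>2 \<le> (real H * x + real H * y - 2 * (x * y)) / (real H)\<^sup>2"
    by (rule divide_right_mono) simp
  moreover have "base_weight H X Y / H = (x + y) * (2 * real H - (x + y)) / 2 / (real H)\<^sup>2"
    by (simp add: base_weight_def x_def y_def power2_eq_square)
  ultimately show ?thesis by linarith
qed

lemma exp_minus_one_le: "exp (- 1) \<le> (2/5 :: real)"
  using exp_lower_Taylor_quadratic[of 1] by (simp add: exp_minus field_simps)

lemma exp_minus_two_le: "exp (- 2) \<le> (1/5 :: real)"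
  using exp_lower_Taylor_quadratic[of 2] by (simp add: exp_minus field_simps)

text \<open>Exponential moment with parameter 1. As exp (- 1) <= 2/5, each round contributes at most
  exp (- (3/5) w / H); 18 H \<Lambda> rounds against the threshold leave 7 - 54/5 <= - 3 times
  \<Lambda> w, and \<open>small\<close> makes w at least half the size of the set. The resulting
  rate 3/2 exceeds the 1 needed for the union bound when \<Lambda> = ln n.\<close>

lemma base_cut_tail:
  assumes H: "H > 0" and X: "X \<subseteq> {..<H}" "Y \<subseteq> {..<H}" and \<Lambda>: "\<Lambda> \<ge> 0" and T: "18 * real H * \<Lambda> \<le> real T"
    and small: "card X + card Y \<le> H"
  shows "lavg T ({..<H} \<times> {..<H}) (\<lambda>ps. of_bool (base_cut ps X Y < 7 * \<Lambda> * base_weight H X Y))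
    \<le> exp (- (3/2) * \<Lambda>) ^ (card X + card Y)"
proof -
  define w where "w = base_weight H X Y"
  let ?D = "{..<H} \<times> {..<H}"
  let ?c = "\<lambda>(a, b). of_bool ((a \<in> X) \<noteq> (b \<in> Y)) :: real"
  have w: "real (card X + card Y) / 2 \<le> w"
  proof -
    have "real (card X + card Y) * real H \<le> real (card X + card Y) * (2 * real H - real (card X + card Y))"
      using small by (intro mult_left_mono) auto
    then show ?thesis using H by (simp add: w_def base_weight_def field_simps)
  qed
  have w0: "w \<ge> 0" using w by (meson divide_nonneg_nonneg of_nat_0_le_iff order_trans zero_le_numeral)
  have D: "finite ?D" "?D \<noteq> {}" using H by auto
  have "lavg T ?D (\<lambda>ps. of_bool (base_cut ps X Y < 7 * \<Lambda> * w)) \<le> lavg T ?D (\<lambda>ps. exp (7 * \<Lambda> * w) * prod_list (map (\<lambda>p. exp (- ?c p)) ps))"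
  proof (rule lavg_mono)
    fix ps
    have "prod_list (map (\<lambda>p. exp (- ?c p)) ps) = exp (- real (base_cut ps X Y))"
      by (induction ps) (auto simp: base_cut_def mult_exp_exp)
    then show "of_bool (base_cut ps X Y < 7 * \<Lambda> * w) \<le> exp (7 * \<Lambda> * w) * prod_list (map (\<lambda>p. exp (- ?c p)) ps)"
      by (simp add: mult_exp_exp of_bool_def)
  qed
  also have "\<dots> = exp (7 * \<Lambda> * w) * avg ?D (\<lambda>p. exp (- ?c p)) ^ T"
    by (simp add: lavg_cmult lavg_prod_list)
  also have "avg ?D (\<lambda>p. exp (- ?c p)) \<le> exp (- (3/5) * (w / H))"
  proof -
    have "avg ?D (\<lambda>p. exp (- ?c p)) \<le> avg ?D (\<lambda>p. 1 - (3/5) * ?c p)"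
      using exp_minus_one_le by (intro avg_mono) (auto simp: of_bool_def)
    also have "\<dots> = 1 - (3/5) * avg ?D ?c" by (simp only: avg_diff avg_cmult avg_const[OF D])
    also have "\<dots> \<le> 1 - (3/5) * (w / H)" using avg_base_cut[OF H X] by (simp add: w_def)
    also have "\<dots> \<le> exp (- (3/5) * (w / H))" using exp_ge_add_one_self[of "- (3/5) * (w / H)"] by simp
    finally show ?thesis .
  qed
  then have "exp (7 * \<Lambda> * w) * avg ?D (\<lambda>p. exp (- ?c p)) ^ T \<le> exp (7 * \<Lambda> * w) * exp (- (3/5) * (w / H)) ^ T"
    by (intro mult_left_mono power_mono avg_nonneg) auto
  also have "\<dots> = exp (7 * \<Lambda> * w - (3/5) * (real T / H) * w)"
    by (simp add: exp_of_nat_mult[symmetric] mult_exp_exp algebra_simps)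
  also have "\<dots> \<le> exp (- 3 * \<Lambda> * w)"
  proof -
    have "18 * \<Lambda> \<le> real T / H" using T H by (simp add: field_simps)
    then have "18 * \<Lambda> * w \<le> real T / H * w" using w0 by (rule mult_right_mono)
    moreover have "0 \<le> \<Lambda> * w" using w0 \<Lambda> by simp
    ultimately have "7 * (\<Lambda> * w) - (3/5) * (real T / H * w) \<le> - 3 * (\<Lambda> * w)" by linarith
    then show ?thesis by (simp only: exp_le_cancel_iff mult.assoc)
  qed
  also have "\<dots> \<le> exp (- 3 * \<Lambda> * (real (card X + card Y) / 2))"
    using mult_left_mono[OF w, of "3 * \<Lambda>"] \<Lambda> by simp
  also have "\<dots> = exp (- (3/2) * \<Lambda>) ^ (card X + card Y)"
    by (simp add: exp_of_nat_mult[symmetric] algebra_simps)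
  finally show ?thesis by (simp add: w_def)
qed

lemma base_cut_complement:
  assumes "set ps \<subseteq> {..<H} \<times> {..<H}"
  shows "base_cut ps ({..<H} - X) ({..<H} - Y) = base_cut ps X Y"
  unfolding base_cut_def using assms by (intro arg_cong[of _ _ length] filter_cong refl) auto

lemma base_weight_complement:
  assumes "X \<subseteq> {..<H}" "Y \<subseteq> {..<H}"
  shows "base_weight H ({..<H} - X) ({..<H} - Y) = base_weight H X Y"
proof -
  have "card X \<le> H" "card Y \<le> H" using assms by (metis card_lessThan card_mono finite_lessThan)+
  then have "real (card ({..<H} - X) + card ({..<H} - Y)) = 2 * real H - real (card X + card Y)"
    using assms by (simp add: card_Diff_subset finite_subset)
  then show ?thesis by (simp add: base_weight_def)
qed

text \<open>Markov's inequality for \<open>\<theta> ^ count_list ps p\<close>, where \<theta> is the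
  inverse of the expected count; the average of this power is then at most exp 1. Three occurrences
  are excluded because the union over H^2 pairs gives order T^3 / H^4, which vanishes for T of order
  H ln n, whereas excluding two would give T^2 / H^2, which does not.\<close>

lemma multiplicity_tail:
  assumes H: "H > 0" and T: "0 < T" "T \<le> H\<^sup>2" and p: "p \<in> {..<H} \<times> {..<H}"
  shows "lavg T ({..<H} \<times> {..<H}) (\<lambda>ps. of_bool (count_list ps p > 2)) \<le> 3 * (real T / (real H)\<^sup>2) ^ 3"
proof -
  let ?D = "{..<H} \<times> {..<H}"
  define \<theta> where "\<theta> = (real H)\<^sup>2 / real T"
  have "real T \<le> (real H)\<^sup>2" using T(2) by (metis of_nat_le_iff of_nat_power)
  then have \<theta>: "\<theta> \<ge> 1" using T by (simp add: \<theta>_def)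
  have "lavg T ?D (\<lambda>ps. of_bool (count_list ps p > 2)) \<le> lavg T ?D (\<lambda>ps. (1/\<theta>)^3 * prod_list (map (\<lambda>x. if x = p then \<theta> else 1) ps))"
  proof (rule lavg_mono)
    fix ps :: "(nat \<times> nat) list"
    have pl: "prod_list (map (\<lambda>x. if x = p then \<theta> else 1) ps) = \<theta> ^ count_list ps p"
      by (induction ps) auto
    show "of_bool (count_list ps p > 2) \<le> (1/\<theta>)^3 * prod_list (map (\<lambda>x. if x = p then \<theta> else 1) ps)"
    proof (cases "count_list ps p > 2")
      case True
      then have "\<theta> ^ 3 \<le> \<theta> ^ count_list ps p" using \<theta> by (intro power_increasing) auto
      then show ?thesis using True \<theta> by (simp add: pl field_simps)
    qed (use \<theta> pl in simp)
  qed
  also have "\<dots> = (1/\<theta>)^3 * avg ?D (\<lambda>x. if x = p then \<theta> else 1) ^ T"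
    by (simp add: lavg_cmult lavg_prod_list)
  also have "avg ?D (\<lambda>x. if x = p then \<theta> else 1) \<le> exp (1 / real T)"
  proof -
    have "(\<lambda>x. if x = p then \<theta> else 1) = (\<lambda>x. 1 + (\<theta> - 1) * of_bool (x = p))" by auto
    then have "avg ?D (\<lambda>x. if x = p then \<theta> else 1) = 1 + (\<theta> - 1) * avg ?D (\<lambda>x. of_bool (x = p))"
      using H by (simp add: avg_add avg_cmult avg_const lessThan_empty_iff)
    also have "avg ?D (\<lambda>x. of_bool (x = p)) = 1 / (real H)\<^sup>2"
      using p by (simp add: avg_def of_bool_def power2_eq_square)
    also have "1 + (\<theta> - 1) * (1 / (real H)\<^sup>2) \<le> 1 + \<theta> * (1 / (real H)\<^sup>2)"
      by (intro add_left_mono mult_right_mono) auto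
    also have "\<theta> * (1 / (real H)\<^sup>2) = 1 / real T" using H by (simp add: \<theta>_def)
    also have "1 + 1 / real T \<le> exp (1 / real T)" by simp
    finally show ?thesis .
  qed
  then have "(1/\<theta>)^3 * avg ?D (\<lambda>x. if x = p then \<theta> else 1) ^ T \<le> (1/\<theta>)^3 * exp (1 / real T) ^ T"
    using \<theta> by (intro mult_left_mono power_mono avg_nonneg) auto
  also have "exp (1 / real T) ^ T = exp 1" using T by (simp add: exp_of_nat_mult[symmetric])
  also have "(1/\<theta>)^3 * exp 1 \<le> (1/\<theta>)^3 * 3" using exp_le \<theta> by (intro mult_left_mono) auto
  finally show ?thesis by (simp add: \<theta>_def mult.commute)
qed

lemma of_bool_le_add: "(P \<Longrightarrow> Q \<or> R) \<Longrightarrow> of_bool P \<le> of_bool Q + (of_bool R :: real)"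
  by auto

text \<open>A union bound over the nonempty sets with at most H vertices, geometric in their size;
  larger sets follow by passing to complements, under which cut and weight are invariant.\<close>

lemma good_base_whp:
  assumes H: "H > 0" and \<Lambda>: "\<Lambda> \<ge> 0" and T: "18 * real H * \<Lambda> \<le> real T" "0 < T" "T \<le> H\<^sup>2"
    and small: "2 * real H * exp (- (3/2) * \<Lambda>) \<le> 1"
  shows "lavg T ({..<H} \<times> {..<H}) (\<lambda>ps. of_bool (\<not> good_base H (7 * \<Lambda>) ps))
    \<le> 4 * real H * exp (- (3/2) * \<Lambda>) + 3 * real T ^ 3 / real H ^ 4"
proof -
  let ?D = "{..<H} \<times> {..<H}"
  define q where "q = exp (- (3/2) * \<Lambda>)"
  define I where "I = {p \<in> Pow {..<H} \<times> Pow {..<H}. p \<noteq> ({}, {})}"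
  define bad1 where "bad1 p ps \<longleftrightarrow> card (fst p) + card (snd p) \<le> H \<and> base_cut ps (fst p) (snd p) < 7 * \<Lambda> * base_weight H (fst p) (snd p)"
    for p ps
  have I: "finite I" by (simp add: I_def)
  have "lavg T ?D (\<lambda>ps. of_bool (\<exists>p\<in>I. bad1 p ps)) \<le> (\<Sum>p\<in>I. q ^ (card (fst p) + card (snd p)))"
  proof (rule lavg_of_bool_Ex[OF I])
    fix p assume p: "p \<in> I"
    show "lavg T ?D (\<lambda>ps. of_bool (bad1 p ps)) \<le> q ^ (card (fst p) + card (snd p))"
    proof (cases "card (fst p) + card (snd p) \<le> H")
      case True
      then show ?thesis using base_cut_tail[OF H _ _ \<Lambda> T(1) True] p by (auto simp: I_def bad1_def q_def)
    next
      case False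
      then have "lavg T ?D (\<lambda>ps. of_bool (bad1 p ps)) = 0" using H
        by (simp add: bad1_def lavg_const lessThan_empty_iff)
      then show ?thesis by (simp add: q_def)
    qed
  qed
  also have "\<dots> = (1 + q) ^ (2 * H) - 1"
  proof -
    have "(\<Sum>p\<in>Pow {..<H} \<times> Pow {..<H}. q ^ (card (fst p) + card (snd p)))
      = (\<Sum>X\<in>Pow {..<H}. q ^ card X) * (\<Sum>Y\<in>Pow {..<H}. q ^ card Y)"
      by (simp add: sum_product sum.cartesian_product power_add case_prod_unfold)
    also have "\<dots> = (1 + q) ^ (2 * H)" by (simp add: sum_power_card_Pow power2_eq_square power_mult mult_2 power_add)
    finally have "(\<Sum>p\<in>Pow {..<H} \<times> Pow {..<H}. q ^ (card (fst p) + card (snd p))) = (1 + q) ^ (2 * H)" .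
    moreover have "Pow {..<H} \<times> Pow {..<H} = insert ({}, {}) I" by (auto simp: I_def)
    ultimately have "(1 + q) ^ (2 * H) = (\<Sum>p\<in>insert ({}, {}) I. q ^ (card (fst p) + card (snd p)))" by (simp only:)
    also have "\<dots> = 1 + (\<Sum>p\<in>I. q ^ (card (fst p) + card (snd p)))"
      using I by (subst sum.insert) (auto simp: I_def)
    finally show ?thesis by simp
  qed
  also have "\<dots> \<le> 2 * (real (2 * H) * q)"
    using small by (intro one_plus_power_minus_one_le) (auto simp: q_def)
  finally have b1: "lavg T ?D (\<lambda>ps. of_bool (\<exists>p\<in>I. bad1 p ps)) \<le> 4 * real H * q" by simp
  have "lavg T ?D (\<lambda>ps. of_bool (\<exists>p\<in>?D. count_list ps p > 2)) \<le> (\<Sum>p\<in>?D. 3 * (real T / (real H)\<^sup>2) ^ 3)"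
    by (rule lavg_of_bool_Ex) (use multiplicity_tail[OF H T(2,3)] in auto)
  also have "\<dots> = 3 * real T ^ 3 / real H ^ 4"
    using H by (simp add: power_divide power2_eq_square power3_eq_cube power4_eq_xxxx)
  finally have b2: "lavg T ?D (\<lambda>ps. of_bool (\<exists>p\<in>?D. count_list ps p > 2)) \<le> 3 * real T ^ 3 / real H ^ 4" .
  have "lavg T ?D (\<lambda>ps. of_bool (\<not> good_base H (7 * \<Lambda>) ps))
    \<le> lavg T ?D (\<lambda>ps. of_bool (\<exists>p\<in>I. bad1 p ps) + of_bool (\<exists>p\<in>?D. count_list ps p > 2))"
  proof (rule lavg_mono)
    fix ps assume ps: "set ps \<subseteq> ?D"
    have "good_base H (7 * \<Lambda>) ps" if n1: "\<not> (\<exists>p\<in>I. bad1 p ps)" and n2: "\<not> (\<exists>p\<in>?D. count_list ps p > 2)"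
      unfolding good_base_def
    proof (intro conjI allI impI)
      show "set ps \<subseteq> ?D" by (rule ps)
      show "count_list ps p \<le> 2" for p
      proof (cases "p \<in> ?D")
        case False
        then have "p \<notin> set ps" using ps by auto
        then show ?thesis by (simp add: count_notin)
      next
        case True
        then have "\<not> count_list ps p > 2" using n2 by blast
        then show ?thesis by simp
      qed
      fix X Y assume XY: "X \<subseteq> {..<H}" "Y \<subseteq> {..<H}"
      have sm: "7 * \<Lambda> * base_weight H X Y \<le> base_cut ps X Y"
        if XY: "X \<subseteq> {..<H}" "Y \<subseteq> {..<H}" and "card X + card Y \<le> H" for X Y
      proof (cases "(X, Y) = ({}, {})")
        case False
        then have "(X, Y) \<in> I" using XY by (auto simp: I_def)
        then have "\<not> bad1 (X, Y) ps" using n1 by blast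
        then show ?thesis using that(3) by (simp add: bad1_def)
      qed (simp add: base_weight_def)
      show "7 * \<Lambda> * base_weight H X Y \<le> base_cut ps X Y"
      proof (cases "card X + card Y \<le> H")
        case False
        have "card X \<le> H" "card Y \<le> H" using XY by (metis card_lessThan card_mono finite_lessThan)+
        then have "card ({..<H} - X) + card ({..<H} - Y) \<le> H"
          using XY False by (simp add: card_Diff_subset finite_subset)
        from sm[OF _ _ this] show ?thesis
          using XY ps by (simp add: base_cut_complement base_weight_complement)
      qed (use sm XY in simp)
    qed
    then show "of_bool (\<not> good_base H (7 * \<Lambda>) ps) \<le> of_bool (\<exists>p\<in>I. bad1 p ps) + (of_bool (\<exists>p\<in>?D. count_list ps p > 2) :: real)"
      by (intro of_bool_le_add) blast
  qed
  also have "\<dots> \<le> 4 * real H * q + 3 * real T ^ 3 / real H ^ 4"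
    using b1 b2 by (simp add: lavg_add)
  finally show ?thesis by (simp add: q_def)
qed

section \<open>Graphs built from blocks\<close>

text \<open>Two vertices suffice for a singleton to be an admissible set, so the minimum is taken
  over a nonempty finite set.\<close>

lemma edge_expansion_ge:
  assumes V: "finite V" "card V \<ge> 2"
    and cut: "\<And>S. S \<subseteq> V \<Longrightarrow> 0 < card S \<Longrightarrow> 2 * card S \<le> card V \<Longrightarrow> \<phi> * real (card S) \<le> real (cut_size E S)"
  shows "\<phi> \<le> edge_expansion V E"
proof -
  let ?F = "{real (cut_size E S) / real (card S) | S. S \<subseteq> V \<and> 0 < card S \<and> 2 * card S \<le> card V}"
  have "?F = (\<lambda>S. real (cut_size E S) / real (card S)) ` {S \<in> Pow V. 0 < card S \<and> 2 * card S \<le> card V}" by auto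
  then have fin: "finite ?F" using V by simp
  obtain v where v: "v \<in> V" using V by fastforce
  then have "real (cut_size E {v}) / real (card {v}) \<in> ?F" using V by (intro CollectI exI[of _ "{v}"]) auto
  then have ne: "?F \<noteq> {}" by blast
  show ?thesis unfolding edge_expansion_def
  proof (subst Min_ge_iff[OF fin ne], rule ballI)
    fix z assume "z \<in> ?F"
    then obtain S where "z = real (cut_size E S) / real (card S)" "S \<subseteq> V" "0 < card S" "2 * card S \<le> card V" by blast
    then show "\<phi> \<le> z" using cut[of S] by (simp add: pos_le_divide_eq)
  qed
qed

lemma cut_size_mset: "cut_size (mset xs) S = length (filter (\<lambda>(u, v). (u \<in> S) \<noteq> (v \<in> S)) xs)"
  by (simp add: cut_size_def flip: mset_filter)

lemma count_mset_take_le: "count (mset (take k xs)) x \<le> count (mset xs) x"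
  by (induction xs arbitrary: k) (auto simp: take_Cons split: nat.splits)

locale block_graph =
  fixes n t :: nat
  assumes t: "t > 0" and N2': "n div t \<ge> 2"
begin

definition "N = n div t"
definition "r = n mod t"
definition "NL = N div 2"
definition "NR = N - NL"
definition "H = NL + 1"

lemma n_eq: "n = N * t + r" by (simp add: N_def r_def)
lemma r_less: "r < t" using t by (simp add: r_def)
lemma NL_pos: "0 < NL" and NR_pos: "0 < NR" and NLR: "NL + NR = N" and H_NR: "H \<le> NR + 1" "NR \<le> H" and N_H: "2 * H \<le> N + 2" "N < 2 * H"
proof -
  have "2 \<le> M \<Longrightarrow> 0 < M div 2 \<and> 0 < M - M div 2 \<and> M div 2 + (M - M div 2) = M \<and> M div 2 + 1 \<le> M - M div 2 + 1 \<and>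
     M - M div 2 \<le> M div 2 + 1 \<and> 2 * (M div 2 + 1) \<le> M + 2 \<and> M < 2 * (M div 2 + 1)" for M :: nat
    by presburger
  from this[OF N2'] show "0 < NL" "0 < NR" "NL + NR = N" "H \<le> NR + 1" "NR \<le> H" "2 * H \<le> N + 2" "N < 2 * H"
    by (auto simp: H_def NR_def NL_def N_def)
qed

lemma t_le: "t \<le> N * t" "NL * t \<le> N * t"
  using NL_pos NLR by (auto intro: mult_le_mono1)

text \<open>The n = N t + r vertices form NL left blocks and NR right blocks of t vertices and r leftover
  vertices. The base graph has H vertices on each side. Left vertex NL stands for a copy of block 0 in
  which the leftover vertices replace the first r ones; on the right, indices wrap around, so that one
  block may be used twice.\<close>

definition VL :: "nat \<Rightarrow> nat \<Rightarrow> nat" where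
  "VL a i = (if a < NL then a * t + i else if i < r then N * t + i else i)"

definition VR :: "nat \<Rightarrow> nat \<Rightarrow> nat" where
  "VR b j = (NL + b mod NR) * t + j"

definition round_edges :: "nat \<times> nat \<Rightarrow> (nat \<Rightarrow> nat) \<Rightarrow> edge list" where
  "round_edges p \<mu> = map (\<lambda>i. (VL (fst p) i, VR (snd p) (\<mu> i))) [0..<t]"

abbreviation "base_pairs \<equiv> {..<H} \<times> {..<H}"
abbreviation "perms \<equiv> bijs {..<t} {..<t}"

lemma block_less: "a < k \<Longrightarrow> i < t \<Longrightarrow> a * t + i < k * t"
proof -
  assume "a < k" "i < t"
  then have "Suc a * t \<le> k * t" by (intro mult_le_mono1) auto
  then show ?thesis using \<open>i < t\<close> by simp
qed

lemma VL_cases: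
  assumes "i < t"
  obtains "VL a i < NL * t" | "N * t \<le> VL a i" "VL a i = N * t + i" "i < r" "\<not> a < NL"
proof (cases "a < NL \<or> \<not> i < r")
  case True
  then have "VL a i < NL * t" using block_less[of a NL i] block_less[of 0 NL i] NL_pos assms by (auto simp: VL_def)
  then show ?thesis using that by blast
next
  case False
  then show ?thesis using that by (auto simp: VL_def)
qed

lemma VL_less_n:
  assumes "i < t" shows "VL a i < n"
  using assms by (rule VL_cases[of i a]) (use t_le n_eq in linarith)+

lemma VR_bounds:
  assumes "j < t" shows "NL * t \<le> VR b j" "VR b j < N * t" "VR b j < n"
proof -
  have "NL + b mod NR < N" using NLR NR_pos by (metis add_less_cancel_left mod_less_divisor)
  then show "VR b j < N * t" using block_less assms by (simp add: VR_def)
  then show "VR b j < n" using n_eq by simp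
  show "NL * t \<le> VR b j" by (simp add: VR_def algebra_simps)
qed

lemma VL_neq_VR: "i < t \<Longrightarrow> j < t \<Longrightarrow> VL a i \<noteq> VR b j"
  using VR_bounds[of j b] by (rule_tac VL_cases[of i a]) auto

lemma VL_inj: "i < t \<Longrightarrow> i' < t \<Longrightarrow> VL a i = VL a i' \<Longrightarrow> i = i'"
proof -
  have nk: "\<not> N * t + k < t" for k using t_le(1) by linarith
  show "i < t \<Longrightarrow> i' < t \<Longrightarrow> VL a i = VL a i' \<Longrightarrow> i = i'"
    by (auto simp: VL_def nk split: if_splits)
qed

lemma vertex_cases:
  assumes "v < n"
  obtains (L) "v < NL * t" "v div t < NL" "v mod t < t" "v = VL (v div t) (v mod t)"
  | (R) "NL * t \<le> v" "v < N * t" "v div t - NL < NR" "v mod t < t" "v = VR (v div t - NL) (v mod t)"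
  | (X) "N * t \<le> v" "v - N * t < r" "v = VL NL (v - N * t)"
proof (cases "v < NL * t")
  case True
  then have "v div t < NL" using t by (simp add: less_mult_imp_div_less)
  then show ?thesis using that(1) True t by (simp add: VL_def)
next
  case False
  show ?thesis
  proof (cases "v < N * t")
    case True
    have 1: "v div t < N" using True t by (simp add: less_mult_imp_div_less)
    have 2: "NL \<le> v div t" using False t by (simp add: less_eq_div_iff_mult_less_eq)
    have "v div t - NL < NR" using 1 2 NLR by linarith
    moreover from this have "v = VR (v div t - NL) (v mod t)" using 2 by (simp add: VR_def)
    ultimately show ?thesis using that(2) True False t by simp
  next
    case F: False
    then show ?thesis using that(3) assms n_eq by (simp add: VL_def)
  qed
qed

text \<open>An edge leaves two candidates for the base vertex on each side: the block itself and an
  alias, caused by the extra copy of block 0 on the left and by the wrap-around on the right. The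
  last disjunct covers \<mu> that leave the range, where only the distinctness of the edges of a
  round is used.\<close>

lemma round_edges_count:
  assumes p: "p \<in> base_pairs"
  shows "count (mset (round_edges p \<mu>)) (u, v) \<le> of_bool (fst p \<in> {u div t, NL} \<and> snd p \<in> {v div t - NL, v div t - NL + NR} \<or> \<not> \<mu> ` {..<t} \<subseteq> {..<t})"
proof (cases "\<mu> ` {..<t} \<subseteq> {..<t}")
  case True
  have "distinct (round_edges p \<mu>)"
    unfolding round_edges_def distinct_map using VL_inj[of _ _ "fst p"] by (auto simp: inj_on_def)
  then have c: "count (mset (round_edges p \<mu>)) (u, v) = of_bool ((u, v) \<in> set (round_edges p \<mu>))"
    by (simp add: distinct_count_atmost_1)
  have "fst p \<in> {u div t, NL} \<and> snd p \<in> {v div t - NL, v div t - NL + NR}" if uv: "(u, v) \<in> set (round_edges p \<mu>)"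
  proof -
    obtain i where i: "i < t" "u = VL (fst p) i" "v = VR (snd p) (\<mu> i)" using uv by (auto simp: round_edges_def)
    have j: "\<mu> i < t" using True i by auto
    have "fst p \<le> NL" "snd p \<le> NR" using p H_NR by (auto simp: H_def)
    then have "fst p \<in> {u div t, NL}" using i t by (auto simp: VL_def)
    moreover have "v div t - NL = snd p mod NR" using i j t by (simp add: VR_def)
    moreover have "snd p = snd p mod NR \<or> snd p = snd p mod NR + NR" using \<open>snd p \<le> NR\<close> by (cases "snd p = NR") auto
    ultimately show ?thesis by auto
  qed
  then show ?thesis unfolding c by auto
next
  case False
  have "distinct (round_edges p \<mu>)"
    unfolding round_edges_def distinct_map using VL_inj[of _ _ "fst p"] by (auto simp: inj_on_def)
  then show ?thesis using False by (simp add: distinct_count_atmost_1)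
qed

text \<open>The last round is cut to r' edges to match a number of edges not divisible by t.\<close>

definition stream :: "nat \<Rightarrow> ((nat \<times> nat) \<times> (nat \<Rightarrow> nat)) list \<Rightarrow> (nat \<times> nat) \<times> (nat \<Rightarrow> nat) \<Rightarrow> edge list" where
  "stream r' es e = concat (map (\<lambda>(p, \<mu>). round_edges p \<mu>) es) @ take r' (case e of (p, \<mu>) \<Rightarrow> round_edges p \<mu>)"

lemma length_round_edges: "length (round_edges p \<mu>) = t"
  by (simp add: round_edges_def)

lemma length_stream: "r' \<le> t \<Longrightarrow> length (stream r' es e) = length es * t + r'"
  by (induction es) (auto simp: stream_def length_round_edges split: prod.splits)

lemma stream_multigraph:
  assumes "set es \<subseteq> base_pairs \<times> perms" "e \<in> base_pairs \<times> perms"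
  shows "multigraph_on {..<n} (mset (stream r' es e))"
  unfolding multigraph_on_def
proof (rule ballI)
  fix d assume "d \<in># mset (stream r' es e)"
  then obtain p \<mu> where "(p, \<mu>) \<in> insert e (set es)" "d \<in> set (round_edges p \<mu>)"
    by (auto simp: stream_def split: prod.splits dest!: in_set_takeD)
  moreover from this assms have "\<mu> \<in> perms" by auto
  ultimately obtain i where "i < t" "\<mu> i < t" "d = (VL (fst p) i, VR (snd p) (\<mu> i))"
    by (auto simp: round_edges_def dest: bijsD(5))
  then show "fst d \<in> {..<n} \<and> snd d \<in> {..<n} \<and> fst d \<noteq> snd d"
    using VL_less_n VR_bounds VL_neq_VR by simp
qed

text \<open>At most four base pairs can produce a given ordered edge, each in at most two full
  rounds, and the cut round adds one: 9 for each orientation.\<close>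

lemma stream_mult_bounded:
  assumes es: "set es \<subseteq> base_pairs \<times> perms" "e \<in> base_pairs \<times> perms"
    and mult: "\<And>p. count_list (map fst es) p \<le> 2"
  shows "mult_bounded 18 (mset (stream r' es e))"
proof -
  have one: "count (mset (stream r' es e)) (u, v) \<le> 9" for u v
  proof -
    let ?P = "{u div t, NL} \<times> {v div t - NL, v div t - NL + NR}"
    have rc: "count (mset (round_edges p \<mu>)) (u, v) \<le> of_bool (p \<in> ?P)" if "(p, \<mu>) \<in> base_pairs \<times> perms" for p \<mu>
      using round_edges_count[of p \<mu> u v] that bijsD(5)[of \<mu> "{..<t}" "{..<t}"] by (cases p) (auto simp: image_subset_iff split: if_splits)
    have "count (mset (concat (map (\<lambda>(p, \<mu>). round_edges p \<mu>) es))) (u, v) \<le> (\<Sum>p\<in>?P. count_list (map fst es) p)"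
      using es(1)
    proof (induction es)
      case (Cons d es)
      obtain p \<mu> where d: "d = (p, \<mu>)" by (cases d)
      have "(\<Sum>q\<in>?P. count_list (map fst (d # es)) q) = (\<Sum>q\<in>?P. count_list (map fst es) q + of_bool (q = p))"
        by (intro sum.cong) (auto simp: d)
      also have "\<dots> = (\<Sum>q\<in>?P. count_list (map fst es) q) + of_bool (p \<in> ?P)"
        by (simp add: sum.distrib of_bool_def)
      finally have s: "(\<Sum>q\<in>?P. count_list (map fst (d # es)) q) = (\<Sum>q\<in>?P. count_list (map fst es) q) + of_bool (p \<in> ?P)" .
      have "(p, \<mu>) \<in> base_pairs \<times> perms" "set es \<subseteq> base_pairs \<times> perms" using Cons.prems d by auto
      note le = rc[OF this(1)] Cons.IH[OF this(2)]
      have "count (mset (concat (map (\<lambda>(p, \<mu>). round_edges p \<mu>) (d # es)))) (u, v)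
        = count (mset (round_edges p \<mu>)) (u, v) + count (mset (concat (map (\<lambda>(p, \<mu>). round_edges p \<mu>) es))) (u, v)"
        by (simp add: d)
      then show ?case unfolding s using le by linarith
    qed simp
    also have "\<dots> \<le> (\<Sum>p\<in>?P. 2)" by (intro sum_mono mult)
    also have "\<dots> \<le> 8"
    proof -
      have "card ?P \<le> 2 * 2" unfolding card_cartesian_product by (intro mult_le_mono) (auto simp: card_insert_if)
      then show ?thesis by simp
    qed
    finally have 1: "count (mset (concat (map (\<lambda>(p, \<mu>). round_edges p \<mu>) es))) (u, v) \<le> 8" .
    obtain p \<mu> where e: "e = (p, \<mu>)" by (cases e)
    have "count (mset (take r' (round_edges p \<mu>))) (u, v) \<le> count (mset (round_edges p \<mu>)) (u, v)"
      by (rule count_mset_take_le)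
    also have "\<dots> \<le> of_bool (p \<in> ?P)" using rc[of p \<mu>] es(2) unfolding e by blast
    also have "\<dots> \<le> (1 :: nat)" by simp
    finally show ?thesis using 1 by (simp add: stream_def e)
  qed
  show ?thesis unfolding mult_bounded_def
  proof (intro allI impI)
    fix u v :: nat
    show "count (mset (stream r' es e)) (u, v) + count (mset (stream r' es e)) (v, u) \<le> 18"
      using one[of u v] one[of v u] by linarith
  qed
qed

definition round_cut :: "(nat \<times> nat) \<times> (nat \<Rightarrow> nat) \<Rightarrow> nat set \<Rightarrow> nat" where
  "round_cut e S = card {i. i < t \<and> (VL (fst (fst e)) i \<in> S) \<noteq> (VR (snd (fst e)) (snd e i) \<in> S)}"

text \<open>Only an inequality, since the edges of the cut last round are dropped.\<close>

lemma stream_cut_ge: "(\<Sum>e\<leftarrow>es. round_cut e S) \<le> cut_size (mset (stream r' es e)) S"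
proof -
  have "length (filter (\<lambda>(u, v). (u \<in> S) \<noteq> (v \<in> S)) (round_edges p \<mu>)) = round_cut (p, \<mu>) S" for p \<mu>
  proof -
    have "length (filter (\<lambda>(u, v). (u \<in> S) \<noteq> (v \<in> S)) (round_edges p \<mu>))
      = length (filter (\<lambda>i. (VL (fst p) i \<in> S) \<noteq> (VR (snd p) (\<mu> i) \<in> S)) [0..<t])"
      by (simp add: round_edges_def filter_map o_def)
    also have "\<dots> = card {i. i < t \<and> (VL (fst p) i \<in> S) \<noteq> (VR (snd p) (\<mu> i) \<in> S)}"
      by (subst distinct_length_filter) (auto intro: arg_cong[of _ _ card])
    finally show ?thesis by (simp add: round_cut_def)
  qed
  then have "length (filter (\<lambda>(u, v). (u \<in> S) \<noteq> (v \<in> S)) (concat (map (\<lambda>(p, \<mu>). round_edges p \<mu>) es))) = (\<Sum>e\<leftarrow>es. round_cut e S)"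
    by (induction es) auto
  then show ?thesis unfolding cut_size_mset stream_def filter_append length_append by simp
qed

section \<open>Aligned matchings give disjoint expanders\<close>

lemma H_pos: "0 < H" by (simp add: H_def)

context
  fixes x y :: "nat \<Rightarrow> nat \<Rightarrow> nat"
  assumes x: "x \<in> labelings {..<NL} (\<lambda>_. {..<t}) {..<t}" and y: "y \<in> labelings {..<NR} (\<lambda>_. {..<t}) {..<t}"
begin

text \<open>A leftover vertex gets the label of the vertex of block 0 that it replaces.\<close>

definition part_label :: "nat \<Rightarrow> nat" where
  "part_label v = (if v < NL * t then x (v div t) (v mod t)
     else if v < N * t then y (v div t - NL) (v mod t) else x 0 (v - N * t))"

definition part :: "nat \<Rightarrow> nat set" where "part l = {v. v < n \<and> part_label v = l}"

definition aligned :: "nat \<times> nat \<Rightarrow> nat \<Rightarrow> nat" where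
  "aligned p = matching {..<t} {..<t} (x (fst p mod NL)) (y (snd p mod NR))"

lemma x_perm: "u < NL \<Longrightarrow> x u \<in> perms" and y_perm: "v < NR \<Longrightarrow> y v \<in> perms"
  using x y by (auto simp: labelings_def)

lemma x_perm': "x (a mod NL) \<in> perms" and y_perm': "y (b mod NR) \<in> perms"
  using x_perm y_perm NL_pos NR_pos by auto

lemma aligned: "aligned p \<in> perms" "i < t \<Longrightarrow> y (snd p mod NR) (aligned p i) = x (fst p mod NL) i"
  using matching_bijs[OF x_perm'[of "fst p"] y_perm'[of "snd p"]] by (auto simp: aligned_def)

text \<open>Holds for a = NL as well: a leftover vertex inherits the label of the vertex it
  replaces, so the extra base vertex acts like block 0.\<close>

lemma part_label_VL: "a < H \<Longrightarrow> i < t \<Longrightarrow> part_label (VL a i) = x (a mod NL) i"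
proof -
  assume a: "a < H" "i < t"
  have NLt: "i < NL * t" using block_less[of 0 NL i] NL_pos a by simp
  show ?thesis
  proof (cases "a < NL")
    case True
    then show ?thesis using block_less[of a NL i] a by (simp add: VL_def part_label_def)
  next
    case False
    then have "a = NL" using a by (simp add: H_def)
    moreover have "\<not> N * t + i < NL * t" "\<not> N * t + i < N * t" using t_le(2) by linarith+
    ultimately show ?thesis using NLt a by (auto simp: VL_def part_label_def)
  qed
qed

lemma part_label_VR: "j < t \<Longrightarrow> part_label (VR b j) = y (b mod NR) j"
  using VR_bounds[of j b] by (auto simp: part_label_def VR_def)

lemma part_label_less: "v < n \<Longrightarrow> part_label v < t"
proof -
  assume "v < n"
  then show ?thesis
  proof (cases rule: vertex_cases)
    case L then show ?thesis using bijsD(5)[OF x_perm, of "v div t" "v mod t"] by (simp add: part_label_def)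
  next
    case R then show ?thesis using bijsD(5)[OF y_perm, of "v div t - NL" "v mod t"] by (simp add: part_label_def)
  next
    case X
    then have "\<not> v < NL * t" "\<not> v < N * t" "v - N * t < t" using t_le(2) r_less by linarith+
    then show ?thesis using bijsD(5)[OF x_perm[OF NL_pos], of "v - N * t"] by (simp add: part_label_def)
  qed
qed

text \<open>With \<open>part_right\<close>, the vertex lying over a base vertex in the copy with
  label l. These maps need not be injective, because a block used twice may give the same vertex
  twice.\<close>

definition part_left :: "nat \<Rightarrow> nat \<Rightarrow> nat" where
  "part_left l a = VL a (the_inv_into {..<t} (x (a mod NL)) l)"

definition part_right :: "nat \<Rightarrow> nat \<Rightarrow> nat" where
  "part_right l b = VR b (the_inv_into {..<t} (y (b mod NR)) l)"

lemma x_inv: assumes "l < t" shows "the_inv_into {..<t} (x (a mod NL)) l < t" "x (a mod NL) (the_inv_into {..<t} (x (a mod NL)) l) = l"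
  "\<And>i. i < t \<Longrightarrow> x (a mod NL) i = l \<longleftrightarrow> i = the_inv_into {..<t} (x (a mod NL)) l"
proof -
  note b = bijsD(3,4)[OF x_perm'[of a]]
  show 1: "the_inv_into {..<t} (x (a mod NL)) l < t"
    using the_inv_into_into[OF b(1), of l "{..<t}"] b(2) assms by simp
  show 2: "x (a mod NL) (the_inv_into {..<t} (x (a mod NL)) l) = l"
    using f_the_inv_into_f[OF b(1), of l] b(2) assms by simp
  show "x (a mod NL) i = l \<longleftrightarrow> i = the_inv_into {..<t} (x (a mod NL)) l" if "i < t" for i
    using the_inv_into_f_f[OF b(1), of i] 2 that by auto
qed

lemma y_inv: assumes "l < t" shows "the_inv_into {..<t} (y (b mod NR)) l < t" "y (b mod NR) (the_inv_into {..<t} (y (b mod NR)) l) = l"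
  "\<And>i. i < t \<Longrightarrow> y (b mod NR) i = l \<longleftrightarrow> i = the_inv_into {..<t} (y (b mod NR)) l"
proof -
  note b = bijsD(3,4)[OF y_perm'[of b]]
  show 1: "the_inv_into {..<t} (y (b mod NR)) l < t"
    using the_inv_into_into[OF b(1), of l "{..<t}"] b(2) assms by simp
  show 2: "y (b mod NR) (the_inv_into {..<t} (y (b mod NR)) l) = l"
    using f_the_inv_into_f[OF b(1), of l] b(2) assms by simp
  show "y (b mod NR) i = l \<longleftrightarrow> i = the_inv_into {..<t} (y (b mod NR)) l" if "i < t" for i
    using the_inv_into_f_f[OF b(1), of i] 2 that by auto
qed

lemma part_cover:
  assumes l: "l < t" and v: "v \<in> part l"
  shows "v \<in> part_left l ` {..<H} \<union> part_right l ` {..<H}"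
proof -
  have vn: "v < n" and lab: "part_label v = l" using v by (auto simp: part_def)
  from vn show ?thesis
  proof (cases rule: vertex_cases)
    case L
    then have "x (v div t mod NL) (v mod t) = l" using lab by (simp add: part_label_def)
    then have "v = part_left l (v div t)" using x_inv(3)[OF l, of "v mod t" "v div t"] L by (simp add: part_left_def)
    then show ?thesis using L by (auto simp: H_def)
  next
    case R
    then have "y ((v div t - NL) mod NR) (v mod t) = l" using lab by (simp add: part_label_def)
    then have "v = part_right l (v div t - NL)" using y_inv(3)[OF l, of "v mod t" "v div t - NL"] R by (simp add: part_right_def)
    then show ?thesis using R H_NR by auto
  next
    case X
    then have nl: "\<not> v < NL * t" "\<not> v < N * t" and vt: "v - N * t < t" using t_le(2) r_less by linarith+
    then have "x (NL mod NL) (v - N * t) = l" using lab by (simp add: part_label_def)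
    then have "v = part_left l NL" using x_inv(3)[OF l vt, of NL] X by (simp add: part_left_def)
    then show ?thesis by (auto simp: H_def)
  qed
qed

text \<open>One vertex from each of the N blocks, and at most one leftover vertex, since these carry
  distinct labels of block 0.\<close>

lemma card_part:
  assumes l: "l < t"
  shows "N \<le> card (part l)" "card (part l) \<le> N + 1"
proof -
  define A where "A = part l \<inter> {..<N * t}"
  define B where "B = part l - {..<N * t}"
  have fin: "finite A" "finite B" by (auto simp: A_def B_def part_def)
  have AB: "part l = A \<union> B" "A \<inter> B = {}" by (auto simp: A_def B_def)
  have inj: "inj_on (\<lambda>v. v div t) A"
  proof (rule inj_onI)
    fix v w assume v: "v \<in> A" and w: "w \<in> A" and eq: "v div t = w div t"
    have m: "v mod t < t" "w mod t < t" using t by auto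
    have iff: "u < NL * t \<longleftrightarrow> u div t < NL" for u using t by (simp add: div_less_iff_less_mult)
    have "v mod t = w mod t"
    proof (cases "v div t < NL")
      case True
      then have "v < NL * t" "w < NL * t" using eq by (simp_all only: iff)
      then have "x (v div t) (v mod t) = x (v div t) (w mod t)" using v w eq by (auto simp: A_def part_def part_label_def)
      then show ?thesis using inj_onD[OF bijsD(3)[OF x_perm[OF True]]] m by auto
    next
      case False
      then have "\<not> v < NL * t" "\<not> w < NL * t" using eq by (simp_all only: iff not_False_eq_True)
      then have "y (v div t - NL) (v mod t) = y (v div t - NL) (w mod t)" using v w eq by (auto simp: A_def part_def part_label_def)
      moreover have "v div t < N" using v t by (auto simp: A_def div_less_iff_less_mult)
      then have "v div t - NL < NR" using False NLR by linarith
      ultimately show ?thesis using inj_onD[OF bijsD(3)[OF y_perm]] m by auto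
    qed
    then show "v = w" using eq by (metis div_mult_mod_eq)
  qed
  have "(\<lambda>v. v div t) ` A = {..<N}"
  proof
    show "(\<lambda>v. v div t) ` A \<subseteq> {..<N}" using t by (auto simp: A_def div_less_iff_less_mult)
    show "{..<N} \<subseteq> (\<lambda>v. v div t) ` A"
    proof
      fix u assume u: "u \<in> {..<N}"
      show "u \<in> (\<lambda>v. v div t) ` A"
      proof (cases "u < NL")
        case True
        define i where "i = the_inv_into {..<t} (x (u mod NL)) l"
        have i: "i < t" "x u i = l" using x_inv[OF l, of u] True by (auto simp: i_def)
        have "VL u i = u * t + i" using True by (simp add: VL_def)
        moreover have "VL u i \<in> A"
          using part_label_VL[of u i] VL_less_n[of i u] block_less[of u N i] u True i calculation by (simp add: A_def part_def H_def)
        ultimately show ?thesis using i by (intro image_eqI[of _ _ "VL u i"]) auto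
      next
        case False
        define j where "j = the_inv_into {..<t} (y ((u - NL) mod NR)) l"
        have uR: "u - NL < NR" using u False NLR by auto
        have j: "j < t" "y (u - NL) j = l" using y_inv[OF l, of "u - NL"] uR by (auto simp: j_def)
        have "VR (u - NL) j = u * t + j" using uR False by (simp add: VR_def)
        moreover have "VR (u - NL) j \<in> A"
          using part_label_VR[of j "u - NL"] VR_bounds[of j "u - NL"] uR j by (simp add: A_def part_def)
        ultimately show ?thesis using j by (intro image_eqI[of _ _ "VR (u - NL) j"]) auto
      qed
    qed
  qed
  then have cA: "card A = N" using card_image[OF inj] by simp
  have cB: "card B \<le> 1"
  proof -
    have "v = w" if v: "v \<in> B" and w: "w \<in> B" for v w
    proof -
      have *: "\<not> u < NL * t" "\<not> u < N * t" "u - N * t < t" if "u \<in> B" for u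
      proof -
        have "N * t \<le> u" "u < n" using that by (auto simp: B_def part_def)
        then show "\<not> u < NL * t" "\<not> u < N * t" "u - N * t < t" using t_le(2) r_less n_eq by linarith+
      qed
      have "part_label v = l" "part_label w = l" using v w by (auto simp: B_def part_def)
      then have "x 0 (v - N * t) = x 0 (w - N * t)" using *(1,2)[OF v] *(1,2)[OF w] by (simp add: part_label_def)
      from inj_onD[OF bijsD(3)[OF x_perm[OF NL_pos]] this]
      have "v - N * t = w - N * t" using *(3)[OF v] *(3)[OF w] by simp
      then show ?thesis using *(2)[OF v] *(2)[OF w] by linarith
    qed
    then show ?thesis using fin card_le_Suc0_iff_eq[of B] by auto
  qed
  show "N \<le> card (part l)" "card (part l) \<le> N + 1"
    using cA cB AB fin by (simp_all add: card_Un_disjoint)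
qed

text \<open>Each aligned round puts exactly one edge into every part, lying over the base edge. The
  full rounds together therefore give each part an image of the whole base graph.\<close>

lemma filter_round_part:
  assumes p: "p \<in> base_pairs" and l: "l < t"
  shows "filter (\<lambda>e. fst e \<in> part l) (round_edges p (aligned p)) = [(part_left l (fst p), part_right l (snd p))]"
proof -
  define i where "i = the_inv_into {..<t} (x (fst p mod NL)) l"
  have i: "i < t" using x_inv(1)[OF l, of "fst p"] by (simp add: i_def)
  have i2: "x (fst p mod NL) k = l \<longleftrightarrow> k = i" if "k < t" for k using x_inv(3)[OF l that, of "fst p"] by (simp add: i_def)
  have j: "aligned p i = the_inv_into {..<t} (y (snd p mod NR)) l"
    using y_inv(3)[OF l, of "aligned p i" "snd p"] aligned(2)[OF i, of p] bijsD(5)[OF aligned(1)[of p], of i] i i2[OF i] by simp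
  have mem: "VL (fst p) k \<in> part l \<longleftrightarrow> k = i" if "k < t" for k
    using that p i2[OF that] part_label_VL[of "fst p" k] VL_less_n[OF that] by (auto simp: part_def)
  have "filter (\<lambda>e. fst e \<in> part l) (round_edges p (aligned p))
    = map (\<lambda>k. (VL (fst p) k, VR (snd p) (aligned p k))) (filter (\<lambda>k. VL (fst p) k \<in> part l) [0..<t])"
    by (simp add: round_edges_def filter_map o_def)
  also have "filter (\<lambda>k. VL (fst p) k \<in> part l) [0..<t] = filter (\<lambda>k. k = i) [0..<t]"
    using mem by (intro filter_cong) auto
  also have "filter (\<lambda>k. k = i) [0..<t] = [i]"
  proof -
    have "[0..<i + (t - i)] = [0..<i] @ [i..<i + (t - i)]" by (rule upt_add_eq_append) simp
    then have "[0..<t] = [0..<i] @ i # [Suc i..<t]" using i by (simp only: upt_conv_Cons[OF i] le_add_diff_inverse less_imp_le)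
    then show ?thesis by (simp add: filter_empty_conv)
  qed
  finally show ?thesis using j by (simp add: part_left_def part_right_def i_def)
qed

text \<open>A part is an image of the base graph under maps that may identify vertices, so cuts are
  pulled back. By \<open>part_cover\<close> the preimage of S is at least as large as S, and its
  complement at least as large as the rest of the part; its weight is then at least |S| / 4 and its
  cut at least (7/4) \<Lambda> |S|. The cut last round adds at most one edge to a part.\<close>

lemma case2_stream:
  assumes ps: "good_base H (7 * \<Lambda>) ps" and \<Lambda>: "\<Lambda> = ln (real n)" "0 \<le> \<Lambda>" and c: "0 \<le> c" "c \<le> 1" and H2: "2 \<le> H"
    and len: "length ps = num_edges n div t" and r': "r' = num_edges n mod t" and tp: "num_parts \<delta> n = t"
    and p': "p' \<in> base_pairs"
  shows "case2 c 18 \<delta> n (stream r' (map (\<lambda>p. (p, aligned p)) ps) (p', aligned p'))"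
proof -
  define es where "es = map (\<lambda>p. (p, aligned p)) ps"
  define xs where "xs = stream r' es (p', aligned p')"
  have psD: "set ps \<subseteq> base_pairs" using ps by (simp add: good_base_def)
  have esD: "set es \<subseteq> base_pairs \<times> perms" "(p', aligned p') \<in> base_pairs \<times> perms"
    using psD aligned(1) p' by (auto simp: es_def)
  have fst_es: "map fst es = ps" by (simp add: es_def o_def)
  have r't: "r' < t" using r' t by simp
  have length: "length xs = num_edges n"
    using r't len r' by (simp add: xs_def length_stream es_def)
  have xs_eq: "xs = concat (map (\<lambda>p. round_edges p (aligned p)) ps) @ take r' (round_edges p' (aligned p'))"
    by (simp add: xs_def stream_def es_def o_def)
  have edge_part: "\<exists>l<t. fst e \<in> part l \<and> snd e \<in> part l" if e: "e \<in> set xs" for e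
  proof -
    obtain p where p: "p \<in> base_pairs" "e \<in> set (round_edges p (aligned p))"
      using e psD p' by (auto simp: xs_eq dest!: in_set_takeD)
    then obtain i where i: "i < t" "e = (VL (fst p) i, VR (snd p) (aligned p i))" by (auto simp: round_edges_def)
    have j: "aligned p i < t" using bijsD(5)[OF aligned(1)[of p], of i] i by simp
    have "x (fst p mod NL) i < t" using bijsD(5)[OF x_perm'[of "fst p"], of i] i by simp
    then show ?thesis using i j p part_label_VL[of "fst p" i] part_label_VR[of "aligned p i" "snd p"] aligned(2)[OF i(1), of p]
      VL_less_n[of i "fst p"] VR_bounds(3)[of "aligned p i" "snd p"]
      by (intro exI[of _ "x (fst p mod NL) i"]) (auto simp: part_def)
  qed
  have parts: "num_edges n div t \<le> size (filter_mset (\<lambda>e. fst e \<in> part l) (mset xs))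
      \<and> size (filter_mset (\<lambda>e. fst e \<in> part l) (mset xs)) \<le> num_edges n div t + 1
      \<and> c * ln (real n) \<le> edge_expansion (part l) (filter_mset (\<lambda>e. fst e \<in> part l) (mset xs))" if l: "l < t" for l
  proof -
    have full: "filter (\<lambda>e. fst e \<in> part l) (concat (map (\<lambda>p. round_edges p (aligned p)) ps))
       = map (\<lambda>p. (part_left l (fst p), part_right l (snd p))) ps"
      using psD by (induction ps) (auto simp: filter_round_part[OF _ l])
    have "length (filter (\<lambda>e. fst e \<in> part l) (take r' (round_edges p' (aligned p'))))
       \<le> length (filter (\<lambda>e. fst e \<in> part l) (take r' (round_edges p' (aligned p')) @ drop r' (round_edges p' (aligned p'))))"
      unfolding filter_append length_append by simp
    also have "\<dots> = 1" using filter_round_part[OF p' l] by simp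
    finally have last: "length (filter (\<lambda>e. fst e \<in> part l) (take r' (round_edges p' (aligned p')))) \<le> 1" .
    have size: "size (filter_mset (\<lambda>e. fst e \<in> part l) (mset xs))
       = length ps + length (filter (\<lambda>e. fst e \<in> part l) (take r' (round_edges p' (aligned p'))))"
      unfolding xs_eq by (simp add: full flip: mset_filter)
    have "c * ln (real n) \<le> edge_expansion (part l) (filter_mset (\<lambda>e. fst e \<in> part l) (mset xs))"
    proof (rule edge_expansion_ge)
      show fin: "finite (part l)" by (simp add: part_def)
      show "2 \<le> card (part l)" using card_part(1)[OF l] N2' by (simp add: N_def)
      fix S assume S: "S \<subseteq> part l" "0 < card S" "2 * card S \<le> card (part l)"
      define X where "X = {a. a < H \<and> part_left l a \<in> S}"
      define Y where "Y = {b. b < H \<and> part_right l b \<in> S}"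
      have XY: "X \<subseteq> {..<H}" "Y \<subseteq> {..<H}" "finite X" "finite Y" by (auto simp: X_def Y_def)
      have "base_cut ps X Y = length (filter (\<lambda>(u, v). (u \<in> S) \<noteq> (v \<in> S)) (map (\<lambda>p. (part_left l (fst p), part_right l (snd p))) ps))"
        using psD by (induction ps) (auto simp: base_cut_def X_def Y_def)
      also have "\<dots> \<le> cut_size (filter_mset (\<lambda>e. fst e \<in> part l) (mset xs)) S"
        unfolding xs_eq mset_filter[symmetric] cut_size_mset filter_append length_append full by simp
      finally have cut: "base_cut ps X Y \<le> cut_size (filter_mset (\<lambda>e. fst e \<in> part l) (mset xs)) S" .
      have "card S \<le> card (part_left l ` X \<union> part_right l ` Y)"
        using part_cover[OF l] S(1) XY by (intro card_mono) (auto simp: X_def Y_def)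
      also have "\<dots> \<le> card X + card Y" by (intro order_trans[OF card_Un_le] add_mono card_image_le XY)
      finally have k1: "card S \<le> card X + card Y" .
      have "card (part l - S) \<le> card (part_left l ` ({..<H} - X) \<union> part_right l ` ({..<H} - Y))"
        using part_cover[OF l] by (intro card_mono) (auto simp: X_def Y_def)
      also have "\<dots> \<le> card ({..<H} - X) + card ({..<H} - Y)" by (intro order_trans[OF card_Un_le] add_mono card_image_le) auto
      also have "\<dots> = 2 * H - (card X + card Y)"
      proof -
        have "card X \<le> H" "card Y \<le> H" using card_mono[OF finite_lessThan XY(1)] card_mono[OF finite_lessThan XY(2)] by auto
        then show ?thesis using XY by (simp add: card_Diff_subset)
      qed
      finally have k2: "card (part l) - card S \<le> 2 * H - (card X + card Y)"
        using S(1) fin by (simp add: card_Diff_subset finite_subset)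
      define k z where "k = real (card S)" and "z = real (card X + card Y)"
      have "H \<le> card (part l)" using card_part(1)[OF l] N_H H2 by linarith
      \<comment> \<open>S is at most half of a part with at least H vertices, so at least H / 2 base
        vertices lie outside the preimage of S.\<close>
      then have k2': "real H / 2 \<le> 2 * real H - z"
      proof -
        have "H \<le> 2 * (2 * H - (card X + card Y))" using k2 S(3) \<open>H \<le> card (part l)\<close> by linarith
        moreover from this have "card X + card Y \<le> 2 * H" using H_pos by linarith
        ultimately have "H + 2 * (card X + card Y) \<le> 4 * H" by arith
        then have "real (H + 2 * (card X + card Y)) \<le> real (4 * H)" by (simp only: of_nat_le_iff)
        then show ?thesis by (simp add: z_def)
      qed
      have "k * (real H / 2) \<le> z * (2 * real H - z)"
        using k1 k2' by (intro mult_mono) (auto simp: k_def z_def)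
      then have w: "k / 4 \<le> base_weight H X Y"
      proof -
        have "k * (real H / 2) / (2 * real H) \<le> z * (2 * real H - z) / (2 * real H)"
          using \<open>k * (real H / 2) \<le> z * (2 * real H - z)\<close> by (rule divide_right_mono) simp
        then show ?thesis using H_pos by (simp add: base_weight_def z_def)
      qed
      have "c * ln (real n) * k \<le> \<Lambda> * k" using c \<Lambda> by (simp add: k_def mult_right_mono mult_left_le_one_le)
      also have "\<dots> \<le> 7 * \<Lambda> * (k / 4)" using \<Lambda>(2) by (simp add: k_def)
      also have "\<dots> \<le> 7 * \<Lambda> * base_weight H X Y" using w \<Lambda>(2) by (intro mult_left_mono) auto
      also have "\<dots> \<le> base_cut ps X Y" using ps XY by (simp add: good_base_def)
      also have "\<dots> \<le> cut_size (filter_mset (\<lambda>e. fst e \<in> part l) (mset xs)) S" using cut by simp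
      finally show "c * ln (real n) * real (card S) \<le> real (cut_size (filter_mset (\<lambda>e. fst e \<in> part l) (mset xs)) S)"
        by (simp add: k_def)
    qed
    then show ?thesis using size last len by simp
  qed
  have "case2 c 18 \<delta> n xs"
    unfolding case2_def Let_def tp
  proof (intro conjI exI[of _ part])
    show "length xs = num_edges n" by (rule length)
    show "multigraph_on {..<n} (mset xs)" unfolding xs_def by (rule stream_multigraph[OF esD])
    show "mult_bounded 18 (mset xs)" unfolding xs_def
    proof (rule stream_mult_bounded[OF esD])
      show "count_list (map fst es) p \<le> 2" for p using ps unfolding fst_es good_base_def by blast
    qed
    show "(\<Union>i<t. part i) = {..<n}" using part_label_less by (auto simp: part_def)
    show "\<forall>i<t. \<forall>j<t. i \<noteq> j \<longrightarrow> part i \<inter> part j = {}" by (auto simp: part_def)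
    show "\<forall>i<t. n div t \<le> card (part i) \<and> card (part i) \<le> n div t + 1" using card_part by (simp add: N_def)
    show "\<forall>e\<in>#mset xs. \<exists>i<t. fst e \<in> part i \<and> snd e \<in> part i" using edge_part by simp
    show "\<forall>i<t. num_edges n div t \<le> size (filter_mset (\<lambda>e. fst e \<in> part i) (mset xs)) \<and>
            size (filter_mset (\<lambda>e. fst e \<in> part i) (mset xs)) \<le> num_edges n div t + 1 \<and>
            c * ln (real n) \<le> edge_expansion (part i) (filter_mset (\<lambda>e. fst e \<in> part i) (mset xs))"
      using parts by blast
  qed
  then show ?thesis by (simp add: xs_def es_def)
qed

end

end

section \<open>Random matchings give one expander\<close>

text \<open>In any one coordinate the value is a convex combination of the two end values, so
  nonnegativity spreads from the vertices of the cube by freeing one coordinate at a time. In the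
  induction the coordinates from k on are still 0 or 1.\<close>

lemma multiaffine_nonneg:
  fixes F :: "(nat \<Rightarrow> real) \<Rightarrow> real"
  assumes aff: "\<And>\<rho> m. m < n \<Longrightarrow> F \<rho> = (1 - \<rho> m) * F (\<rho>(m := 0)) + \<rho> m * F (\<rho>(m := 1))"
    and vert: "\<And>\<rho>. (\<And>i. i < n \<Longrightarrow> \<rho> i = 0 \<or> \<rho> i = 1) \<Longrightarrow> 0 \<le> F \<rho>"
    and \<rho>: "\<And>i. i < n \<Longrightarrow> 0 \<le> \<rho> i \<and> \<rho> i \<le> 1"
  shows "0 \<le> F \<rho>"
proof -
  have "0 \<le> F \<rho>" if "k \<le> n" "\<And>i. i < n \<Longrightarrow> 0 \<le> \<rho> i \<and> \<rho> i \<le> 1" "\<And>i. k \<le> i \<Longrightarrow> i < n \<Longrightarrow> \<rho> i = 0 \<or> \<rho> i = 1" for k \<rho>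
    using that
  proof (induction k arbitrary: \<rho>)
    case 0
    then show ?case by (intro vert) auto
  next
    case (Suc k)
    have "0 \<le> F (\<rho>(k := v))" if "v = 0 \<or> v = 1" for v
      using that Suc.prems by (intro Suc.IH) (auto simp: Suc_le_eq)
    then show ?case using aff[of k \<rho>] Suc.prems(1) Suc.prems(2)[of k] by simp
  qed
  from this[of n \<rho>] \<rho> show ?thesis by auto
qed

text \<open>Fails for i = j, where the product is quadratic in the coordinate. This is why only
  off-diagonal pairs enter the fractional bound and \<open>sum_offdiag\<close> has a correction
  term.\<close>

lemma affine_term:
  fixes \<rho> :: "nat \<Rightarrow> real"
  assumes "i \<noteq> j"
  shows "\<rho> i * (1 - \<rho> j) = (1 - \<rho> m) * ((\<rho>(m := 0)) i * (1 - (\<rho>(m := 0)) j)) + \<rho> m * ((\<rho>(m := 1)) i * (1 - (\<rho>(m := 1)) j))"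
  using assms by (auto simp: algebra_simps)

lemma sum_offdiag:
  fixes \<rho> :: "nat \<Rightarrow> real"
  shows "(\<Sum>i<n. \<Sum>j\<in>{..<n}-{i}. \<rho> i * (1 - \<rho> j)) = (\<Sum>i<n. \<rho> i) * (real n - (\<Sum>i<n. \<rho> i)) - (\<Sum>i<n. \<rho> i * (1 - \<rho> i))"
proof -
  have "(\<Sum>i<n. \<Sum>j\<in>{..<n}-{i}. \<rho> i * (1 - \<rho> j)) = (\<Sum>i<n. (\<Sum>j<n. \<rho> i * (1 - \<rho> j)) - \<rho> i * (1 - \<rho> i))"
    by (intro sum.cong refl) (simp add: sum_diff1)
  also have "\<dots> = (\<Sum>i<n. \<rho> i) * (\<Sum>j<n. 1 - \<rho> j) - (\<Sum>i<n. \<rho> i * (1 - \<rho> i))"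
    unfolding sum_product by (rule sum_subtractf)
  finally show ?thesis by (simp add: sum_subtractf)
qed

lemma sum_lessThan_double: "(\<Sum>i<2 * (h::nat). f i) = (\<Sum>a<h. f a) + (\<Sum>b<h. f (h + b))"
proof -
  have "(\<Sum>i<h + k. f i) = (\<Sum>a<h. f a) + (\<Sum>b<k. f (h + b))" for k
    by (induction k) (simp_all add: ac_simps)
  then show ?thesis by (simp only: mult_2)
qed

lemma sum_list_affine:
  assumes "\<And>x. x \<in> set xs \<Longrightarrow> f x = c * g x + d * (h x :: real)"
  shows "(\<Sum>x\<leftarrow>xs. f x) = c * (\<Sum>x\<leftarrow>xs. g x) + d * (\<Sum>x\<leftarrow>xs. h x)"
  using assms by (induction xs) (auto simp: algebra_simps)

text \<open>A cut bound for vertex sets extends to fractional vertex sets, by multilinearity.\<close>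

lemma good_base_fractional:
  assumes good: "good_base H \<beta> ps" and H: "0 < H"
    and \<rho>: "\<And>i. i < 2 * H \<Longrightarrow> 0 \<le> \<rho> i \<and> \<rho> i \<le> 1"
  shows "\<beta> / (2 * real H) * ((\<Sum>i<2*H. \<rho> i) * (2 * real H - (\<Sum>i<2*H. \<rho> i)) - (\<Sum>i<2*H. \<rho> i * (1 - \<rho> i)))
    \<le> (\<Sum>(a, b)\<leftarrow>ps. \<rho> a * (1 - \<rho> (H + b)) + \<rho> (H + b) * (1 - \<rho> a))"
proof -
  define \<gamma> where "\<gamma> = \<beta> / (2 * real H)"
  define cutr where "cutr \<rho> = (\<Sum>(a, b)\<leftarrow>ps. \<rho> a * (1 - \<rho> (H + b)) + \<rho> (H + b) * (1 - \<rho> a))" for \<rho> :: "nat \<Rightarrow> real"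
  define off where "off \<rho> = (\<Sum>i<2*H. \<Sum>j\<in>{..<2*H}-{i}. \<rho> i * (1 - \<rho> j))" for \<rho> :: "nat \<Rightarrow> real"
  define F where "F \<rho> = cutr \<rho> - \<gamma> * off \<rho>" for \<rho>
  have psD: "set ps \<subseteq> {..<H} \<times> {..<H}" using good by (simp add: good_base_def)
  have "0 \<le> F \<rho>"
  proof (rule multiaffine_nonneg[where n = "2 * H" and F = F and \<rho> = \<rho>])
    fix \<rho> :: "nat \<Rightarrow> real" and m
    have 1: "cutr \<rho> = (1 - \<rho> m) * cutr (\<rho>(m := 0)) + \<rho> m * cutr (\<rho>(m := 1))"
      unfolding cutr_def
    proof (rule sum_list_affine)
      fix p assume "p \<in> set ps"
      then obtain a b where p: "p = (a, b)" "a < H" using psD by (cases p) auto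
      then have ne: "a \<noteq> H + b" by simp
      show "(case p of (a, b) \<Rightarrow> \<rho> a * (1 - \<rho> (H + b)) + \<rho> (H + b) * (1 - \<rho> a))
        = (1 - \<rho> m) * (case p of (a, b) \<Rightarrow> (\<rho>(m := 0)) a * (1 - (\<rho>(m := 0)) (H + b)) + (\<rho>(m := 0)) (H + b) * (1 - (\<rho>(m := 0)) a))
        + \<rho> m * (case p of (a, b) \<Rightarrow> (\<rho>(m := 1)) a * (1 - (\<rho>(m := 1)) (H + b)) + (\<rho>(m := 1)) (H + b) * (1 - (\<rho>(m := 1)) a))"
        unfolding p prod.case
        by (subst affine_term[OF ne, of \<rho> m], subst affine_term[OF ne[symmetric], of \<rho> m]) (simp only: distrib_left add.assoc add.commute add.left_commute)
    qed
    have 2: "off \<rho> = (1 - \<rho> m) * off (\<rho>(m := 0)) + \<rho> m * off (\<rho>(m := 1))"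
    proof -
      have "off \<rho> = (\<Sum>i<2*H. \<Sum>j\<in>{..<2*H}-{i}. (1 - \<rho> m) * ((\<rho>(m := 0)) i * (1 - (\<rho>(m := 0)) j)) + \<rho> m * ((\<rho>(m := 1)) i * (1 - (\<rho>(m := 1)) j)))"
        unfolding off_def by (intro sum.cong refl affine_term) auto
      then show ?thesis by (simp only: sum.distrib off_def sum_distrib_left)
    qed
    show "F \<rho> = (1 - \<rho> m) * F (\<rho>(m := 0)) + \<rho> m * F (\<rho>(m := 1))"
    proof -
      have alg: "(1 - r) * x0 + r * x1 - g * ((1 - r) * y0 + r * y1) = (1 - r) * (x0 - g * y0) + r * (x1 - g * y1)"
        for r x0 x1 g y0 y1 :: real
        by (simp add: algebra_simps)
      show "F \<rho> = (1 - \<rho> m) * F (\<rho>(m := 0)) + \<rho> m * F (\<rho>(m := 1))"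
        unfolding F_def by (subst 1, subst 2) (rule alg)
    qed
  next
    fix \<rho> :: "nat \<Rightarrow> real" assume v: "\<And>i. i < 2 * H \<Longrightarrow> \<rho> i = 0 \<or> \<rho> i = 1"
    define X where "X = {a. a < H \<and> \<rho> a = 1}"
    define Y where "Y = {b. b < H \<and> \<rho> (H + b) = 1}"
    have XY: "X \<subseteq> {..<H}" "Y \<subseteq> {..<H}" by (auto simp: X_def Y_def)
    have ra: "\<rho> a = of_bool (a \<in> X)" if "a < H" for a using v[of a] that by (auto simp: X_def)
    have rb: "\<rho> (H + b) = of_bool (b \<in> Y)" if "b < H" for b using v[of "H + b"] that by (auto simp: Y_def)
    have "(\<Sum>i<2*H. \<rho> i) = (\<Sum>a<H. of_bool (a \<in> X)) + (\<Sum>b<H. of_bool (b \<in> Y))"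
      unfolding sum_lessThan_double using ra rb by simp
    also have "\<dots> = real (card X + card Y)"
      using XY by (simp add: of_bool_def sum.If_cases Int_absorb1 Int_absorb2)
    finally have s: "(\<Sum>i<2*H. \<rho> i) = real (card X + card Y)" .
    have z: "(\<Sum>i<2*H. \<rho> i * (1 - \<rho> i)) = 0" using v by (intro sum.neutral ballI) (metis diff_self diff_zero lessThan_iff mult_zero_left mult_zero_right mult_cancel_left2)
    \<comment> \<open>At a vertex of the cube the diagonal correction vanishes, and what is left is
      the product that defines \<open>base_weight\<close>.\<close>
    have "\<gamma> * off \<rho> = \<beta> * base_weight H X Y"
      by (simp add: off_def sum_offdiag s z \<gamma>_def base_weight_def)
    also have "\<dots> \<le> base_cut ps X Y" using good XY by (simp add: good_base_def)
    also have "real (base_cut ps X Y) = cutr \<rho>"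
      using psD unfolding cutr_def base_cut_def by (induction ps) (auto simp: ra rb)
    finally show "0 \<le> F \<rho>" by (simp add: F_def)
  qed (use \<rho> in auto)
  then show ?thesis by (simp add: F_def cutr_def off_def sum_offdiag \<gamma>_def)
qed

section \<open>Cuts of the random lift\<close>

context block_graph
begin

context
  fixes S :: "nat set"
begin

definition hitL :: "nat \<Rightarrow> nat set" where "hitL a = {i. i < t \<and> VL a i \<in> S}"
definition hitR :: "nat \<Rightarrow> nat set" where "hitR b = {j. j < t \<and> VR b j \<in> S}"
text \<open>The fractional vertex set that S induces on the base graph. As in
  \<open>good_base_fractional\<close>, indices below H are left vertices and the others right
  vertices.\<close>

definition density :: "nat \<Rightarrow> real" where
  "density i = (if i < H then card (hitL i) else card (hitR (i - H))) / real t"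

lemma card_hit_le: "card (hitL a) \<le> t" "card (hitR b) \<le> t"
  using card_mono[of "{..<t}" "hitL a"] card_mono[of "{..<t}" "hitR b"] by (auto simp: hitL_def hitR_def)

lemma density_bounds: "0 \<le> density i \<and> density i \<le> 1"
  using card_hit_le t by (simp add: density_def)

text \<open>The factors decrease with membership in B, hence the reversed ranking. The 2 in the
  exponent anticipates Cauchy-Schwarz in \<open>avg_exp_round_cut\<close>, and 4/5 comes from exp (-
  2) <= 1/5.\<close>

lemma avg_exp_hits:
  assumes A: "A \<subseteq> {..<t}" and B: "B \<subseteq> {..<t}"
  shows "avg perms (\<lambda>\<mu>. exp (- 2 * real (card {i\<in>A. \<mu> i \<in> B}))) \<le> exp (- (4/5) * (real (card A) * (real (card B) / t)))"
proof -
  have fin: "finite A" "finite B" using A B finite_subset by blast+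
  have "avg perms (\<lambda>\<mu>. exp (- 2 * real (card {i\<in>A. \<mu> i \<in> B}))) = avg perms (\<lambda>\<mu>. \<Prod>i\<in>A. exp (- 2 * of_bool (\<mu> i \<in> B)))"
  proof (intro avg_cong refl)
    fix \<mu> :: "nat \<Rightarrow> nat"
    have "real (card {i\<in>A. \<mu> i \<in> B}) = (\<Sum>i\<in>A. of_bool (\<mu> i \<in> B))"
      using fin by (simp add: of_bool_def sum.If_cases Int_def)
    then show "exp (- 2 * real (card {i\<in>A. \<mu> i \<in> B})) = (\<Prod>i\<in>A. exp (- 2 * of_bool (\<mu> i \<in> B)))"
      unfolding exp_sum[OF fin(1), symmetric] by (simp only: sum_distrib_left)
  qed
  also have "\<dots> \<le> (\<Prod>i\<in>A. avg {..<t} (\<lambda>j. exp (- 2 * of_bool (j \<in> B))))"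
    using A by (intro bijs_negative_association[where rk = "\<lambda>j. - of_bool (j \<in> B)"]) auto
  also have "\<dots> \<le> (\<Prod>i\<in>A. exp (- (4/5) * (real (card B) / t)))"
  proof (intro prod_mono conjI avg_nonneg)
    have "avg {..<t} (\<lambda>j. exp (- 2 * of_bool (j \<in> B))) \<le> avg {..<t} (\<lambda>j. 1 - (4/5) * of_bool (j \<in> B))"
      using exp_minus_two_le by (intro avg_mono) (auto simp: of_bool_def)
    also have "\<dots> = 1 - (4/5) * (real (card B) / t)"
      using t B by (simp only: avg_diff avg_cmult) (simp add: avg_const lessThan_empty_iff, simp add: avg_def of_bool_def sum.If_cases Int_absorb1 Int_absorb2)
    also have "\<dots> \<le> exp (- (4/5) * (real (card B) / t))"
      using exp_ge_add_one_self[of "- (4/5) * (real (card B) / t)"] by simp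
    finally show "avg {..<t} (\<lambda>j. exp (- 2 * of_bool (j \<in> B))) \<le> exp (- (4/5) * (real (card B) / t))" .
  qed auto
  also have "\<dots> = exp (- (4/5) * (real (card A) * (real (card B) / t)))"
    by (simp add: exp_of_nat_mult[symmetric])
  finally show ?thesis .
qed

text \<open>The cut edges of a round have either their left or their right end in S. Both counts
  obey negative association, but with opposite monotonicity in \<mu>, so Cauchy-Schwarz separates
  them and halves the rate 4/5 to 2/5.\<close>

lemma avg_exp_round_cut:
  assumes p: "fst p < H" "snd p < H"
  shows "avg perms (\<lambda>\<mu>. exp (- real (round_cut (p, \<mu>) S)))
    \<le> exp (- (2/5) * t * (density (fst p) * (1 - density (H + snd p)) + density (H + snd p) * (1 - density (fst p))))"
proof -
  define A where "A = hitL (fst p)"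
  define B where "B = hitR (snd p)"
  have AB: "A \<subseteq> {..<t}" "B \<subseteq> {..<t}" by (auto simp: A_def B_def hitL_def hitR_def)
  then have fin: "finite A" "finite B" using finite_subset by blast+
  have dA: "density (fst p) = card A / t" and dB: "density (H + snd p) = card B / t"
    using p by (simp_all add: density_def A_def B_def)
  have comp: "card ({..<t} - C) = t - card C" "card C \<le> t" if "C \<subseteq> {..<t}" for C
    using that card_mono[OF finite_lessThan that] finite_subset[OF that] by (simp_all add: card_Diff_subset)
  define e1 where "e1 = (4/5) * (real (card A) * (1 - density (H + snd p)))"
  define e2 where "e2 = (4/5) * ((t - real (card A)) * density (H + snd p))"
  have "avg perms (\<lambda>\<mu>. exp (- real (round_cut (p, \<mu>) S)))
    \<le> avg perms (\<lambda>\<mu>. exp (- real (card {i\<in>A. \<mu> i \<in> {..<t} - B})) * exp (- real (card {i\<in>{..<t} - A. \<mu> i \<in> B})))"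
  proof (rule avg_mono)
    fix \<mu> :: "nat \<Rightarrow> nat" assume \<mu>: "\<mu> \<in> perms"
    have "card ({i\<in>A. \<mu> i \<in> {..<t} - B} \<union> {i\<in>{..<t} - A. \<mu> i \<in> B}) \<le> round_cut (p, \<mu>) S"
      unfolding round_cut_def using bijsD(5)[OF \<mu>]
      by (intro card_mono) (auto simp: A_def B_def hitL_def hitR_def)
    moreover have "card ({i\<in>A. \<mu> i \<in> {..<t} - B} \<union> {i\<in>{..<t} - A. \<mu> i \<in> B})
      = card {i\<in>A. \<mu> i \<in> {..<t} - B} + card {i\<in>{..<t} - A. \<mu> i \<in> B}"
      using fin by (intro card_Un_disjoint) auto
    ultimately show "exp (- real (round_cut (p, \<mu>) S)) \<le> exp (- real (card {i\<in>A. \<mu> i \<in> {..<t} - B})) * exp (- real (card {i\<in>{..<t} - A. \<mu> i \<in> B}))"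
      by (simp flip: exp_add)
  qed
  also have "\<dots> \<le> exp (- e1 / 2) * exp (- e2 / 2)"
  proof (rule avg_cauchy_schwarz)
    have "avg perms (\<lambda>\<mu>. (exp (- real (card {i\<in>A. \<mu> i \<in> {..<t} - B})))\<^sup>2) = avg perms (\<lambda>\<mu>. exp (- 2 * real (card {i\<in>A. \<mu> i \<in> {..<t} - B})))"
      by (simp flip: exp_double)
    also have "\<dots> \<le> exp (- e1)"
      using avg_exp_hits[of A "{..<t} - B"] AB comp[OF AB(2)] t by (simp add: e1_def dB of_nat_diff diff_divide_distrib)
    finally show "avg perms (\<lambda>\<mu>. (exp (- real (card {i\<in>A. \<mu> i \<in> {..<t} - B})))\<^sup>2) \<le> (exp (- e1 / 2))\<^sup>2"
      by (simp flip: exp_double)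
    have "avg perms (\<lambda>\<mu>. (exp (- real (card {i\<in>{..<t} - A. \<mu> i \<in> B})))\<^sup>2) = avg perms (\<lambda>\<mu>. exp (- 2 * real (card {i\<in>{..<t} - A. \<mu> i \<in> B})))"
      by (simp flip: exp_double)
    also have "\<dots> \<le> exp (- e2)"
      using avg_exp_hits[of "{..<t} - A" B] AB comp[OF AB(1)] t by (simp add: e2_def dB of_nat_diff)
    finally show "avg perms (\<lambda>\<mu>. (exp (- real (card {i\<in>{..<t} - A. \<mu> i \<in> B})))\<^sup>2) \<le> (exp (- e2 / 2))\<^sup>2"
      by (simp flip: exp_double)
  qed auto
  also have "\<dots> = exp (- (2/5) * t * (density (fst p) * (1 - density (H + snd p)) + density (H + snd p) * (1 - density (fst p))))"
    using t by (simp add: e1_def e2_def dA field_simps flip: exp_add)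
  finally show ?thesis .
qed

lemma sum_density: "real t * (\<Sum>i<2*H. density i) = (\<Sum>a<H. card (hitL a)) + (\<Sum>b<H. card (hitR b))"
  using t unfolding sum_lessThan_double by (simp add: density_def distrib_left sum_distrib_left)

text \<open>The 2 H block copies cover every vertex, some twice, so counting over copies can only
  overestimate S and its complement. Both directions are needed because the weight is a
  product.\<close>

lemma card_le_density:
  assumes S: "S \<subseteq> {..<n}"
  shows "real (card S) \<le> real t * (\<Sum>i<2*H. density i)"
    and "real (n - card S) \<le> real t * (2 * real H - (\<Sum>i<2*H. density i))"
proof -
  define D1 where "D1 = Sigma {..<H} hitL"
  define D2 where "D2 = Sigma {..<H} hitR"
  define C1 where "C1 = {..<H} \<times> {..<t} - D1"
  define C2 where "C2 = {..<H} \<times> {..<t} - D2"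
  have fin: "finite D1" "finite D2" "finite C1" "finite C2" "D1 \<subseteq> {..<H} \<times> {..<t}" "D2 \<subseteq> {..<H} \<times> {..<t}"
    by (auto simp: D1_def D2_def C1_def C2_def hitL_def hitR_def)
  have cov: "v \<in> case_prod VL ` ({..<H} \<times> {..<t}) \<union> case_prod VR ` ({..<H} \<times> {..<t})" if "v < n" for v
    using that
  proof (cases rule: vertex_cases)
    case L
    then show ?thesis by (intro UnI1 image_eqI[of _ _ "(v div t, v mod t)"]) (auto simp: H_def)
  next
    case R
    then show ?thesis using H_NR by (intro UnI2 image_eqI[of _ _ "(v div t - NL, v mod t)"]) auto
  next
    case X
    then show ?thesis using r_less by (intro UnI1 image_eqI[of _ _ "(NL, v - N * t)"]) (auto simp: H_def)
  qed
  have cD: "card D1 = (\<Sum>a<H. card (hitL a))" "card D2 = (\<Sum>b<H. card (hitR b))"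
    by (simp_all add: D1_def D2_def hitL_def hitR_def)
  have "card S \<le> card (case_prod VL ` D1 \<union> case_prod VR ` D2)"
  proof (intro card_mono subsetI)
    fix v assume v: "v \<in> S"
    then show "v \<in> case_prod VL ` D1 \<union> case_prod VR ` D2"
      using cov[of v] S by (fastforce simp: D1_def D2_def hitL_def hitR_def)
  qed (use fin in auto)
  also have "\<dots> \<le> card D1 + card D2" using fin by (intro order_trans[OF card_Un_le] add_mono card_image_le)
  finally have "real (card S) \<le> real (card D1 + card D2)" by (simp only: of_nat_le_iff)
  then show "real (card S) \<le> real t * (\<Sum>i<2*H. density i)" by (simp add: sum_density cD)
  have "card ({..<n} - S) \<le> card (case_prod VL ` C1 \<union> case_prod VR ` C2)"
  proof (intro card_mono subsetI)
    fix v assume v: "v \<in> {..<n} - S"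
    then show "v \<in> case_prod VL ` C1 \<union> case_prod VR ` C2"
      using cov[of v] by (fastforce simp: D1_def D2_def C1_def C2_def hitL_def hitR_def)
  qed (use fin in auto)
  also have "\<dots> \<le> card C1 + card C2" using fin by (intro order_trans[OF card_Un_le] add_mono card_image_le)
  finally have le: "n - card S \<le> card C1 + card C2" using S by (simp add: card_Diff_subset finite_subset)
  have "card D1 \<le> H * t" "card D2 \<le> H * t"
    using card_mono[OF _ fin(5)] card_mono[OF _ fin(6)] by auto
  moreover have "card C1 = H * t - card D1" "card C2 = H * t - card D2"
    unfolding C1_def C2_def using fin by (simp_all add: card_Diff_subset)
  ultimately have "real (card C1 + card C2) = 2 * real H * t - real (card D1 + card D2)" by (simp add: of_nat_diff)
  moreover have "real (n - card S) \<le> real (card C1 + card C2)" using le by (simp only: of_nat_le_iff)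
  ultimately show "real (n - card S) \<le> real t * (2 * real H - (\<Sum>i<2*H. density i))"
    using sum_density by (simp add: cD algebra_simps)
qed

text \<open>Given a good base graph, the exponential moment has exponent (2/5) t times the
  fractional cut of the densities, and that cut is at least 7 (19/40) \<Lambda> w; here (H - 2) / (2
  H) >= 19/40 uses that H is large. With t w >= |S| this becomes (133/100) \<Lambda> |S|, and
  subtracting 1/20 for the threshold leaves more than 5/4.\<close>

lemma lift_cut_tail:
  assumes S: "S \<subseteq> {..<n}" "2 * card S \<le> n" and \<Lambda>: "0 \<le> \<Lambda>" and H: "50 \<le> H"
  shows "lavg T (base_pairs \<times> perms) (\<lambda>es. of_bool (good_base H (7 * \<Lambda>) (map fst es) \<and> real (\<Sum>e\<leftarrow>es. round_cut e S) < \<Lambda> / 20 * card S))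
    \<le> exp (- (5/4) * \<Lambda>) ^ card S"
proof -
  define w where "w = (\<Sum>i<2*H. density i)"
  define k where "k = real (card S)"
  have bp: "finite (base_pairs)" "base_pairs \<noteq> {}" using H by (auto simp: lessThan_empty_iff)
  have pp: "finite perms" "perms \<noteq> {}" by (auto simp: finite_bijs bijs_nonempty)
  have k1: "k \<le> t * w" using card_le_density(1)[OF S(1)] by (simp add: k_def w_def)
  have w0: "w \<ge> 0" unfolding w_def using density_bounds by (intro sum_nonneg) auto
  \<comment> \<open>At least half of the vertices lie outside S, so the missing fractional mass is
    at least N / 2 >= H - 1; the additional 1 pays for the diagonal terms, whose sum is at most
    w.\<close>
  have compl: "real H - 2 \<le> 2 * real H - w - 1"
  proof -
    have "n \<le> 2 * (n - card S)" using S(2) by linarith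
    then have "real n \<le> real (2 * (n - card S))" by (simp only: of_nat_le_iff)
    then have "real n / 2 \<le> real t * (2 * real H - w)" using card_le_density(2)[OF S(1)] by (simp add: w_def)
    moreover have "real N * t \<le> real n" using n_eq by (metis le_add1 of_nat_le_iff of_nat_mult)
    ultimately have "t * (real N / 2) \<le> t * (2 * real H - w)" by (simp add: mult.commute)
    then have "real N / 2 \<le> 2 * real H - w" using t by simp
    moreover have "2 * real H \<le> real N + 2" using N_H(1) by linarith
    ultimately show ?thesis by linarith
  qed
  have "lavg T (base_pairs \<times> perms) (\<lambda>es. of_bool (good_base H (7 * \<Lambda>) (map fst es) \<and> real (\<Sum>e\<leftarrow>es. round_cut e S) < \<Lambda> / 20 * k))
    \<le> lavg T (base_pairs \<times> perms) (\<lambda>es. exp (\<Lambda> / 20 * k) * (of_bool (good_base H (7 * \<Lambda>) (map fst es)) * prod_list (map (\<lambda>e. exp (- real (round_cut e S))) es)))"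
  proof (rule lavg_mono)
    fix es
    have "prod_list (map (\<lambda>e. exp (- real (round_cut e S))) es) = exp (- real (\<Sum>e\<leftarrow>es. round_cut e S))"
      by (induction es) (auto simp: mult_exp_exp)
    then show "of_bool (good_base H (7 * \<Lambda>) (map fst es) \<and> real (\<Sum>e\<leftarrow>es. round_cut e S) < \<Lambda> / 20 * k)
      \<le> exp (\<Lambda> / 20 * k) * (of_bool (good_base H (7 * \<Lambda>) (map fst es)) * prod_list (map (\<lambda>e. exp (- real (round_cut e S))) es))"
      by (auto simp: of_bool_def mult_exp_exp)
  qed
  also have "\<dots> = exp (\<Lambda> / 20 * k) * lavg T base_pairs (\<lambda>ps. of_bool (good_base H (7 * \<Lambda>) ps) * prod_list (map (\<lambda>p. avg perms (\<lambda>\<mu>. exp (- real (round_cut (p, \<mu>) S)))) ps))"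
    unfolding lavg_cmult using lavg_Times_prod_list[OF bp(1) pp(1), of T "\<lambda>ps. of_bool (good_base H (7 * \<Lambda>) ps)"] by simp
  also have "\<dots> \<le> exp (\<Lambda> / 20 * k) * lavg T base_pairs (\<lambda>ps. exp (- (133/100) * \<Lambda> * k))"
  proof (intro mult_left_mono lavg_mono)
    fix ps assume ps: "set ps \<subseteq> base_pairs"
    show "of_bool (good_base H (7 * \<Lambda>) ps) * prod_list (map (\<lambda>p. avg perms (\<lambda>\<mu>. exp (- real (round_cut (p, \<mu>) S)))) ps) \<le> exp (- (133/100) * \<Lambda> * k)"
    proof (cases "good_base H (7 * \<Lambda>) ps")
      case True
      let ?d = "\<lambda>p. density (fst p) * (1 - density (H + snd p)) + density (H + snd p) * (1 - density (fst p))"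
      have "prod_list (map (\<lambda>p. avg perms (\<lambda>\<mu>. exp (- real (round_cut (p, \<mu>) S)))) ps) \<le> exp (- (2/5) * t * (\<Sum>p\<leftarrow>ps. ?d p))
          \<and> 0 \<le> prod_list (map (\<lambda>p. avg perms (\<lambda>\<mu>. exp (- real (round_cut (p, \<mu>) S)))) ps)"
        using ps
      proof (induction ps)
        case (Cons p ps)
        have "avg perms (\<lambda>\<mu>. exp (- real (round_cut (p, \<mu>) S))) \<le> exp (- (2/5) * t * ?d p)"
          using Cons.prems by (intro avg_exp_round_cut) auto
        moreover have "0 \<le> avg perms (\<lambda>\<mu>. exp (- real (round_cut (p, \<mu>) S)))" by (intro avg_nonneg) simp
        ultimately have "avg perms (\<lambda>\<mu>. exp (- real (round_cut (p, \<mu>) S))) * prod_list (map (\<lambda>p. avg perms (\<lambda>\<mu>. exp (- real (round_cut (p, \<mu>) S)))) ps)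
           \<le> exp (- (2/5) * t * ?d p) * exp (- (2/5) * t * (\<Sum>p\<leftarrow>ps. ?d p))"
          using Cons by (intro mult_mono) auto
        also have "\<dots> = exp (- (2/5) * t * (\<Sum>p\<leftarrow>p # ps. ?d p))"
          by (simp only: mult_exp_exp list.map sum_list.Cons distrib_left)
        finally show ?case using Cons \<open>0 \<le> avg perms (\<lambda>\<mu>. exp (- real (round_cut (p, \<mu>) S)))\<close> by simp
      qed simp
      moreover have "(133/40) * (\<Lambda> * w) \<le> (\<Sum>p\<leftarrow>ps. ?d p)"
      proof -
        have "(\<Sum>i<2*H. density i * (1 - density i)) \<le> w"
          unfolding w_def using density_bounds by (intro sum_mono) (simp add: mult_left_le)
        then have "w * (real H - 2) \<le> w * (2 * real H - w) - (\<Sum>i<2*H. density i * (1 - density i))"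
          using mult_left_mono[OF compl w0] by (simp add: algebra_simps)
        then have "7 * \<Lambda> / (2 * real H) * (w * (real H - 2)) \<le> 7 * \<Lambda> / (2 * real H) * (w * (2 * real H - w) - (\<Sum>i<2*H. density i * (1 - density i)))"
          using \<Lambda> by (intro mult_left_mono) auto
        also have "\<dots> \<le> (\<Sum>p\<leftarrow>ps. ?d p)"
          using good_base_fractional[OF True _ density_bounds] H by (simp add: w_def case_prod_unfold)
        finally have "7 * \<Lambda> / (2 * real H) * (w * (real H - 2)) \<le> (\<Sum>p\<leftarrow>ps. ?d p)" .
        moreover have "(133/40) * (\<Lambda> * w) \<le> 7 * \<Lambda> / (2 * real H) * (w * (real H - 2))"
        proof -
          have "19/40 \<le> (real H - 2) / (2 * real H)" using H by (simp add: field_simps)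
          then have "7 * (\<Lambda> * w) * (19/40) \<le> 7 * (\<Lambda> * w) * ((real H - 2) / (2 * real H))"
            using \<Lambda> w0 by (intro mult_left_mono) auto
          then show ?thesis by (simp add: field_simps)
        qed
        ultimately show ?thesis by linarith
      qed
      ultimately have "prod_list (map (\<lambda>p. avg perms (\<lambda>\<mu>. exp (- real (round_cut (p, \<mu>) S)))) ps) \<le> exp (- (133/100) * (\<Lambda> * (t * w)))"
        using t by (elim conjE order_trans) (simp add: mult_left_mono)
      also have "\<dots> \<le> exp (- (133/100) * \<Lambda> * k)" using k1 \<Lambda> by (simp add: mult_left_mono)
      finally show ?thesis using True by simp
    qed simp
  qed simp
  also have "\<dots> = exp (\<Lambda> / 20 * k - (133/100) * \<Lambda> * k)" using bp by (simp add: lavg_const mult_exp_exp)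
  also have "\<dots> \<le> exp (- (5/4) * \<Lambda> * k)"
  proof -
    have "0 \<le> \<Lambda> * k" using \<Lambda> by (simp add: k_def)
    then show ?thesis by simp
  qed
  also have "\<dots> = exp (- (5/4) * \<Lambda>) ^ card S" by (simp add: exp_of_nat_mult[symmetric] k_def mult_ac)
  finally show ?thesis by (simp add: k_def)
qed

end

definition good_lift :: "real \<Rightarrow> ((nat \<times> nat) \<times> (nat \<Rightarrow> nat)) list \<Rightarrow> bool" where
  "good_lift \<Lambda> es \<longleftrightarrow> good_base H (7 * \<Lambda>) (map fst es) \<and>
     (\<forall>S. S \<subseteq> {..<n} \<longrightarrow> 2 * card S \<le> n \<longrightarrow> \<Lambda> / 20 * card S \<le> real (\<Sum>e\<leftarrow>es. round_cut e S))"

text \<open>The failure of the base graph is paid for once. The union bound over S concerns only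
  good base graphs, since goodness is part of the event in \<open>lift_cut_tail\<close>.\<close>

lemma good_lift_whp:
  assumes \<Lambda>: "0 \<le> \<Lambda>" and H: "50 \<le> H" and T: "18 * real H * \<Lambda> \<le> real T" "0 < T" "T \<le> H\<^sup>2"
    and small: "2 * real H * exp (- (3/2) * \<Lambda>) \<le> 1" "real n * exp (- (5/4) * \<Lambda>) \<le> 1"
  shows "lavg T (base_pairs \<times> perms) (\<lambda>es. of_bool (\<not> good_lift \<Lambda> es))
    \<le> 4 * real H * exp (- (3/2) * \<Lambda>) + 3 * real T ^ 3 / real H ^ 4 + 2 * (real n * exp (- (5/4) * \<Lambda>))"
proof -
  define q where "q = exp (- (5/4) * \<Lambda>)"
  define bad where "bad S es \<longleftrightarrow> 2 * card S \<le> n \<and> good_base H (7 * \<Lambda>) (map fst es) \<and> real (\<Sum>e\<leftarrow>es. round_cut e S) < \<Lambda> / 20 * card S" for S es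
  define I where "I = Pow {..<n} - {{}}"
  have bp: "finite (base_pairs)" "base_pairs \<noteq> {}" using H by (auto simp: lessThan_empty_iff)
  have pp: "finite perms" "perms \<noteq> {}" by (auto simp: finite_bijs bijs_nonempty)
  have I: "finite I" by (simp add: I_def)
  have "lavg T (base_pairs \<times> perms) (\<lambda>es. of_bool (\<exists>S\<in>I. bad S es)) \<le> (\<Sum>S\<in>I. q ^ card S)"
  proof (rule lavg_of_bool_Ex[OF I])
    fix S assume S: "S \<in> I"
    show "lavg T (base_pairs \<times> perms) (\<lambda>es. of_bool (bad S es)) \<le> q ^ card S"
    proof (cases "2 * card S \<le> n")
      case True
      then show ?thesis using lift_cut_tail[OF _ True \<Lambda> H, of T] S by (simp add: I_def bad_def q_def)
    next
      case False
      then have "lavg T (base_pairs \<times> perms) (\<lambda>es. of_bool (bad S es)) = lavg T (base_pairs \<times> perms) (\<lambda>es. 0)"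
        by (simp add: bad_def)
      also have "\<dots> = 0" using bp pp by (intro lavg_const) auto
      finally show ?thesis by (simp add: q_def)
    qed
  qed
  also have "(\<Sum>S\<in>I. q ^ card S) = (1 + q) ^ n - 1"
  proof -
    have "(1 + q) ^ n = (\<Sum>S\<in>insert {} I. q ^ card S)"
      using sum_power_card_Pow[of "{..<n}" q] by (simp add: I_def insert_absorb)
    also have "\<dots> = 1 + (\<Sum>S\<in>I. q ^ card S)" using I by (subst sum.insert) (auto simp: I_def)
    finally show ?thesis by simp
  qed
  also have "\<dots> \<le> 2 * (real n * q)"
    using small(2) by (intro one_plus_power_minus_one_le) (auto simp: q_def)
  finally have b1: "lavg T (base_pairs \<times> perms) (\<lambda>es. of_bool (\<exists>S\<in>I. bad S es)) \<le> 2 * (real n * q)" .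
  have b2: "lavg T (base_pairs \<times> perms) (\<lambda>es. of_bool (\<not> good_base H (7 * \<Lambda>) (map fst es)))
     \<le> 4 * real H * exp (- (3/2) * \<Lambda>) + 3 * real T ^ 3 / real H ^ 4"
    unfolding lavg_map_fst[OF bp(1) pp, of T "\<lambda>ps. of_bool (\<not> good_base H (7 * \<Lambda>) ps)"]
    using H by (intro good_base_whp \<Lambda> T small) auto
  have "lavg T (base_pairs \<times> perms) (\<lambda>es. of_bool (\<not> good_lift \<Lambda> es))
    \<le> lavg T (base_pairs \<times> perms) (\<lambda>es. of_bool (\<not> good_base H (7 * \<Lambda>) (map fst es)) + of_bool (\<exists>S\<in>I. bad S es))"
  proof (intro lavg_mono of_bool_le_add)
    fix es assume bad: "\<not> good_lift \<Lambda> es"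
    show "\<not> good_base H (7 * \<Lambda>) (map fst es) \<or> (\<exists>S\<in>I. bad S es)"
    proof (rule ccontr)
      assume *: "\<not> (\<not> good_base H (7 * \<Lambda>) (map fst es) \<or> (\<exists>S\<in>I. bad S es))"
      have "\<Lambda> / 20 * card S \<le> real (\<Sum>e\<leftarrow>es. round_cut e S)" if "S \<subseteq> {..<n}" "2 * card S \<le> n" for S
      proof (cases "S = {}")
        case True then show ?thesis by (metis card.empty mult_zero_right of_nat_0 of_nat_0_le_iff)
      next
        case False
        then have "S \<in> I" using that by (auto simp: I_def)
        then have "\<not> bad S es" using * by blast
        then show ?thesis using * that by (auto simp: bad_def)
      qed
      then have "good_lift \<Lambda> es" using * by (auto simp: good_lift_def)
      then show False using bad by simp
    qed
  qed
  also have "\<dots> \<le> 4 * real H * exp (- (3/2) * \<Lambda>) + 3 * real T ^ 3 / real H ^ 4 + 2 * (real n * q)"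
    using b1 b2 by (simp add: lavg_add)
  finally show ?thesis by (simp add: q_def)
qed

lemma case1_stream:
  assumes es: "good_lift \<Lambda> es" "set es \<subseteq> base_pairs \<times> perms" and e: "e \<in> base_pairs \<times> perms"
    and \<Lambda>: "\<Lambda> = ln (real n)" "0 \<le> \<Lambda>" and c: "0 \<le> c" "c \<le> 1/20" and n2: "2 \<le> n"
    and len: "length es = num_edges n div t" and r': "r' = num_edges n mod t"
  shows "case1 c 18 n (stream r' es e)"
proof -
  have "length (stream r' es e) = num_edges n"
    using len r' t by (simp add: length_stream order_less_imp_le)
  moreover have "mult_bounded 18 (mset (stream r' es e))"
  proof (rule stream_mult_bounded[OF es(2) e])
    show "count_list (map fst es) p \<le> 2" for p using es(1) unfolding good_lift_def good_base_def by blast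
  qed
  moreover have "c * ln (real n) \<le> edge_expansion {..<n} (mset (stream r' es e))"
  proof (rule edge_expansion_ge)
    fix S assume S: "S \<subseteq> {..<n}" "2 * card S \<le> card {..<n}"
    have "c * ln (real n) \<le> \<Lambda> / 20" using c \<Lambda> mult_right_mono[of c "1/20" \<Lambda>] by simp
    then have "c * ln (real n) * real (card S) \<le> \<Lambda> / 20 * card S" by (rule mult_right_mono) simp
    also have "\<dots> \<le> real (\<Sum>e\<leftarrow>es. round_cut e S)" using es(1) S by (simp add: good_lift_def)
    also have "\<dots> \<le> real (cut_size (mset (stream r' es e)) S)"
      using stream_cut_ge[where es = es and S = S and r' = r' and e = e] by (simp only: of_nat_le_iff)
    finally show "c * ln (real n) * real (card S) \<le> real (cut_size (mset (stream r' es e)) S)" .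
  qed (use n2 in auto)
  ultimately show ?thesis unfolding case1_def Let_def using stream_multigraph[OF es(2) e] by blast
qed

end

section \<open>The lower bound\<close>

text \<open>Goodness depends on the T full rounds alone, so the element of the final round can be
  integrated out.\<close>

lemma prob_stream_pmf:
  assumes D: "finite D" "D \<noteq> {}"
    and F: "\<And>es e. set es \<subseteq> D \<Longrightarrow> length es = T \<Longrightarrow> e \<in> D \<Longrightarrow> good es \<Longrightarrow> F (concat (map ed es) @ ed' e)"
  shows "measure_pmf.prob (stream_pmf T (pmf_of_set D) ed ed') {xs. \<not> F xs} \<le> lavg T D (\<lambda>es. of_bool (\<not> good es))"
proof -
  let ?R = "replicate_pmf T (pmf_of_set D)"
  let ?P = "pair_pmf ?R (pmf_of_set D)"
  have eq: "stream_pmf T (pmf_of_set D) ed ed' = map_pmf (\<lambda>(es, e). concat (map ed es) @ ed' e) ?P"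
    by (simp add: stream_pmf_def pair_pmf_def map_pmf_def bind_assoc_pmf bind_return_pmf)
  have "measure_pmf.prob (stream_pmf T (pmf_of_set D) ed ed') {xs. \<not> F xs}
    = measure_pmf.prob ?P ((\<lambda>(es, e). concat (map ed es) @ ed' e) -` {xs. \<not> F xs})"
    by (simp add: eq)
  also have "\<dots> \<le> measure_pmf.prob ?P (fst -` {es. \<not> good es})"
  proof (rule measure_pmf.finite_measure_mono_AE)
    show "AE p in ?P. p \<in> (\<lambda>(es, e). concat (map ed es) @ ed' e) -` {xs. \<not> F xs} \<longrightarrow> p \<in> fst -` {es. \<not> good es}"
    proof (rule AE_pmfI, rule impI)
      fix p assume p: "p \<in> set_pmf ?P" and bad: "p \<in> (\<lambda>(es, e). concat (map ed es) @ ed' e) -` {xs. \<not> F xs}"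
      obtain es e where pe: "p = (es, e)" by (cases p)
      have "set es \<subseteq> D" "length es = T" "e \<in> D"
        using p D by (auto simp: pe set_replicate_pmf lists_eq_set)
      then show "p \<in> fst -` {es. \<not> good es}" using F[of es e] bad by (auto simp: pe)
    qed
  qed simp
  also have "\<dots> = measure_pmf.prob (map_pmf fst ?P) {es. \<not> good es}" by simp
  also have "\<dots> = lavg T D (\<lambda>es. of_bool (\<not> good es))"
    unfolding map_fst_pair_pmf by (rule prob_replicate_pmf[OF D])
  finally show ?thesis .
qed

text \<open>Since H exceeds k by at most one, reduction modulo k meets index 0 at most twice and
  every other index at most once.\<close>

lemma sum_mod_le:
  fixes g :: "nat \<Rightarrow> real"
  assumes "H \<le> k + 1" "0 < k" "\<And>u. 0 \<le> g u"
  shows "(\<Sum>a<H. g (a mod k)) \<le> 2 * (\<Sum>u<k. g u)"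
proof -
  have "(\<Sum>a<H. g (a mod k)) \<le> (\<Sum>a<Suc k. g (a mod k))"
    using assms by (intro sum_mono2) auto
  also have "\<dots> = (\<Sum>u<k. g u) + g 0" by simp
  also have "g 0 \<le> (\<Sum>u<k. g u)" using assms by (intro member_le_sum) auto
  finally show ?thesis by simp
qed

section \<open>Cost per round and the bound on the advantage\<close>

context block_graph
begin

text \<open>The base pair is uniform among H^2, so a round costs the total over all pairs of blocks,
  bounded independently of H, divided by H^2. The factor 4 = 2 * 2 accounts for the blocks that
  represent two base vertices.\<close>

lemma round_information:
  fixes S :: "(nat \<Rightarrow> nat \<Rightarrow> nat) \<Rightarrow> (nat \<Rightarrow> nat \<Rightarrow> nat) \<Rightarrow> nat pmf"
  assumes X: "X = labelings {..<NL} (\<lambda>_. {..<t}) {..<t}" and Y: "Y = labelings {..<NR} (\<lambda>_. {..<t}) {..<t}"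
    and S: "\<And>x y. x \<in> X \<Longrightarrow> y \<in> Y \<Longrightarrow> set_pmf (S x y) \<subseteq> {..<2^s}"
  shows "avg base_pairs (\<lambda>p. \<Sum>q<2^s. kl_bijs {..<t} {..<t} (match_mass X Y {..<t} (\<lambda>x y. pmf (S x y) q) (fst p mod NL) (snd p mod NR)))
    \<le> 4 / (real H)\<^sup>2 * (real t * (1329\<^sup>2 * 40 * (real s + 1)\<^sup>2))"
proof -
  define g where "g u v = (\<Sum>q<2^s. kl_bijs {..<t} {..<t} (match_mass X Y {..<t} (\<lambda>x y. pmf (S x y) q) u v))" for u v
  have g0: "0 \<le> g u v" for u v
    unfolding g_def match_mass_def by (intro sum_nonneg kl_bijs_nonneg avg_nonneg) auto
  have "avg base_pairs (\<lambda>p. g (fst p mod NL) (snd p mod NR)) = (\<Sum>a<H. \<Sum>b<H. g (a mod NL) (b mod NR)) / (real H)\<^sup>2"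
    by (subst avg_Times) (simp_all add: avg_def power2_eq_square flip: sum_divide_distrib)
  also have "(\<Sum>a<H. \<Sum>b<H. g (a mod NL) (b mod NR)) \<le> (\<Sum>a<H. 2 * (\<Sum>v<NR. g (a mod NL) v))"
    using H_NR NR_pos g0 by (intro sum_mono sum_mod_le) auto
  also have "\<dots> \<le> 2 * (\<Sum>u<NL. 2 * (\<Sum>v<NR. g u v))"
    using NL_pos g0 by (intro sum_mod_le) (auto simp: H_def sum_nonneg)
  also have "\<dots> = 4 * (\<Sum>q<2^s. \<Sum>u<NL. \<Sum>v<NR. kl_bijs {..<t} {..<t} (match_mass X Y {..<t} (\<lambda>x y. pmf (S x y) q) u v))"
  proof -
    have "(\<Sum>u<NL. \<Sum>v<NR. g u v) = (\<Sum>q<2^s. \<Sum>u<NL. \<Sum>v<NR. kl_bijs {..<t} {..<t} (match_mass X Y {..<t} (\<lambda>x y. pmf (S x y) q) u v))"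
      unfolding g_def by (subst (2) sum.swap, subst sum.swap) (rule refl)
    then show ?thesis by (simp flip: sum_distrib_left)
  qed
  also have "\<dots> \<le> 4 * (real (card {..<t}) * (1329\<^sup>2 * 40 * (real s + 1)\<^sup>2))"
    unfolding X Y
  proof (intro mult_left_mono kl_le_round_bound)
    fix x y assume "x \<in> labelings {..<NL} (\<lambda>_. {..<t}) {..<t}" "y \<in> labelings {..<NR} (\<lambda>_. {..<t}) {..<t}"
    then show "(\<Sum>q<2^s. pmf (S x y) q) = 1" using S unfolding X Y by (intro sum_pmf_le_set) auto
  qed auto
  finally show ?thesis by (simp add: g_def divide_right_mono)
qed

text \<open>The guarantees separate the acceptance probabilities by 2 \<epsilon>, up to the failure
  probability \<open>err\<close> on each side, while the memory argument bounds the gap after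
  averaging over labelings. The bound \<epsilon> <= 1/2 keeps both thresholds in [0, 1], as
  \<open>acceptance_ge\<close> and \<open>acceptance_le\<close> require.\<close>

lemma not_distinguishes:
  assumes sb: "space_bounded s A" and dist: "distinguishes \<epsilon> A (case1 (1/20) 18 n) (case2 (1/20) 18 \<delta> n)"
    and \<epsilon>: "0 < \<epsilon>" "\<epsilon> \<le> 1/2" and tp: "num_parts \<delta> n = t"
    and T: "T = num_edges n div t" "18 * real H * ln (real n) \<le> real T" "0 < T" "T \<le> H\<^sup>2" and H: "50 \<le> H"
    and small: "2 * real H * exp (- (3/2) * ln (real n)) \<le> 1" "real n * exp (- (5/4) * ln (real n)) \<le> 1"
  shows "2 * \<epsilon> \<le> 2 * (4 * real H * exp (- (3/2) * ln (real n)) + 3 * real T ^ 3 / real H ^ 4 + 2 * (real n * exp (- (5/4) * ln (real n))))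
    + sqrt (4 * ((real T + 1) * (4 / (real H)\<^sup>2 * (real t * (1329\<^sup>2 * 40 * (real s + 1)\<^sup>2)))))"
proof -
  define \<Lambda> where "\<Lambda> = ln (real n)"
  define err where "err = 4 * real H * exp (- (3/2) * \<Lambda>) + 3 * real T ^ 3 / real H ^ 4 + 2 * (real n * exp (- (5/4) * \<Lambda>))"
  define r' where "r' = num_edges n mod t"
  define \<kappa> where "\<kappa> = 4 / (real H)\<^sup>2 * (real t * (1329\<^sup>2 * 40 * (real s + 1)\<^sup>2))"
  define X where "X = labelings {..<NL} (\<lambda>_. {..<t}) {..<t}"
  define Y where "Y = labelings {..<NR} (\<lambda>_. {..<t}) {..<t}"
  have n1: "2 \<le> n" using N2' t by (metis div_le_dividend order_trans)
  have \<Lambda>0: "0 \<le> \<Lambda>" using n1 by (simp add: \<Lambda>_def)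
  have bp: "finite base_pairs" "base_pairs \<noteq> {}" using H by (auto simp: lessThan_empty_iff)
  have pp: "finite perms" "perms \<noteq> {}" by (auto simp: finite_bijs bijs_nonempty)
  define no where "no = stream_pmf T (pmf_of_set (base_pairs \<times> perms)) (\<lambda>(e, \<mu>). round_edges e \<mu>) (\<lambda>(e, \<mu>). take r' (round_edges e \<mu>))"
  define yes where "yes x y = stream_pmf T (pmf_of_set base_pairs)
      (\<lambda>e. round_edges e (matching {..<t} {..<t} (x (fst e mod NL)) (y (snd e mod NR))))
      (\<lambda>e. take r' (round_edges e (matching {..<t} {..<t} (x (fst e mod NL)) (y (snd e mod NR)))))" for x y :: "nat \<Rightarrow> nat \<Rightarrow> nat"
  have "measure_pmf.prob no {xs. \<not> case1 (1/20) 18 n xs} \<le> lavg T (base_pairs \<times> perms) (\<lambda>es. of_bool (\<not> good_lift \<Lambda> es))"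
    unfolding no_def
  proof (rule prob_stream_pmf)
    fix es e assume es: "set es \<subseteq> base_pairs \<times> perms" "length es = T" "e \<in> base_pairs \<times> perms" "good_lift \<Lambda> es"
    have "case1 (1/20) 18 n (stream r' es e)"
      using es n1 \<Lambda>0 by (intro case1_stream[of \<Lambda>]) (auto simp: \<Lambda>_def r'_def T(1))
    then show "case1 (1/20) 18 n (concat (map (\<lambda>(e, \<mu>). round_edges e \<mu>) es) @ (case e of (e, \<mu>) \<Rightarrow> take r' (round_edges e \<mu>)))"
      by (cases e) (simp add: stream_def)
  qed (use bp pp in auto)
  also have "\<dots> \<le> err"
    unfolding err_def using T(2-4) small H \<Lambda>0 by (intro good_lift_whp) (simp_all add: \<Lambda>_def)
  finally have p1: "measure_pmf.prob no {xs. \<not> case1 (1/20) 18 n xs} \<le> err" .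
  have p2: "measure_pmf.prob (yes x y) {xs. \<not> case2 (1/20) 18 \<delta> n xs} \<le> err" if xy: "x \<in> X" "y \<in> Y" for x y
  proof -
    have "measure_pmf.prob (yes x y) {xs. \<not> case2 (1/20) 18 \<delta> n xs} \<le> lavg T base_pairs (\<lambda>ps. of_bool (\<not> good_base H (7 * \<Lambda>) ps))"
      unfolding yes_def
    proof (rule prob_stream_pmf)
      fix ps p assume ps: "set ps \<subseteq> base_pairs" "length ps = T" "p \<in> base_pairs" "good_base H (7 * \<Lambda>) ps"
      have "case2 (1/20) 18 \<delta> n (stream r' (map (\<lambda>p. (p, aligned x y p)) ps) (p, aligned x y p))"
        using xy ps \<Lambda>0 H tp by (intro case2_stream[of x y \<Lambda>]) (auto simp: X_def Y_def \<Lambda>_def r'_def T(1))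
      moreover have al: "aligned x y p = matching {..<t} {..<t} (x (fst p mod NL)) (y (snd p mod NR))" for p
        using xy by (intro aligned_def) (auto simp: X_def Y_def)
      ultimately show "case2 (1/20) 18 \<delta> n (concat (map (\<lambda>e. round_edges e (matching {..<t} {..<t} (x (fst e mod NL)) (y (snd e mod NR)))) ps)
         @ take r' (round_edges p (matching {..<t} {..<t} (x (fst p mod NL)) (y (snd p mod NR)))))"
        by (simp add: stream_def o_def)
    qed (use bp in auto)
    also have "\<dots> \<le> 4 * real H * exp (- (3/2) * \<Lambda>) + 3 * real T ^ 3 / real H ^ 4"
      using T(2-4) small H \<Lambda>0 by (intro good_base_whp) (simp_all add: \<Lambda>_def)
    also have "\<dots> \<le> err" by (simp add: err_def)
    finally show ?thesis .
  qed
  have d1: "case1 (1/20) 18 n xs \<Longrightarrow> 1/2 + \<epsilon> \<le> accept_prob A xs" and d2: "case2 (1/20) 18 \<delta> n xs \<Longrightarrow> accept_prob A xs \<le> 1/2 - \<epsilon>" for xs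
    using dist by (auto simp: distinguishes_def)
  have a1: "1/2 + \<epsilon> - err \<le> acceptance A no"
    using acceptance_ge[of no "case1 (1/20) 18 n" "1/2 + \<epsilon>" A] d1 \<epsilon> p1 by auto
  have a2: "acceptance A (yes x y) \<le> 1/2 - \<epsilon> + err" if "x \<in> X" "y \<in> Y" for x y
    using acceptance_le[of "yes x y" "case2 (1/20) 18 \<delta> n" A "1/2 - \<epsilon>"] d2 \<epsilon> p2[OF that] by auto
  have Xne: "finite X" "X \<noteq> {}" "finite Y" "Y \<noteq> {}"
    unfolding X_def Y_def
    using labelings_finite_nonempty[where I = "{..<NL}" and A = "\<lambda>_. {..<t}" and B = "{..<t}"]
      labelings_finite_nonempty[where I = "{..<NR}" and A = "\<lambda>_. {..<t}" and B = "{..<t}"] by auto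
  have "avg X (\<lambda>x. avg Y (\<lambda>y. acceptance A (yes x y))) \<le> avg X (\<lambda>x. avg Y (\<lambda>y. 1/2 - \<epsilon> + err))"
    by (intro avg_mono a2)
  also have "\<dots> = 1/2 - \<epsilon> + err" using Xne by (simp add: avg_const)
  finally have a3: "avg X (\<lambda>x. avg Y (\<lambda>y. acceptance A (yes x y))) \<le> 1/2 - \<epsilon> + err" .
  have "(acceptance A no - avg X (\<lambda>x. avg Y (\<lambda>y. acceptance A (yes x y))))\<^sup>2 \<le> 4 * ((real T + 1) * \<kappa>)"
    unfolding no_def yes_def
  proof (rule streaming_indistinguishable[OF sb bp])
    show "X = labelings {..<NL} (\<lambda>_. {..<t}) {..<t}" "Y = labelings {..<NR} (\<lambda>_. {..<t}) {..<t}" by (simp_all add: X_def Y_def)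
    show "avg base_pairs (\<lambda>e. \<Sum>q<2^s. kl_bijs {..<t} {..<t} (match_mass X Y {..<t} (\<lambda>x y. pmf (S x y) q) (fst e mod NL) (snd e mod NR))) \<le> \<kappa>"
      if "\<And>x y. x \<in> X \<Longrightarrow> y \<in> Y \<Longrightarrow> set_pmf (S x y) \<subseteq> {..<2^s}" for S :: "_ \<Rightarrow> _ \<Rightarrow> nat pmf"
      unfolding \<kappa>_def by (rule round_information[OF X_def Y_def that])
  qed (use NL_pos NR_pos in auto)
  then have "acceptance A no - avg X (\<lambda>x. avg Y (\<lambda>y. acceptance A (yes x y))) \<le> sqrt (4 * ((real T + 1) * \<kappa>))"
    by (intro real_le_rsqrt)
  then have "2 * \<epsilon> \<le> 2 * err + sqrt (4 * ((real T + 1) * \<kappa>))" using a1 a3 by linarith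
  then show ?thesis unfolding err_def \<kappa>_def \<Lambda>_def .
qed

end

text \<open>The gap between the lower bound 18 H ln n and the upper bound 20 H ln n on the number of
  rounds leaves room for the floors in \<open>num_edges\<close> and the divisions. The lower bounds
  on H rest on t <= sqrt n, hence n / t >= sqrt n.\<close>

lemma parameter_bounds:
  fixes \<delta> :: real
  assumes \<delta>: "0 < \<delta>" "\<delta> < 1/2"
    and n: "sqrt (real n) \<ge> 200" "ln (real n) \<ge> 1" "sqrt (real n) / 2 - 1/2 \<ge> 20 * ln (real n)"
    and t: "t = num_parts \<delta> n" and N: "N = n div t" and H: "H = N div 2 + 1" and T: "T = num_edges n div t"
  shows "0 < t" "2 \<le> N" "50 \<le> H" "18 * real H * ln (real n) \<le> real T" "0 < T" "T \<le> H\<^sup>2" "real H \<le> real n"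
    "sqrt (real n) / 2 - 1/2 \<le> real H" "real T \<le> 20 * real H * ln (real n)" "real t \<le> real n powr (1/2 - \<delta>)" "real n / (4 * real t) \<le> real H"
proof -
  define L where "L = ln (real n)"
  have n0: "real n \<ge> 1" using n(1) by (smt (verit) real_sqrt_le_1_iff)
  have pw: "real n powr (1/2 - \<delta>) \<ge> 1" using \<delta> n0 by (intro ge_one_powr_ge_zero) auto
  then have "1 \<le> \<lfloor>real n powr (1/2 - \<delta>)\<rfloor>" by (simp add: le_floor_iff)
  then show t0: "0 < t" by (simp add: t num_parts_def)
  show tle: "real t \<le> real n powr (1/2 - \<delta>)" using pw by (simp add: t num_parts_def)
  also have "\<dots> \<le> real n powr (1/2)" using \<delta> n0 by (intro powr_mono) auto
  also have "\<dots> = sqrt (real n)" using n0 by (simp add: powr_half_sqrt)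
  finally have tsq: "real t \<le> sqrt (real n)" .
  have q: "sqrt (real n) \<le> real n / real t"
  proof -
    have "sqrt (real n) * real t \<le> sqrt (real n) * sqrt (real n)" using tsq by (intro mult_left_mono) auto
    then show ?thesis using t0 by (simp add: field_simps)
  qed
  define Q where "Q = real n / real t"
  have N1: "real N \<le> Q" by (simp add: N Q_def of_nat_div_le_of_nat)
  have div_lt: "real a / real t < real (a div t) + 1" for a
  proof -
    have "real (a mod t) / real t < 1" using t0 by simp
    then show ?thesis using of_nat_of_nat_div_aux[of a t, where 'a = real] by linarith
  qed
  have N2: "Q < real N + 1" using div_lt[of n] by (simp add: N Q_def)
  show "2 \<le> N" using N2 q n(1) by (simp add: Q_def)
  have H1: "2 * H \<le> N + 2" and H2: "N + 1 \<le> 2 * H" unfolding H by presburger+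
  have H1': "2 * real H \<le> real N + 2" using H1 by linarith
  have H2': "real N + 1 \<le> 2 * real H" using H2 by linarith
  have HQ: "Q \<le> 2 * real H" using N2 H2' by linarith
  show "50 \<le> H" using HQ q n(1) by (simp add: Q_def)
  show Hs: "sqrt (real n) / 2 - 1/2 \<le> real H" using HQ q by (simp add: Q_def)
  show "real n / (4 * real t) \<le> real H"
    using HQ t0 by (simp add: Q_def field_simps)
  have "N \<le> n" by (simp add: N)
  then show "real H \<le> real n" using H1' \<open>2 \<le> N\<close> by linarith
  have L: "L \<ge> 1" using n(2) by (simp add: L_def)
  have m1: "real (num_edges n) \<le> 10 * real n * L" "10 * real n * L - 1 \<le> real (num_edges n)"
  proof -
    have "0 \<le> 10 * real n * L" using L n0 by simp
    then have "real (num_edges n) = of_int \<lfloor>10 * real n * L\<rfloor>" unfolding num_edges_def L_def[symmetric] by simp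
    then show "real (num_edges n) \<le> 10 * real n * L" "10 * real n * L - 1 \<le> real (num_edges n)" by linarith+
  qed
  have T1: "real T \<le> real (num_edges n) / real t" by (simp add: T of_nat_div_le_of_nat)
  have T2: "real (num_edges n) / real t \<le> real T + 1" using div_lt[of "num_edges n"] by (simp add: T)
  have "real T \<le> 10 * real n * L / real t" using T1 m1(1) t0 by (meson divide_right_mono of_nat_0_le_iff order_trans)
  also have "\<dots> = 10 * L * Q" by (simp add: Q_def)
  also have "\<dots> \<le> 10 * L * (2 * real H)" using HQ L by (intro mult_left_mono) auto
  finally have TH: "real T \<le> 20 * real H * L" by (simp add: mult_ac)
  then show "real T \<le> 20 * real H * ln (real n)" by (simp add: L_def)
  have "20 * L \<le> real H" using n(3) Hs by (simp add: L_def)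
  then have "real H * (20 * L) \<le> real H * real H" by (intro mult_left_mono) auto
  then have "real T \<le> real (H\<^sup>2)" using TH by (simp add: power2_eq_square)
  then show "T \<le> H\<^sup>2" by (simp only: of_nat_le_iff)
  have "10 * L * Q - 2 \<le> real T"
  proof -
    have "(10 * real n * L - 1) / real t \<le> real (num_edges n) / real t" using m1(2) t0 by (intro divide_right_mono) auto
    moreover have "(10 * real n * L - 1) / real t = 10 * L * Q - 1 / real t" by (simp add: Q_def diff_divide_distrib)
    moreover have "1 / real t \<le> 1" using t0 by simp
    ultimately show ?thesis using T2 by linarith
  qed
  moreover have "18 * real H * L \<le> 10 * L * Q - 2"
  proof -
    \<comment> \<open>From H <= Q / 2 + 1 the left side is at most 9 L Q + 18 L; the spare L Q >= 20
      L absorbs both 18 L and the rounding loss 2.\<close>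
    have "18 * real H * L \<le> 9 * L * (Q + 2)" using H1' N1 L by (simp add: mult_left_mono)
    moreover have "20 \<le> Q" using q n(1) by (simp add: Q_def)
    then have "20 * L \<le> L * Q" using L by (subst mult.commute) (intro mult_left_mono, auto)
    moreover have "9 * L * (Q + 2) = 9 * (L * Q) + 18 * L" by (simp add: algebra_simps)
    ultimately show ?thesis using L by (simp only: mult.assoc)
  qed
  ultimately show "18 * real H * ln (real n) \<le> real T" by (simp add: L_def)
  moreover have "0 < 18 * real H * ln (real n)" using n(2) \<open>50 \<le> H\<close> by simp
  ultimately show "0 < T" by linarith
qed

theorem theorem5p2:
  shows "\<exists>c::real > 0. \<exists>C::nat.
    \<forall>\<delta>::real. 0 < \<delta> \<and> \<delta> < 1/2 \<longrightarrow>
      (\<forall>(A :: nat \<Rightarrow> salg) (s :: nat \<Rightarrow> nat).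
         (\<forall>n. space_bounded (s n) (A n)) \<and>
         (\<lambda>n. real (s n)) \<in> o(\<lambda>n. real n powr \<delta> / ln (real n)) \<longrightarrow>
         (\<forall>\<epsilon>::real > 0. \<forall>\<^sub>F n in sequentially.
            \<not> distinguishes \<epsilon> (A n) (case1 c C n) (case2 c C \<delta> n)))"
\<comment> \<open>1/20 is the threshold in \<open>good_lift\<close>, the more restrictive of the two
  expansion bounds; 18 is the multiplicity from \<open>stream_mult_bounded\<close>.\<close>
proof (intro exI[of _ "1/20 :: real"] conjI exI[of _ "18 :: nat"] allI impI)
  fix \<delta> \<epsilon> :: real and A :: "nat \<Rightarrow> salg" and s :: "nat \<Rightarrow> nat"
  assume \<delta>: "0 < \<delta> \<and> \<delta> < 1/2"
    and As: "(\<forall>n. space_bounded (s n) (A n)) \<and> (\<lambda>n. real (s n)) \<in> o(\<lambda>n. real n powr \<delta> / ln (real n))"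
    and \<epsilon>: "0 < \<epsilon>"
  \<comment> \<open>Capping the advantage at 1/2 only weakens what the algorithm achieves and meets
    the hypothesis of \<open>not_distinguishes\<close>.\<close>
  define e where "e = min \<epsilon> (1/2)"
  have e: "0 < e" "e \<le> 1/2" using \<epsilon> by (auto simp: e_def)
  define C :: real where "C = 1329\<^sup>2 * 40"
  \<comment> \<open>The failure probability with H replaced by its upper bound n or its lower bound
    sqrt n / 2 - 1/2; 24000 is 3 * 20^3, from T <= 20 H ln n.\<close>
  define err where "err n = 4 * real n * exp (- (3/2) * ln (real n)) + 24000 * ln (real n) ^ 3 / (sqrt (real n) / 2 - 1/2)
     + 2 * (real n * exp (- (5/4) * ln (real n)))" for n
  have "\<forall>\<^sub>F n in sequentially. real (s n) \<le> 1/2 * (real n powr \<delta> / ln (real n))"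
  proof -
    have "\<forall>\<^sub>F n in sequentially. norm (real (s n)) \<le> 1/2 * norm (real n powr \<delta> / ln (real n))"
      using As by (intro landau_o.smallD) auto
    moreover have "\<forall>\<^sub>F n in sequentially. 1 \<le> ln (real n)" by real_asymp
    ultimately show ?thesis by eventually_elim simp
  qed
  moreover have "\<forall>\<^sub>F n in sequentially. 1 \<le> 1/2 * (real n powr \<delta> / ln (real n))" using \<delta> by real_asymp
  moreover have "\<forall>\<^sub>F n in sequentially. sqrt (real n) \<ge> 200" by real_asymp
  moreover have "\<forall>\<^sub>F n in sequentially. ln (real n) \<ge> 1" by real_asymp
  moreover have "\<forall>\<^sub>F n in sequentially. sqrt (real n) / 2 - 1/2 \<ge> 20 * ln (real n)" by real_asymp
  moreover have "\<forall>\<^sub>F n in sequentially. 2 * real n * exp (- (3/2) * ln (real n)) \<le> 1" by real_asymp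
  moreover have "\<forall>\<^sub>F n in sequentially. real n * exp (- (5/4) * ln (real n)) \<le> 1" by real_asymp
  moreover have "\<forall>\<^sub>F n in sequentially. err n < e / 2"
  proof -
    have "err \<longlonglongrightarrow> 0" unfolding err_def by real_asymp
    then show ?thesis using e by (intro order_tendstoD) auto
  qed
  moreover have "\<forall>\<^sub>F n in sequentially. sqrt (1344 * C / ln (real n)) < e"
  proof -
    have "(\<lambda>n. sqrt (1344 * C / ln (real n))) \<longlonglongrightarrow> 0" unfolding C_def by real_asymp
    then show ?thesis using e by (intro order_tendstoD) auto
  qed
  ultimately show "\<forall>\<^sub>F n in sequentially. \<not> distinguishes \<epsilon> (A n) (case1 (1/20) 18 n) (case2 (1/20) 18 \<delta> n)"
  proof eventually_elim
    case (elim n)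
    define L where "L = ln (real n)"
    define t where "t = num_parts \<delta> n"
    define T where "T = num_edges n div t"
    define h where "h = n div t div 2 + 1"
    note pb = parameter_bounds[OF conjunct1[OF \<delta>] conjunct2[OF \<delta>] elim(3,4,5) t_def refl h_def T_def]
    interpret block_graph n t using pb(1,2) by unfold_locales auto
    have hH: "h = H" by (simp add: h_def H_def NL_def N_def)
    note pb = pb[unfolded hH]
    have L1: "L \<ge> 1" using elim(4) by (simp add: L_def)
    have n0: "real n > 0" using elim(3) by (metis not_numeral_le_zero of_nat_0_less_iff neq0_conv of_nat_0 real_sqrt_zero)
    show ?case
    proof
      assume "distinguishes \<epsilon> (A n) (case1 (1/20) 18 n) (case2 (1/20) 18 \<delta> n)"
      then have d: "distinguishes e (A n) (case1 (1/20) 18 n) (case2 (1/20) 18 \<delta> n)"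
        unfolding distinguishes_def e_def by (smt (verit))
      have sm: "2 * real H * exp (- (3/2) * ln (real n)) \<le> 1"
      proof -
        have "2 * real H * exp (- (3/2) * ln (real n)) \<le> 2 * real n * exp (- (3/2) * ln (real n))"
          using pb(7) by (intro mult_right_mono mult_left_mono) auto
        then show ?thesis using elim(6) by linarith
      qed
      have sb: "space_bounded (s n) (A n)" using As by blast
      note main = not_distinguishes[OF sb d e t_def[symmetric] T_def pb(4,5,6,3) sm elim(7)]
      have Hpos: "real H > 0" using pb(3) by simp
      have "3 * real T ^ 3 / real H ^ 4 \<le> 24000 * L ^ 3 / (sqrt (real n) / 2 - 1/2)"
      proof -
        have "real T ^ 3 \<le> (20 * real H * L) ^ 3" using pb(9) by (intro power_mono) (auto simp: L_def)
        then have "3 * real T ^ 3 / real H ^ 4 \<le> 3 * (20 * real H * L) ^ 3 / real H ^ 4"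
          by (intro divide_right_mono mult_left_mono) auto
        also have "\<dots> = 24000 * L ^ 3 / real H"
          using Hpos by (simp add: power_mult_distrib power3_eq_cube power4_eq_xxxx)
        also have "\<dots> \<le> 24000 * L ^ 3 / (sqrt (real n) / 2 - 1/2)"
        proof (intro divide_left_mono mult_pos_pos)
          show "0 < sqrt (real n) / 2 - 1/2" using elim(3) by linarith
        qed (use pb(8) L1 Hpos in auto)
        finally show ?thesis .
      qed
      moreover have "4 * real H * exp (- (3/2) * ln (real n)) \<le> 4 * real n * exp (- (3/2) * ln (real n))"
        using pb(7) by (intro mult_right_mono mult_left_mono) auto
      ultimately have "4 * real H * exp (- (3/2) * ln (real n)) + 3 * real T ^ 3 / real H ^ 4 + 2 * (real n * exp (- (5/4) * ln (real n))) \<le> err n"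
        unfolding err_def L_def by linarith
      then have E: "4 * real H * exp (- (3/2) * ln (real n)) + 3 * real T ^ 3 / real H ^ 4 + 2 * (real n * exp (- (5/4) * ln (real n))) < e / 2"
        using elim(8) by linarith
      \<comment> \<open>Here the space bound enters: t (s + 1) <= sqrt n / ln n, so t^2 (s + 1)^2 ln
        n / n is at most 1 / ln n. The constant is 1344 = 4 * 21 * 4 * 4, from
        \<open>kl_states_distance\<close>, T + 1 <= 21 H ln n, \<open>round_information\<close> and
        n / (4 t) <= H.\<close>
      have "4 * ((real T + 1) * (4 / (real H)\<^sup>2 * (real t * (C * (real (s n) + 1)\<^sup>2)))) \<le> 1344 * C / L"
      proof -
        define Z where "Z = real t * (C * (real (s n) + 1)\<^sup>2)"
        have Z0: "Z \<ge> 0" by (simp add: Z_def C_def)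
        have "real T + 1 \<le> 21 * real H * L"
        proof -
          have "1 * 1 \<le> real H * L" using pb(3) L1 by (intro mult_mono) auto
          then show ?thesis using pb(9) by (simp add: L_def)
        qed
        then have "4 * ((real T + 1) * (4 / (real H)\<^sup>2 * Z)) \<le> 4 * (21 * real H * L * (4 / (real H)\<^sup>2 * Z))"
          using Z0 by (intro mult_left_mono mult_right_mono) auto
        also have "\<dots> = 336 * L * Z / real H" using Hpos by (simp add: power2_eq_square field_simps)
        also have "\<dots> \<le> 336 * L * Z / (real n / (4 * real t))"
          using pb(11) pb(1) n0 L1 Z0 Hpos by (intro divide_left_mono) auto
        also have "\<dots> = 1344 * C * L * (real t * (real (s n) + 1))\<^sup>2 / real n"
          by (simp add: Z_def power2_eq_square)
        also have "\<dots> \<le> 1344 * C * L * (sqrt (real n) / L)\<^sup>2 / real n"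
        proof -
          have "real (s n) + 1 \<le> real n powr \<delta> / L" using elim(1,2) by (simp add: L_def)
          then have "real t * (real (s n) + 1) \<le> real n powr (1/2 - \<delta>) * (real n powr \<delta> / L)"
            using pb(10) by (intro mult_mono) auto
          also have "\<dots> = sqrt (real n) / L"
            using n0 by (simp add: powr_half_sqrt flip: powr_add)
          finally have "(real t * (real (s n) + 1))\<^sup>2 \<le> (sqrt (real n) / L)\<^sup>2" by (intro power_mono) auto
          then show ?thesis using L1 by (intro divide_right_mono mult_left_mono) (auto simp: C_def)
        qed
        also have "\<dots> = 1344 * C / L" using n0 L1 by (simp add: power_divide) (simp add: power2_eq_square)
        finally show ?thesis by (simp add: Z_def)
      qed
      then have "sqrt (4 * ((real T + 1) * (4 / (real H)\<^sup>2 * (real t * (C * (real (s n) + 1)\<^sup>2))))) < e"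
        using elim(9) by (smt (verit) L_def real_sqrt_le_mono)
      moreover have False if "2 * e \<le> 2 * a + b" "a < e / 2" "b < e" for a b using that by linarith
      ultimately show False using main E unfolding C_def by blast
    qed
  qed
qed simp

end
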